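(* A quasiconformal tree $X$ admits a bi-Lipschitz embedding into some Euclidean space if and only if its set of leaves $\mathcal{L}(X)$ (with the restricted metric) admits a bi-Lipschitz embedding into some Euclidean space.
   Context: A metric tree is a compact, connected, locally connected metric space in which each pair of distinct points forms the endpoints of a unique arc. A quasiconformal tree is a metric tree that is doubling (there is $N$ such that every ball can be covered by $N$ balls of half the radius) and bounded turning (there is $C$ such that each pair of points $x,y$ lies in a continuum of diameter at most $C\,d(x,y)$). The set of leaves is $\mathcal{L}(X)=\{x\in X: X\setminus\{x\}\text{ is connected}\}$. A bi-Lipschitz embedding is a map $f$ for which there is $L\ge1$ with $L^{-1}d(x,y)\le|f(x)-f(y)|\le L\,d(x,y)$ for all $x,y$. *)

theory Defs
  imports "HOL-Analysis.Analysis"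
begin

text \<open>Metric spaces are arbitrary subsets \<open>X\<close> of a type of class \<^class>\<open>metric_space\<close>, with the
  restricted metric and the subspace topology.\<close>

definition arc_between :: "'a::metric_space set \<Rightarrow> 'a \<Rightarrow> 'a \<Rightarrow> 'a set \<Rightarrow> bool" where
  "arc_between X x y A \<longleftrightarrow>
     A \<subseteq> X \<and> (\<exists>g. arc g \<and> path_image g = A \<and> pathstart g = x \<and> pathfinish g = y)"

text \<open>Uniqueness of the arc is uniqueness of the point set, not of its parametrization.\<close>

definition metric_tree :: "'a::metric_space set \<Rightarrow> bool" where
  "metric_tree X \<longleftrightarrow> compact X \<and> connected X \<and> locally connected X \<and>
     (\<forall>x\<in>X. \<forall>y\<in>X. x \<noteq> y \<longrightarrow> (\<exists>!A. arc_between X x y A))"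

text \<open>Balls are those of the space \<open>X\<close> itself; in particular all centres lie in \<open>X\<close>.\<close>

definition doubling :: "'a::metric_space set \<Rightarrow> bool" where
  "doubling X \<longleftrightarrow> (\<exists>N::nat. \<forall>x\<in>X. \<forall>r>0. \<exists>C\<subseteq>X. finite C \<and> card C \<le> N \<and>
     X \<inter> ball x r \<subseteq> (\<Union>c\<in>C. X \<inter> ball c (r / 2)))"

definition bounded_turning :: "'a::metric_space set \<Rightarrow> bool" where
  "bounded_turning X \<longleftrightarrow> (\<exists>C::real. \<forall>x\<in>X. \<forall>y\<in>X. \<exists>K\<subseteq>X.
     compact K \<and> connected K \<and> x \<in> K \<and> y \<in> K \<and> diameter K \<le> C * dist x y)"

definition quasiconformal_tree :: "'a::metric_space set \<Rightarrow> bool" where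
  "quasiconformal_tree X \<longleftrightarrow> metric_tree X \<and> doubling X \<and> bounded_turning X"

definition leaves :: "'a::metric_space set \<Rightarrow> 'a set" where
  "leaves X = {x \<in> X. connected (X - {x})}"

text \<open>The dimension has to be quantified inside a formula, so \<open>n\<close>-dimensional Euclidean space is the
  carrier of the library's \<^const>\<open>Euclidean_space\<close>, that is, the functions of type
  \<^typ>\<open>nat \<Rightarrow> real\<close> that vanish outside \<open>{..<n}\<close>, with the distance given by the
  Euclidean norm \<^const>\<open>L2_set\<close> of the difference.\<close>

definition euclidean_dist :: "nat \<Rightarrow> (nat \<Rightarrow> real) \<Rightarrow> (nat \<Rightarrow> real) \<Rightarrow> real" where
  "euclidean_dist n u v = L2_set (\<lambda>i. u i - v i) {..<n}"

definition bilipschitz_embedding ::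
    "'a::metric_space set \<Rightarrow> nat \<Rightarrow> ('a \<Rightarrow> nat \<Rightarrow> real) \<Rightarrow> bool" where
  "bilipschitz_embedding X n f \<longleftrightarrow> f \<in> X \<rightarrow> topspace (Euclidean_space n) \<and>
     (\<exists>L\<ge>1. \<forall>x\<in>X. \<forall>y\<in>X.
        inverse L * dist x y \<le> euclidean_dist n (f x) (f y) \<and>
        euclidean_dist n (f x) (f y) \<le> L * dist x y)"

definition bilipschitz_embeds_Euclidean :: "'a::metric_space set \<Rightarrow> bool" where
  "bilipschitz_embeds_Euclidean X \<longleftrightarrow> (\<exists>n f. bilipschitz_embedding X n f)"

end

theory Submission
  imports Defs
begin

text \<open>Every quasiconformal tree \<open>X\<close> is covered near a point \<open>x\<close> that is not a limit of leaves, at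
  scale the distance from \<open>x\<close> to the leaves, by a bounded number of arcs from \<open>x\<close>: each arc through a
  nearby point continues to a leaf, and two of these arcs that part close to \<open>x\<close> have
  well separated points on a sphere around \<open>x\<close>, so doubling bounds their number. Arcs of
  bounded turning in a doubling space embed with uniform constants, hence so do these finite
  unions, and a Whitney decomposition of the complement of the leaves glues the local embeddings to
  the given embedding of the leaves.

  To embed an arc, subdivide it into nested intervals of endpoint distance about \<open>r0 * \<rho> ^ k\<close> and let
  functions be linear on each interval with respect to the weights that share out an interval in
  proportion to the endpoint distances of its children. By the triangle inequality the slope of
  such a function can only decrease from one level to the next. Whenever it has
  dropped to one half, a new zigzag is started in the next of \<open>m\<close> cyclically used blocks of coordinates. The
  slopes in a block then sum up like a geometric series, which makes the map Lipschitz, and at every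
  place and scale one block has a slope bounded from below.\<close>

section \<open>Lipschitz coordinates\<close>

text \<open>Dimension and distortion must be uniform over infinitely many pieces, so an embedding is
  kept as a pair \<open>n\<close>, \<open>L\<close> with coordinates that are Lipschitz on the whole
  type. These can be evaluated off their piece, truncated and glued, and each pair of points is
  detected by a single coordinate. The obstacle lies in the arcs: a quasi-arc can be rectifiable in
  one place and snowflake-like in another. New zigzags on every level would add up without bound on
  a straight stretch, while a single one would flatten out on a snowflake. The slope that is left
  tells the two apart, so the restarts follow it and not the level. The cyclic blocks have two
  purposes. When a block has its turn again, its old zigzag has lost a factor
  \<open>(1 / 2) ^ m\<close> and cannot spoil the new direction. And over a bounded range of levels
  more than half of the blocks are not restarted at all, which is needed for points in adjacent
  intervals with different histories. The implication from \<open>X\<close> to its leaves is mere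
  restriction.\<close>

definition coord_embeds :: "nat \<Rightarrow> real \<Rightarrow> 'a::metric_space set \<Rightarrow> bool" where
  "coord_embeds n L S \<longleftrightarrow> (\<exists>f::nat \<Rightarrow> 'a \<Rightarrow> real. (\<forall>j. L-lipschitz_on UNIV (f j)) \<and>
     (\<forall>x\<in>S. \<forall>y\<in>S. x \<noteq> y \<longrightarrow> (\<exists>j<n. dist x y \<le> L * \<bar>f j x - f j y\<bar>)))"

lemma lipschitz_on_real_leD:
  fixes f :: "'a::metric_space \<Rightarrow> real"
  assumes "L-lipschitz_on S f" "x \<in> S" "y \<in> S"
  shows "f x \<le> f y + L * dist x y"
  using lipschitz_onD[OF assms] by (simp add: dist_real_def)

lemma lipschitz_on_realI:
  fixes f :: "'a::metric_space \<Rightarrow> real"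
  assumes "0 \<le> L" "\<And>x y. x \<in> S \<Longrightarrow> y \<in> S \<Longrightarrow> f x \<le> f y + L * dist x y"
  shows "L-lipschitz_on S f"
proof (rule lipschitz_onI)
  fix x y assume "x \<in> S" "y \<in> S"
  then show "dist (f x) (f y) \<le> L * dist x y"
    using assms(2)[of x y] assms(2)[of y x] by (simp add: dist_real_def dist_commute abs_le_iff)
qed (fact assms)

text \<open>The lower envelope of the cones \<open>f s + L * dist x s\<close> is the greatest
  \<open>L\<close>-Lipschitz extension. Comparison with one fixed \<open>s0\<close> shows that the
  infimum is finite.\<close>

lemma mcshane_extension:
  fixes f :: "'a::metric_space \<Rightarrow> real"
  assumes "L-lipschitz_on S f"
  obtains g where "L-lipschitz_on UNIV g" "\<And>x. x \<in> S \<Longrightarrow> g x = f x"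
proof (cases "S = {}")
  case True
  show thesis
    by (rule that[of "\<lambda>_. 0"]) (use True lipschitz_on_nonneg[OF assms] in \<open>auto intro: lipschitz_onI\<close>)
next
  case False
  then obtain s0 where s0: "s0 \<in> S" by auto
  have L: "0 \<le> L" by (rule lipschitz_on_nonneg[OF assms])
  define g where "g = (\<lambda>x. INF s\<in>S. f s + L * dist x s)"
  have bdd: "bdd_below ((\<lambda>s. f s + L * dist x s) ` S)" for x
  proof (rule bdd_belowI2)
    fix s assume s: "s \<in> S"
    have "f s0 \<le> f s + L * dist s0 s" by (rule lipschitz_on_real_leD[OF assms s0 s])
    also have "L * dist s0 s \<le> L * (dist s0 x + dist x s)" by (intro mult_left_mono dist_triangle L)
    finally show "f s0 - L * dist s0 x \<le> f s + L * dist x s" by (simp add: algebra_simps)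
  qed
  have "L-lipschitz_on UNIV g"
  proof (rule lipschitz_on_realI[OF L])
    fix x y :: 'a
    have "g x - L * dist x y \<le> g y"
      unfolding g_def
    proof (rule cINF_greatest[OF False])
      fix s assume s: "s \<in> S"
      have "(INF s\<in>S. f s + L * dist x s) \<le> f s + L * dist x s" by (rule cINF_lower[OF bdd s])
      also have "L * dist x s \<le> L * (dist x y + dist y s)"
        by (intro mult_left_mono dist_triangle L)
      finally show "(INF s\<in>S. f s + L * dist x s) - L * dist x y \<le> f s + L * dist y s"
        by (simp add: algebra_simps)
    qed
    then show "g x \<le> g y + L * dist x y" by simp
  qed
  moreover have "g x = f x" if x: "x \<in> S" for x
  proof (rule antisym)
    show "g x \<le> f x" unfolding g_def using cINF_lower[OF bdd x, of x] by simp
    show "f x \<le> g x" unfolding g_def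
      by (rule cINF_greatest[OF False]) (rule lipschitz_on_real_leD[OF assms x])
  qed
  ultimately show thesis by (rule that)
qed

text \<open>Coordinates may be indexed by any finite set and need only be controlled on
  \<open>S\<close>; the McShane extension supplies the globally Lipschitz functions. Numbers from
  \<open>card I\<close> on get the zero function.\<close>

lemma coord_embedsI:
  fixes f :: "'i \<Rightarrow> 'a::metric_space \<Rightarrow> real"
  assumes I: "finite I" "card I \<le> n" and L: "0 \<le> L"
    and lip: "\<And>i x y. i \<in> I \<Longrightarrow> x \<in> S \<Longrightarrow> y \<in> S \<Longrightarrow> \<bar>f i x - f i y\<bar> \<le> L * dist x y"
    and sep: "\<And>x y. x \<in> S \<Longrightarrow> y \<in> S \<Longrightarrow> x \<noteq> y \<Longrightarrow> \<exists>i\<in>I. dist x y \<le> L * \<bar>f i x - f i y\<bar>"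
  shows "coord_embeds n L S"
proof -
  have "\<exists>g. L-lipschitz_on UNIV g \<and> (\<forall>x\<in>S. g x = f i x)" if "i \<in> I" for i
  proof -
    have "L-lipschitz_on S (f i)"
      using lip[OF that] L by (intro lipschitz_onI) (auto simp: dist_real_def)
    from mcshane_extension[OF this] show ?thesis by metis
  qed
  then obtain g where g: "\<And>i. i \<in> I \<Longrightarrow> L-lipschitz_on UNIV (g i)"
      "\<And>i x. i \<in> I \<Longrightarrow> x \<in> S \<Longrightarrow> g i x = f i x"
    by metis
  obtain e where e: "bij_betw e {0..<card I} I" using ex_bij_betw_nat_finite[OF I(1)] by auto
  define h where "h = (\<lambda>j. if j < card I then g (e j) else (\<lambda>_. 0))"
  have "L-lipschitz_on UNIV (h j)" for j
  proof (cases "j < card I")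
    case True
    then have "e j \<in> I" using e by (auto simp: bij_betw_def)
    then show ?thesis using g(1)[of "e j"] True by (simp add: h_def)
  qed (use L in \<open>auto simp: h_def intro: lipschitz_onI\<close>)
  moreover have "\<exists>j<n. dist x y \<le> L * \<bar>h j x - h j y\<bar>" if "x \<in> S" "y \<in> S" "x \<noteq> y" for x y
  proof -
    obtain i where i: "i \<in> I" "dist x y \<le> L * \<bar>f i x - f i y\<bar>" using sep[OF \<open>x \<in> S\<close> \<open>y \<in> S\<close> \<open>x \<noteq> y\<close>] by auto
    then obtain j where j: "j < card I" "i = e j" using e by (fastforce simp: bij_betw_def)
    then show ?thesis using i g(2) that I(2) by (intro exI[of _ j]) (auto simp: h_def)
  qed
  ultimately show ?thesis unfolding coord_embeds_def by blast
qed

lemma coord_embedsE: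
  assumes "coord_embeds n L S"
  obtains f :: "nat \<Rightarrow> 'a::metric_space \<Rightarrow> real"
  where "\<And>j. L-lipschitz_on UNIV (f j)" "\<And>j x y. \<bar>f j x - f j y\<bar> \<le> L * dist x y" "0 \<le> L"
    "\<And>x y. x \<in> S \<Longrightarrow> y \<in> S \<Longrightarrow> x \<noteq> y \<Longrightarrow> \<exists>j<n. dist x y \<le> L * \<bar>f j x - f j y\<bar>"
proof -
  obtain f :: "nat \<Rightarrow> 'a \<Rightarrow> real" where f: "\<And>j. L-lipschitz_on UNIV (f j)"
    "\<And>x y. x \<in> S \<Longrightarrow> y \<in> S \<Longrightarrow> x \<noteq> y \<Longrightarrow> \<exists>j<n. dist x y \<le> L * \<bar>f j x - f j y\<bar>"
    using assms unfolding coord_embeds_def by blast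
  have "\<bar>f j x - f j y\<bar> \<le> L * dist x y" for j x y
    using lipschitz_onD[OF f(1), of x y] by (simp add: dist_real_def)
  moreover have "0 \<le> L" using lipschitz_on_nonneg[OF f(1)] .
  ultimately show thesis using that f by blast
qed

lemma coord_embeds_mono:
  assumes "coord_embeds n L S" "T \<subseteq> S" "n \<le> n'" "L \<le> L'"
  shows "coord_embeds n' L' T"
proof -
  obtain f :: "nat \<Rightarrow> 'a \<Rightarrow> real" where f: "\<And>j x y. \<bar>f j x - f j y\<bar> \<le> L * dist x y" "0 \<le> L"
    "\<And>x y. x \<in> S \<Longrightarrow> y \<in> S \<Longrightarrow> x \<noteq> y \<Longrightarrow> \<exists>j<n. dist x y \<le> L * \<bar>f j x - f j y\<bar>"
    using coord_embedsE[OF assms(1)] by metis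
  show ?thesis
  proof (rule coord_embedsI[of "{..<n'}" _ _ _ f])
    show "\<bar>f j x - f j y\<bar> \<le> L' * dist x y" for j x y
      by (rule order_trans[OF f(1)]) (simp add: assms(4) mult_right_mono)
    fix x y assume "x \<in> T" "y \<in> T" "x \<noteq> y"
    then obtain j where "j < n" "dist x y \<le> L * \<bar>f j x - f j y\<bar>" using f(3) assms(2) by blast
    moreover have "L * \<bar>f j x - f j y\<bar> \<le> L' * \<bar>f j x - f j y\<bar>" by (simp add: assms(4) mult_right_mono)
    ultimately show "\<exists>j\<in>{..<n'}. dist x y \<le> L' * \<bar>f j x - f j y\<bar>"
      using assms(3) by (intro bexI[of _ j]) auto
  qed (use assms f(2) in auto)
qed

lemma coord_embeds_closure:
  assumes "coord_embeds n L S" "T \<subseteq> closure S"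
  shows "coord_embeds n (2 * L + 1) T"
proof -
  obtain f :: "nat \<Rightarrow> 'a \<Rightarrow> real" where f: "\<And>j x y. \<bar>f j x - f j y\<bar> \<le> L * dist x y" "0 \<le> L"
    "\<And>x y. x \<in> S \<Longrightarrow> y \<in> S \<Longrightarrow> x \<noteq> y \<Longrightarrow> \<exists>j<n. dist x y \<le> L * \<bar>f j x - f j y\<bar>"
    using coord_embedsE[OF assms(1)] by metis
  show ?thesis
  proof (rule coord_embedsI[of "{..<n}" _ _ _ f])
    show "\<bar>f j x - f j y\<bar> \<le> (2 * L + 1) * dist x y" for j x y
      by (rule order_trans[OF f(1)]) (use f(2) in \<open>simp add: mult_right_mono\<close>)
    fix x y assume xy: "x \<in> T" "y \<in> T" "x \<noteq> y"
    define d where "d = dist x y"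
    have d: "d > 0" using xy by (simp add: d_def)
    \<comment> \<open>Moving both points by less than \<open>e = d / c\<close> costs at most
      \<open>2 * e\<close> in distance and \<open>2 * L * L * e\<close> in \<open>L\<close> times
      the coordinate difference, together \<open>d / 2\<close>.\<close>
    define c where "c = 4 * (1 + L * L)"
    define e where "e = d / c"
    have LL: "0 \<le> L * L" using f(2) by simp
    have c: "c > 0" unfolding c_def by (rule mult_pos_pos) (use LL in linarith)+
    have e: "e > 0" using d c by (simp add: e_def)
    have "c * e = d" using c by (simp add: e_def)
    then have e4: "4 * e + 4 * (L * L * e) = d" by (simp add: c_def algebra_simps)
    obtain x' y' where x': "x' \<in> S" "dist x' x < e" and y': "y' \<in> S" "dist y' y < e"
      using xy assms(2) e by (metis closure_approachable subsetD)
    have "d \<le> dist x x' + dist x' y' + dist y' y"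
      unfolding d_def by (metis dist_triangle_le dist_triangle add.assoc add_left_mono order_trans)
    then have d1: "d - 2 * e \<le> dist x' y'" using x' y' by (simp add: dist_commute)
    have "d - 2 * e > 0" using e4 LL e mult_nonneg_nonneg[OF LL less_imp_le[OF e]] by linarith
    then have "x' \<noteq> y'" using d1 by auto
    then obtain j where j: "j < n" "dist x' y' \<le> L * \<bar>f j x' - f j y'\<bar>" using f(3) x' y' by blast
    have "\<bar>f j x' - f j y'\<bar> \<le> \<bar>f j x - f j y\<bar> + \<bar>f j x' - f j x\<bar> + \<bar>f j y' - f j y\<bar>" by linarith
    also have "\<dots> \<le> \<bar>f j x - f j y\<bar> + L * e + L * e"
      using f(1)[of j x' x] f(1)[of j y' y] mult_left_mono[OF less_imp_le[OF x'(2)] f(2)]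
        mult_left_mono[OF less_imp_le[OF y'(2)] f(2)] by linarith
    finally have "L * \<bar>f j x' - f j y'\<bar> \<le> L * (\<bar>f j x - f j y\<bar> + L * e + L * e)"
      using f(2) by (rule mult_left_mono)
    then have "d - 2 * e \<le> L * \<bar>f j x - f j y\<bar> + 2 * (L * L * e)"
      using j(2) d1 by (simp add: algebra_simps)
    then have "d \<le> 2 * (L * \<bar>f j x - f j y\<bar>)" using e4 by linarith
    then have "dist x y \<le> (2 * L + 1) * \<bar>f j x - f j y\<bar>"
      by (simp add: d_def algebra_simps)
    then show "\<exists>j\<in>{..<n}. dist x y \<le> (2 * L + 1) * \<bar>f j x - f j y\<bar>" using j(1) by auto
  qed (use f(2) in auto)
qed

lemma infdist_lessE:
  assumes "infdist x A < e" "A \<noteq> {}"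
  obtains a where "a \<in> A" "dist x a < e"
  using assms by (auto simp: infdist_notempty cINF_less_iff)

text \<open>A point of one piece and a point outside it are separated either by the distance to that
  piece or by the coordinates of that piece, read off at a nearly closest point.\<close>

lemma coord_embeds_UN:
  fixes S :: "'i \<Rightarrow> 'a::metric_space set"
  assumes "finite I" "card I \<le> N" "1 \<le> L" "\<And>i. i \<in> I \<Longrightarrow> coord_embeds n L (S i)"
  shows "coord_embeds (N * Suc n) (3 * L\<^sup>2) (\<Union>i\<in>I. S i)"
proof -
  have "\<exists>f. (\<forall>j x y. \<bar>f j x - f j y\<bar> \<le> L * dist x y) \<and>
    (\<forall>x\<in>S i. \<forall>y\<in>S i. x \<noteq> y \<longrightarrow> (\<exists>j<n. dist x y \<le> L * \<bar>f j x - f j y\<bar>))" if "i \<in> I" for i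
    using coord_embedsE[OF assms(4)[OF that]] by metis
  then obtain f where f: "\<And>i j x y. i \<in> I \<Longrightarrow> \<bar>f i j x - f i j y\<bar> \<le> L * dist x y"
     "\<And>i x y. i \<in> I \<Longrightarrow> x \<in> S i \<Longrightarrow> y \<in> S i \<Longrightarrow> x \<noteq> y \<Longrightarrow> \<exists>j<n. dist x y \<le> L * \<bar>f i j x - f i j y\<bar>"
    by metis
  have L1: "L \<le> L\<^sup>2" "1 \<le> L\<^sup>2" using assms(3) by (auto simp: power2_eq_square mult_ge1_I)
  then have L3: "0 < 3 * L\<^sup>2" by linarith
  define g where "g = (\<lambda>(i,j). if j < n then f i j else (\<lambda>x. infdist x (S i)))"
  show ?thesis
  proof (rule coord_embedsI[of "I \<times> {..<Suc n}" _ _ _ g])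
    show "card (I \<times> {..<Suc n}) \<le> N * Suc n"
      unfolding card_cartesian_product card_lessThan by (rule mult_le_mono1[OF assms(2)])
    show "\<bar>g ij x - g ij y\<bar> \<le> 3 * L\<^sup>2 * dist x y" if "ij \<in> I \<times> {..<Suc n}" for ij x y
    proof -
      have "\<bar>g ij x - g ij y\<bar> \<le> L * dist x y"
      proof (cases "snd ij < n")
        case True
        then show ?thesis using that f(1) by (auto simp: g_def split: prod.splits)
      next
        case False
        have "\<bar>infdist x (S (fst ij)) - infdist y (S (fst ij))\<bar> \<le> dist x y"
          by (rule infdist_triangle_abs)
        also have "dist x y \<le> L * dist x y" using assms(3) mult_right_mono[of 1 L "dist x y"] by simp
        finally show ?thesis using False by (cases ij) (simp add: g_def)
      qed
      also have "L * dist x y \<le> 3 * L\<^sup>2 * dist x y" using L1 by (intro mult_right_mono) auto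
      finally show ?thesis .
    qed
    fix x y assume xy: "x \<in> (\<Union>i\<in>I. S i)" "y \<in> (\<Union>i\<in>I. S i)" "x \<noteq> y"
    then obtain i where i: "i \<in> I" "x \<in> S i" by auto
    define d where "d = dist x y"
    have d: "d > 0" using xy by (simp add: d_def)
    show "\<exists>ij\<in>I \<times> {..<Suc n}. dist x y \<le> 3 * L\<^sup>2 * \<bar>g ij x - g ij y\<bar>"
    \<comment> \<open>Replacing \<open>y\<close> by a point of \<open>S i\<close> closer than this
      threshold costs less than \<open>d / 3\<close> in the distance and less than
      \<open>d / 3\<close> in \<open>L\<close> times a coordinate, so a third of \<open>d\<close>
      survives.\<close>
    proof (cases "infdist y (S i) \<ge> d / (3 * L\<^sup>2)")
      case True
      have "infdist x (S i) = 0" using i by simp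
      then have "d \<le> 3 * L\<^sup>2 * \<bar>g (i,n) x - g (i,n) y\<bar>"
        using True L3 by (simp add: g_def pos_divide_le_eq[OF L3] mult.commute infdist_nonneg)
      then show ?thesis using i by (intro bexI[of _ "(i,n)"]) (auto simp: d_def)
    next
      case False
      then obtain z where z: "z \<in> S i" "dist y z < d / (3 * L\<^sup>2)"
        using infdist_lessE[of y "S i"] i by (metis empty_iff not_le)
      have zd: "3 * L\<^sup>2 * dist y z < d"
        using z(2) unfolding pos_less_divide_eq[OF L3] by (simp only: mult.commute)
      have dyz: "3 * dist y z < d" using zd L1 mult_right_mono[of 1 "L\<^sup>2" "dist y z"] by simp
      have dxz: "d \<le> dist x z + dist y z" unfolding d_def by (metis dist_triangle dist_commute)
      have "x \<noteq> z"
      proof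
        assume "x = z"
        then show False using dxz dyz d by simp
      qed
      then obtain j where j: "j < n" "dist x z \<le> L * \<bar>f i j x - f i j z\<bar>" using f(2) i z by blast
      have "\<bar>f i j x - f i j z\<bar> \<le> \<bar>f i j x - f i j y\<bar> + L * dist y z"
        using f(1)[OF i(1), of j y z] by linarith
      then have "L * \<bar>f i j x - f i j z\<bar> \<le> L * (\<bar>f i j x - f i j y\<bar> + L * dist y z)"
        using assms(3) by (intro mult_left_mono) auto
      then have "dist x z \<le> L * \<bar>f i j x - f i j y\<bar> + L\<^sup>2 * dist y z"
        using j(2) by (simp add: algebra_simps power2_eq_square)
      then have "d \<le> 3 * (L * \<bar>f i j x - f i j y\<bar>)" using zd dxz dyz by linarith
      also have "\<dots> \<le> 3 * (L\<^sup>2 * \<bar>f i j x - f i j y\<bar>)" using L1 by (simp add: mult_right_mono)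
      finally show ?thesis using i j by (intro bexI[of _ "(i,j)"]) (auto simp: g_def d_def)
    qed
  qed (use assms in auto)
qed

lemma abs_le_L2_set: "finite A \<Longrightarrow> i \<in> A \<Longrightarrow> \<bar>f i\<bar> \<le> L2_set f A"
  using member_le_L2_set[of A i "\<lambda>i. \<bar>f i\<bar>"] by (simp add: L2_set_def)

lemma bilipschitz_embeds_Euclidean_iff:
  fixes S :: "'a::metric_space set"
  shows "bilipschitz_embeds_Euclidean S \<longleftrightarrow> (\<exists>n L. coord_embeds n L S)"
proof
  assume "bilipschitz_embeds_Euclidean S"
  then obtain n f L where L: "1 \<le> L"
    and lo: "\<And>x y. x \<in> S \<Longrightarrow> y \<in> S \<Longrightarrow> inverse L * dist x y \<le> euclidean_dist n (f x) (f y)"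
    and hi: "\<And>x y. x \<in> S \<Longrightarrow> y \<in> S \<Longrightarrow> euclidean_dist n (f x) (f y) \<le> L * dist x y"
    unfolding bilipschitz_embeds_Euclidean_def bilipschitz_embedding_def by blast
  \<comment> \<open>If all \<open>n\<close> coordinate differences were below
    \<open>dist x y / L'\<close>, their sum would be at most \<open>n / (n + 1)\<close> times
    \<open>dist x y / L\<close>. The added 1 makes this contradict the lower bound, also for
    \<open>n = 0\<close>.\<close>
  define L' where "L' = L * (1 + real n)"
  have LL': "L \<le> L'" using L by (simp add: L'_def algebra_simps)
  have "coord_embeds n L' S"
  proof (rule coord_embedsI[of "{..<n}" _ _ _ "\<lambda>j x. f x j"])
    show "\<bar>f x j - f y j\<bar> \<le> L' * dist x y" if "j \<in> {..<n}" "x \<in> S" "y \<in> S" for j x y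
    proof -
      have "\<bar>f x j - f y j\<bar> \<le> euclidean_dist n (f x) (f y)"
        unfolding euclidean_dist_def
        using that by (intro abs_le_L2_set[of _ _ "\<lambda>i. f x i - f y i"]) auto
      also have "\<dots> \<le> L * dist x y" by (rule hi[OF that(2,3)])
      also have "\<dots> \<le> L' * dist x y" using LL' by (simp add: mult_right_mono)
      finally show ?thesis .
    qed
    fix x y assume xy: "x \<in> S" "y \<in> S" "x \<noteq> y"
    show "\<exists>j\<in>{..<n}. dist x y \<le> L' * \<bar>f x j - f y j\<bar>"
    proof (rule ccontr)
      assume "\<not> ?thesis"
      then have less: "L' * \<bar>f x j - f y j\<bar> < dist x y" if "j < n" for j using that by force
      have "euclidean_dist n (f x) (f y) \<le> (\<Sum>j<n. \<bar>f x j - f y j\<bar>)"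
        unfolding euclidean_dist_def by (rule L2_set_le_sum_abs)
      also have "\<dots> \<le> (\<Sum>j<n. dist x y / L')"
        using less L LL' by (intro sum_mono) (auto simp: field_simps less_imp_le)
      finally have "inverse L * dist x y \<le> real n * dist x y / L'" using lo[OF xy(1,2)] by simp
      then have "inverse L * dist x y * L' \<le> real n * dist x y"
        using L LL' by (simp add: pos_le_divide_eq)
      moreover have "inverse L * dist x y * L' = (1 + real n) * dist x y" using L by (simp add: L'_def)
      ultimately have "dist x y \<le> 0" by (simp add: algebra_simps)
      then show False using xy(3) by simp
    qed
  qed (use L LL' in auto)
  then show "\<exists>n L. coord_embeds n L S" by blast
next
  assume "\<exists>n L. coord_embeds n L S"
  then obtain n L where nL: "coord_embeds n L S" by blast
  obtain f :: "nat \<Rightarrow> 'a \<Rightarrow> real" where f: "\<And>j x y. \<bar>f j x - f j y\<bar> \<le> L * dist x y" "0 \<le> L"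
    "\<And>x y. x \<in> S \<Longrightarrow> y \<in> S \<Longrightarrow> x \<noteq> y \<Longrightarrow> \<exists>j<n. dist x y \<le> L * \<bar>f j x - f j y\<bar>"
    using coord_embedsE[OF nL] by metis
  define F where "F = (\<lambda>x j. if j < n then f j x else 0)"
  define L' where "L' = 1 + L * (1 + real n)"
  have L': "1 \<le> L'" "L \<le> L'" "real n * L \<le> L'" using f(2) by (auto simp: L'_def algebra_simps)
  have "bilipschitz_embedding S n F"
    unfolding bilipschitz_embedding_def
  proof (intro conjI exI[of _ L'] ballI)
    show "F \<in> S \<rightarrow> topspace (Euclidean_space n)"
      by (auto simp: F_def topspace_Euclidean_space)
    show "1 \<le> L'" by (rule L')
    fix x y assume xy: "x \<in> S" "y \<in> S"
    have "euclidean_dist n (F x) (F y) \<le> (\<Sum>j<n. \<bar>F x j - F y j\<bar>)"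
      unfolding euclidean_dist_def by (rule L2_set_le_sum_abs)
    also have "\<dots> \<le> (\<Sum>j<n. L * dist x y)" by (intro sum_mono) (auto simp: F_def f(1))
    also have "\<dots> = real n * L * dist x y" by simp
    also have "\<dots> \<le> L' * dist x y" using L'(3) by (simp add: mult_right_mono)
    finally show "euclidean_dist n (F x) (F y) \<le> L' * dist x y" .
    show "inverse L' * dist x y \<le> euclidean_dist n (F x) (F y)"
    proof (cases "x = y")
      case False
      then obtain j where j: "j < n" "dist x y \<le> L * \<bar>f j x - f j y\<bar>" using f(3) xy by blast
      have "\<bar>f j x - f j y\<bar> \<le> euclidean_dist n (F x) (F y)"
        unfolding euclidean_dist_def
        using abs_le_L2_set[of "{..<n}" j "\<lambda>i. F x i - F y i"] j by (auto simp: F_def)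
      then have "L * \<bar>f j x - f j y\<bar> \<le> L' * euclidean_dist n (F x) (F y)"
        using L' f(2) by (intro mult_mono) auto
      then show ?thesis using j(2) L'(1) by (simp add: field_simps)
    qed (simp add: euclidean_dist_def)
  qed
  then show "bilipschitz_embeds_Euclidean S" unfolding bilipschitz_embeds_Euclidean_def by blast
qed

section \<open>Doubling and separated sets\<close>

definition separated :: "real \<Rightarrow> 'a::metric_space set \<Rightarrow> bool" where
  "separated e S \<longleftrightarrow> (\<forall>a\<in>S. \<forall>b\<in>S. a \<noteq> b \<longrightarrow> e \<le> dist a b)"

text \<open>The packing form of doubling. It yields counts directly, and one \<open>M\<close> serves
  all centres and radii, which makes every count uniform over the scales.\<close>

definition separation_bound :: "'a::metric_space set \<Rightarrow> real \<Rightarrow> nat \<Rightarrow> bool" where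
  "separation_bound X e M \<longleftrightarrow>
     (\<forall>x\<in>X. \<forall>R>0. \<forall>S \<subseteq> X \<inter> ball x R. separated (e * R) S \<longrightarrow> finite S \<and> card S \<le> M)"

lemma doubling_iterated_cover:
  assumes N: "\<forall>x\<in>X. \<forall>r>0. \<exists>C\<subseteq>X. finite C \<and> card C \<le> N \<and> X \<inter> ball x r \<subseteq> (\<Union>c\<in>C. X \<inter> ball c (r / 2))"
    and "x \<in> X" "0 < r"
  shows "\<exists>C\<subseteq>X. finite C \<and> card C \<le> N ^ j \<and> X \<inter> ball x r \<subseteq> (\<Union>c\<in>C. X \<inter> ball c (r / 2 ^ j))"
proof (induction j)
  case 0
  show ?case using assms by (intro exI[of _ "{x}"]) auto
next
  case (Suc j)
  then obtain C where C: "C \<subseteq> X" "finite C" "card C \<le> N ^ j"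
    "X \<inter> ball x r \<subseteq> (\<Union>c\<in>C. X \<inter> ball c (r / 2 ^ j))" by blast
  have "\<forall>c\<in>C. \<exists>C'\<subseteq>X. finite C' \<and> card C' \<le> N \<and>
      X \<inter> ball c (r / 2 ^ j) \<subseteq> (\<Union>d\<in>C'. X \<inter> ball d (r / 2 ^ j / 2))"
    using N C(1) \<open>0 < r\<close> by (metis subsetD divide_pos_pos zero_less_numeral zero_less_power)
  then obtain K where K: "\<And>c. c \<in> C \<Longrightarrow> K c \<subseteq> X \<and> finite (K c) \<and> card (K c) \<le> N \<and>
      X \<inter> ball c (r / 2 ^ j) \<subseteq> (\<Union>d\<in>K c. X \<inter> ball d (r / 2 ^ j / 2))"
    by metis
  have "card (\<Union>c\<in>C. K c) \<le> (\<Sum>c\<in>C. card (K c))" by (rule card_UN_le[OF C(2)])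
  also have "\<dots> \<le> (\<Sum>c\<in>C. N)" using K by (intro sum_mono) auto
  also have "\<dots> \<le> N ^ Suc j" using C(3) by (simp add: mult.commute)
  finally have "card (\<Union>c\<in>C. K c) \<le> N ^ Suc j" .
  moreover have "X \<inter> ball x r \<subseteq> (\<Union>d\<in>(\<Union>c\<in>C. K c). X \<inter> ball d (r / 2 ^ Suc j))"
  proof
    fix y assume y: "y \<in> X \<inter> ball x r"
    then obtain c where c: "c \<in> C" "y \<in> X \<inter> ball c (r / 2 ^ j)" using C(4) by blast
    then obtain d where "d \<in> K c" "y \<in> X \<inter> ball d (r / 2 ^ j / 2)" using K by blast
    then show "y \<in> (\<Union>d\<in>(\<Union>c\<in>C. K c). X \<inter> ball d (r / 2 ^ Suc j))"
      using c by (auto simp: field_simps)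
  qed
  ultimately show ?case
    using K C by (intro exI[of _ "\<Union>c\<in>C. K c"]) auto
qed

text \<open>With \<open>2 / e < 2 ^ j\<close>, a ball of radius \<open>R / 2 ^ j\<close> has room
  for only one point of an \<open>e * R\<close>-separated set, so such a set injects into the
  centres of the \<open>j\<close>-fold iterated cover.\<close>

lemma doubling_imp_separation_bound:
  assumes "doubling X" "0 < e"
  obtains M where "separation_bound X e M"
proof -
  obtain N where N: "\<forall>x\<in>X. \<forall>r>0. \<exists>C\<subseteq>X. finite C \<and> card C \<le> N \<and>
      X \<inter> ball x r \<subseteq> (\<Union>c\<in>C. X \<inter> ball c (r / 2))"
    using assms(1) unfolding doubling_def by blast
  obtain j where j: "2 / e < 2 ^ j" using real_arch_pow[of 2 "2 / e"] by auto
  have "separation_bound X e (N ^ j)"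
    unfolding separation_bound_def
  proof (intro ballI allI impI)
    fix x R S assume x: "x \<in> X" and R: "0 < R" and S: "S \<subseteq> X \<inter> ball x R" and sep: "separated (e * R) S"
    obtain C where C: "C \<subseteq> X" "finite C" "card C \<le> N ^ j"
      "X \<inter> ball x R \<subseteq> (\<Union>c\<in>C. X \<inter> ball c (R / 2 ^ j))"
      using doubling_iterated_cover[OF N x R, of j] by blast
    have "\<forall>s\<in>S. \<exists>c\<in>C. dist c s < R / 2 ^ j" using S C(4) by (fastforce simp: subset_iff)
    then obtain h where h: "\<And>s. s \<in> S \<Longrightarrow> h s \<in> C \<and> dist (h s) s < R / 2 ^ j" by metis
    have "inj_on h S"
    proof (rule inj_onI, rule ccontr)
      fix s t assume st: "s \<in> S" "t \<in> S" "h s = h t" "s \<noteq> t"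
      have "e * R \<le> dist s t" using sep st by (auto simp: separated_def)
      also have "\<dots> \<le> dist (h s) s + dist (h s) t" by (rule dist_triangle3)
      also have "\<dots> < R / 2 ^ j + R / 2 ^ j" using h[OF st(1)] h[OF st(2)] st(3) by simp
      finally have "e * R < 2 * R / 2 ^ j" by simp
      then have "e * 2 ^ j < 2" using R by (simp add: field_simps)
      then show False using j assms(2) by (simp add: field_simps)
    qed
    moreover have "h ` S \<subseteq> C" using h by blast
    ultimately show "finite S \<and> card S \<le> N ^ j"
      using C by (meson card_inj_on_le finite_imageD finite_subset order_trans)
  qed
  then show thesis by (rule that)
qed

text \<open>A separated subset of greatest cardinality is a net, because a point far from all of it
  could be added. The alternative \<open>a = s\<close> accounts for the net points themselves, as
  \<open>e\<close> is not assumed positive.\<close>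

lemma separation_bound_net:
  assumes M: "separation_bound X e M" and "x \<in> X" "0 < R" "A \<subseteq> X \<inter> ball x R"
  obtains S where "S \<subseteq> A" "finite S" "card S \<le> M" "separated (e * R) S"
    "\<And>a. a \<in> A \<Longrightarrow> \<exists>s\<in>S. dist a s < e * R \<or> a = s"
proof -
  define P where "P = (\<lambda>S. S \<subseteq> A \<and> separated (e * R) S)"
  have fin: "finite S \<and> card S \<le> M" if "P S" for S
    using M assms(2-4) that unfolding separation_bound_def P_def by (meson order_trans)
  have "P {}" by (simp add: P_def separated_def)
  then have "\<exists>S. P S \<and> (\<forall>T. P T \<longrightarrow> card T \<le> card S)"
    by (rule ex_has_greatest_nat[where b = "Suc M"]) (metis fin less_Suc_eq_le)
  then obtain S where S: "P S" "\<And>T. P T \<Longrightarrow> card T \<le> card S" by blast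
  have "\<exists>s\<in>S. dist a s < e * R \<or> a = s" if "a \<in> A" for a
  proof (rule ccontr)
    assume far: "\<not> ?thesis"
    then have "\<forall>s\<in>S. e * R \<le> dist a s \<and> e * R \<le> dist s a" by (auto simp: not_less dist_commute)
    then have "P (insert a S)"
      using S(1) that unfolding P_def separated_def by (simp add: ball_simps)
    moreover have "a \<notin> S" using far by auto
    ultimately show False using S(2)[of "insert a S"] fin[OF S(1)] by simp
  qed
  then show thesis by (rule that[of S, rotated -1]) (use S(1) fin[OF S(1)] in \<open>auto simp: P_def\<close>)
qed

section \<open>Whitney gluing\<close>

text \<open>Zorn's lemma, since the sets may be infinite. It is applied to nets whose spacing varies
  from point to point and to independent sets of a graph.\<close>

lemma maximal_pairwise_subset:
  assumes sym: "\<And>a b. R a b \<Longrightarrow> R b a"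
  obtains S where "S \<subseteq> A" "pairwise R S" "\<And>a. a \<in> A \<Longrightarrow> a \<notin> S \<Longrightarrow> \<exists>s\<in>S. \<not> R a s"
proof -
  define F where "F = {S. S \<subseteq> A \<and> pairwise R S}"
  have "\<exists>U\<in>F. \<forall>S\<in>C. S \<subseteq> U" if C: "C \<in> chains F" for C
  proof
    have "pairwise R (\<Union>C)"
    proof (rule pairwiseI)
      fix a b assume "a \<in> \<Union>C" "b \<in> \<Union>C" "a \<noteq> b"
      then obtain S T where ST: "S \<in> C" "T \<in> C" "a \<in> S" "b \<in> T" by blast
      define U where "U = S \<union> T"
      have "U = S \<or> U = T" using chainsD[OF C ST(1,2)] by (auto simp: U_def)
      then have "U \<in> F" using ST(1,2) chainsD2[OF C] by auto
      moreover have "a \<in> U" "b \<in> U" using ST by (auto simp: U_def)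
      ultimately show "R a b" using \<open>a \<noteq> b\<close> unfolding F_def pairwise_def by blast
    qed
    moreover have "\<Union>C \<subseteq> A" using chainsD2[OF C] by (auto simp: F_def)
    ultimately show "\<Union>C \<in> F" by (simp add: F_def)
  qed blast
  then have "\<exists>S\<in>F. \<forall>T\<in>F. S \<subseteq> T \<longrightarrow> T = S" by (intro Zorn_Lemma2) blast
  then obtain S where S: "S \<in> F" "\<And>T. T \<in> F \<Longrightarrow> S \<subseteq> T \<Longrightarrow> T = S" by blast
  have "\<exists>s\<in>S. \<not> R a s" if "a \<in> A" "a \<notin> S" for a
  proof (rule ccontr)
    assume "\<not> ?thesis"
    then have "\<And>s. s \<in> S \<Longrightarrow> R a s \<and> R s a" using sym by blast
    then have "insert a S \<in> F" using S(1) that(1) by (simp add: F_def pairwise_insert)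
    then show False using S(2)[of "insert a S"] that by blast
  qed
  then show thesis using that S(1) by (auto simp: F_def)
qed

text \<open>Induction on the degree, which also works for infinitely many vertices: a maximal
  independent set \<open>I\<close> gets the top colour, and by maximality every other vertex has a
  neighbour in \<open>I\<close>, so its degree drops when \<open>I\<close> is removed.\<close>

lemma bounded_degree_colouring:
  assumes sym: "\<And>a b. adj a b \<Longrightarrow> adj b a"
    and deg: "\<And>z. z \<in> Z \<Longrightarrow> finite {w \<in> Z. w \<noteq> z \<and> adj z w} \<and> card {w \<in> Z. w \<noteq> z \<and> adj z w} \<le> d"
  shows "\<exists>c::'a \<Rightarrow> nat. \<forall>z\<in>Z. c z \<le> d \<and> (\<forall>w\<in>Z. w \<noteq> z \<and> adj z w \<longrightarrow> c z \<noteq> c w)"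
  using deg
proof (induction d arbitrary: Z)
  case 0
  then have "{w \<in> Z. w \<noteq> z \<and> adj z w} = {}" if "z \<in> Z" for z
  proof -
    have "finite {w \<in> Z. w \<noteq> z \<and> adj z w}" "card {w \<in> Z. w \<noteq> z \<and> adj z w} = 0"
      using 0[OF that] by simp_all
    then show ?thesis by (simp only: card_0_eq)
  qed
  then show ?case by (intro exI[of _ "\<lambda>_. 0"]) blast
next
  case (Suc d)
  have nsym: "\<not> adj a b \<Longrightarrow> \<not> adj b a" for a b using sym by blast
  obtain I where I: "I \<subseteq> Z" "pairwise (\<lambda>a b. \<not> adj a b) I"
    "\<And>a. a \<in> Z \<Longrightarrow> a \<notin> I \<Longrightarrow> \<exists>s\<in>I. \<not> \<not> adj a s"
    by (rule maximal_pairwise_subset[of "\<lambda>a b. \<not> adj a b" Z]) (erule nsym, rule that)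
  have "finite {w \<in> Z - I. w \<noteq> z \<and> adj z w} \<and> card {w \<in> Z - I. w \<noteq> z \<and> adj z w} \<le> d" if z: "z \<in> Z - I" for z
  proof -
    obtain s where s: "s \<in> I" "adj z s" using I(3) z by blast
    have "{w \<in> Z - I. w \<noteq> z \<and> adj z w} \<subset> {w \<in> Z. w \<noteq> z \<and> adj z w}" using s I(1) z by blast
    moreover have fin: "finite {w \<in> Z. w \<noteq> z \<and> adj z w}" "card {w \<in> Z. w \<noteq> z \<and> adj z w} \<le> Suc d"
      using Suc.prems[of z] z by simp_all
    ultimately have "card {w \<in> Z - I. w \<noteq> z \<and> adj z w} < Suc d" by (meson psubset_card_mono order_less_le_trans)
    moreover have "finite {w \<in> Z - I. w \<noteq> z \<and> adj z w}" by (rule finite_subset[OF _ fin(1)]) auto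
    ultimately show ?thesis by simp
  qed
  from Suc.IH[OF this] obtain c :: "'a \<Rightarrow> nat" where
    c: "\<forall>z\<in>Z - I. c z \<le> d \<and> (\<forall>w\<in>Z - I. w \<noteq> z \<and> adj z w \<longrightarrow> c z \<noteq> c w)" ..
  define c' where "c' = (\<lambda>z. if z \<in> I then Suc d else c z)"
  show ?case
  proof (intro exI[of _ c'] ballI conjI impI)
    fix z assume z: "z \<in> Z"
    have cz: "c x \<le> d" if "x \<in> Z" "x \<notin> I" for x using c that by simp
    show "c' z \<le> Suc d" using cz[OF z] by (cases "z \<in> I") (auto simp: c'_def)
    fix w assume w: "w \<in> Z" "w \<noteq> z \<and> adj z w"
    have "\<not> (z \<in> I \<and> w \<in> I)" using I(2) w by (auto simp: pairwise_def)
    moreover have "c z \<noteq> c w" if "z \<notin> I" "w \<notin> I" using c that w z by simp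
    ultimately show "c' z \<noteq> c' w"
      using cz[of z] cz[of w] z w(1) by (auto simp: c'_def)
  qed
qed

text \<open>For points in different pieces, the function of either piece vanishes at the other
  point, so both values are at most \<open>L * dist x y\<close>. This is the factor 2; no path
  between the pieces is involved.\<close>

lemma lipschitz_glue_disjoint:
  fixes h :: "'p \<Rightarrow> 'a::metric_space \<Rightarrow> real"
  assumes L: "0 \<le> L" and lip: "\<And>p. p \<in> Z \<Longrightarrow> L-lipschitz_on UNIV (h p)"
    and supp: "\<And>p x. p \<in> Z \<Longrightarrow> x \<notin> U p \<Longrightarrow> h p x = 0"
    and disj: "\<And>p q x. p \<in> Z \<Longrightarrow> q \<in> Z \<Longrightarrow> x \<in> U p \<Longrightarrow> x \<in> U q \<Longrightarrow> p = q"
  obtains g where "\<And>x y. \<bar>g x - g y\<bar> \<le> 2 * L * dist x y" "\<And>p x. p \<in> Z \<Longrightarrow> x \<in> U p \<Longrightarrow> g x = h p x"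
    "\<And>x. (\<And>p. p \<in> Z \<Longrightarrow> x \<notin> U p) \<Longrightarrow> g x = 0"
proof -
  define g where "g = (\<lambda>x. if \<exists>p\<in>Z. x \<in> U p then h (SOME p. p \<in> Z \<and> x \<in> U p) x else 0)"
  have g1: "g x = h p x" if "p \<in> Z" "x \<in> U p" for p x
  proof -
    have "(SOME p. p \<in> Z \<and> x \<in> U p) = p" using that disj by (intro some_equality) blast+
    then show ?thesis using that by (auto simp: g_def)
  qed
  have g0: "g x = 0" if "\<And>p. p \<in> Z \<Longrightarrow> x \<notin> U p" for x using that by (auto simp: g_def)
  have l: "\<bar>h p x - h p y\<bar> \<le> L * dist x y" if "p \<in> Z" for p x y
    using lipschitz_onD[OF lip[OF that], of x y] by (simp add: dist_real_def)
  have main: "\<bar>g x - g y\<bar> \<le> 2 * L * dist x y" if p: "p \<in> Z" "x \<in> U p" for p x y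
  proof (cases "\<exists>q\<in>Z. y \<in> U q \<and> p \<noteq> q")
    case True
    then obtain q where q: "q \<in> Z" "y \<in> U q" "p \<noteq> q" by blast
    have "h p y = 0" "h q x = 0" using supp disj p q by metis+
    then show ?thesis using l[OF p(1), of x y] l[OF q(1), of x y] g1[OF p] g1[OF q(1,2)] by simp
  next
    case False
    have "g y = h p y"
    proof (cases "y \<in> U p")
      case True
      then show ?thesis by (rule g1[OF p(1)])
    next
      case no: False
      then have "\<And>q. q \<in> Z \<Longrightarrow> y \<notin> U q" using False by blast
      then show ?thesis using g0[of y] supp[OF p(1) no] by simp
    qed
    moreover have "0 \<le> L * dist x y" using L by simp
    ultimately show ?thesis using l[OF p(1), of x y] g1[OF p] by simp
  qed
  have "\<bar>g x - g y\<bar> \<le> 2 * L * dist x y" for x y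
  proof (cases "\<exists>p\<in>Z. x \<in> U p \<or> y \<in> U p")
    case True
    then obtain p where "p \<in> Z" "x \<in> U p \<or> y \<in> U p" by blast
    then show ?thesis using main[of p x y] main[of p y x] by (auto simp: dist_commute abs_minus_commute)
  next
    case False
    then have "g x = 0" "g y = 0" by (auto intro: g0)
    then show ?thesis using L by simp
  qed
  then show thesis using that g1 g0 by blast
qed

section \<open>Whitney nets and their colourings\<close>

lemma infdist_le_add_dist: "infdist x E \<le> infdist y E + dist x y"
  by (metis add.commute dist_commute infdist_triangle)

text \<open>\<open>Z\<close> is a maximal set whose spacing is proportional to the distance \<delta>
  from \<open>E\<close>. Points of \<open>Z\<close> that are close on the scale \<open>K\<close>
  times their \<delta> have values of \<delta> within a factor \<open>1 + K\<close>, so packing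
  bounds the number of such neighbours and a finite colouring keeps them apart.\<close>

lemma whitney_colouring:
  fixes X E :: "'a::metric_space set"
  assumes sb: "\<And>e. 0 < e \<Longrightarrow> \<exists>M. separation_bound X e M"
    and s: "0 < s" "s \<le> 1/4" and K: "1 \<le> K"
  obtains Z :: "'a set" and col :: "'a \<Rightarrow> nat" and M :: nat where
    "Z \<subseteq> X" "\<And>p. p \<in> Z \<Longrightarrow> 0 < infdist p E" "\<And>p. p \<in> Z \<Longrightarrow> col p \<le> M"
    "\<And>x. x \<in> X \<Longrightarrow> 0 < infdist x E \<Longrightarrow> \<exists>p\<in>Z. dist x p \<le> s * infdist p E"
    "\<And>p q. p \<in> Z \<Longrightarrow> q \<in> Z \<Longrightarrow> p \<noteq> q \<Longrightarrow> col p = col q \<Longrightarrow>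
       dist p q \<le> K * infdist p E \<Longrightarrow> dist p q \<le> K * infdist q E \<Longrightarrow> False"
proof -
  define \<delta> where "\<delta> = (\<lambda>x. infdist x E)"
  have \<delta>_tri: "\<delta> x \<le> \<delta> y + dist x y" for x y unfolding \<delta>_def by (rule infdist_le_add_dist)
  define W where "W = {x \<in> X. 0 < \<delta> x}"
  define R where "R = (\<lambda>p q. s / 2 * \<delta> p \<le> dist p q \<and> s / 2 * \<delta> q \<le> dist p q)"
  obtain Z where Z: "Z \<subseteq> W" "pairwise R Z" "\<And>a. a \<in> W \<Longrightarrow> a \<notin> Z \<Longrightarrow> \<exists>z\<in>Z. \<not> R a z"
    using maximal_pairwise_subset[of R W] by (auto simp: R_def dist_commute)
  have ZX: "Z \<subseteq> X" and Zpos: "\<And>p. p \<in> Z \<Longrightarrow> 0 < \<delta> p" using Z(1) by (auto simp: W_def)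
  define adj where "adj = (\<lambda>p q. dist p q \<le> K * \<delta> p \<and> dist p q \<le> K * \<delta> q)"
  \<comment> \<open>The neighbours of \<open>z\<close> lie in the ball of radius
    \<open>(1 + K) * \<delta> z\<close> and are at least \<open>s / 2 * \<delta> z / (1 + K)\<close>
    apart; \<open>e\<close> is the quotient.\<close>
  define e where "e = s / 2 / (1 + K)\<^sup>2"
  have "0 < e" using s K by (simp add: e_def)
  then obtain M where M: "separation_bound X e M" using sb by blast
  have "finite {w \<in> Z. w \<noteq> z \<and> adj z w} \<and> card {w \<in> Z. w \<noteq> z \<and> adj z w} \<le> M" if z: "z \<in> Z" for z
  proof -
    let ?S = "{w \<in> Z. w \<noteq> z \<and> adj z w}" and ?R = "(1 + K) * \<delta> z"
    have "?S \<subseteq> X \<inter> ball z ?R"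
    proof
      fix w assume w: "w \<in> ?S"
      then have "dist z w \<le> K * \<delta> z" by (simp add: adj_def)
      also have "\<dots> < ?R" using Zpos[OF z] by (simp add: algebra_simps)
      finally show "w \<in> X \<inter> ball z ?R" using w ZX by auto
    qed
    moreover have "separated (e * ?R) ?S"
      unfolding separated_def
    proof (intro ballI impI)
      fix a b assume a: "a \<in> ?S" and b: "b \<in> ?S" and ab: "a \<noteq> b"
      have "\<delta> z \<le> \<delta> a + dist z a" by (rule \<delta>_tri)
      also have "\<dots> \<le> \<delta> a + K * \<delta> a" using a by (simp add: adj_def)
      finally have "\<delta> z / (1 + K) \<le> \<delta> a" using K by (simp add: field_simps)
      then have "s / 2 * (\<delta> z / (1 + K)) \<le> s / 2 * \<delta> a" using s by (intro mult_left_mono) auto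
      moreover have "e * ?R = s / 2 * (\<delta> z / (1 + K))"
        using K by (simp add: e_def power2_eq_square)
      moreover have "R a b" using Z(2) a b ab by (auto simp: pairwise_def)
      ultimately show "e * ?R \<le> dist a b" unfolding R_def by linarith
    qed
    moreover have "0 < ?R" using K Zpos[OF z] by simp
    ultimately show ?thesis using M z ZX unfolding separation_bound_def by blast
  qed
  then obtain col where col: "\<And>z. z \<in> Z \<Longrightarrow> col z \<le> M \<and> (\<forall>w\<in>Z. w \<noteq> z \<and> adj z w \<longrightarrow> col z \<noteq> col w)"
    using bounded_degree_colouring[of adj Z M] by (auto simp: adj_def dist_commute)
  have cov: "\<exists>p\<in>Z. dist x p \<le> s * \<delta> p" if x: "x \<in> X" "0 < \<delta> x" for x
  proof (cases "x \<in> Z")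
    case True
    then show ?thesis using s Zpos[OF True] by (intro bexI[of _ x]) auto
  next
    case False
    then obtain p where p: "p \<in> Z" "\<not> R x p" using Z(3)[of x] x by (auto simp: W_def)
    \<comment> \<open>Maximality bounds \<open>dist x p\<close> by \<open>s / 2\<close> times one of
      the two distances from \<open>E\<close>. Both are at most
      \<open>\<delta> p + dist x p\<close>, and the second summand is absorbed since
      \<open>s\<close> is small.\<close>
    have "dist x p < s / 2 * (\<delta> p + dist x p)"
    proof -
      have "s / 2 * \<delta> x \<le> s / 2 * (\<delta> p + dist x p)" "s / 2 * \<delta> p \<le> s / 2 * (\<delta> p + dist x p)"
        using s \<delta>_tri[of x p] by (auto intro!: mult_left_mono)
      then show ?thesis using p(2) by (auto simp: R_def)
    qed
    moreover have "s / 2 * dist x p \<le> 1 / 2 * dist x p" using s by (intro mult_right_mono) auto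
    ultimately have "dist x p \<le> s * \<delta> p" by (simp add: algebra_simps)
    then show ?thesis using p(1) by blast
  qed
  show thesis
  proof (rule that[of Z col M])
    show "False" if "p \<in> Z" "q \<in> Z" "p \<noteq> q" "col p = col q"
       "dist p q \<le> K * infdist p E" "dist p q \<le> K * infdist q E" for p q
      using that col[of p] by (auto simp: adj_def \<delta>_def)
  qed (use ZX Zpos col cov in \<open>auto simp: \<delta>_def\<close>)
qed

text \<open>Truncation at height \<open>t\<close> takes the place of multiplication by a cutoff
  function: it keeps the constant \<open>L\<close>, vanishes where \<open>t\<close> does, and
  changes nothing where \<open>\<bar>f x\<bar> \<le> t x\<close>.\<close>

lemma lipschitz_clip:
  fixes f t :: "'a::metric_space \<Rightarrow> real"
  assumes "L-lipschitz_on UNIV f" "L-lipschitz_on UNIV t"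
  shows "L-lipschitz_on UNIV (\<lambda>x. max (- t x) (min (t x) (f x)))"
proof (rule lipschitz_on_realI)
  show "0 \<le> L" by (rule lipschitz_on_nonneg[OF assms(1)])
  fix x y :: 'a
  have "f x \<le> f y + L * dist x y" "t x \<le> t y + L * dist x y" "t y \<le> t x + L * dist x y"
    using lipschitz_on_real_leD[OF assms(1), of x y] lipschitz_on_real_leD[OF assms(2), of x y]
      lipschitz_on_real_leD[OF assms(2), of y x] by (auto simp: dist_commute)
  then show "max (- t x) (min (t x) (f x)) \<le> max (- t y) (min (t y) (f y)) + L * dist x y"
    by linarith
qed

text \<open>Pairs of points that are far apart compared with their distances to \<open>E\<close> are separated by the
  embedding of \<open>E\<close>, pairs at different distances from \<open>E\<close> by that distance. The remaining pairs are
  seen by the coordinates of one colour, whose pieces are too far apart to interfere.\<close>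

theorem whitney_gluing:
  fixes X E :: "'a::metric_space set"
  assumes sb: "\<And>e. 0 < e \<Longrightarrow> \<exists>M. separation_bound X e M"
    and E: "E \<noteq> {}" "coord_embeds n0 L0 E"
    and c: "0 < c"
    and loc: "\<And>x. x \<in> X \<Longrightarrow> 0 < infdist x E \<Longrightarrow> coord_embeds n1 L1 (X \<inter> ball x (c * infdist x E))"
  shows "\<exists>n L. coord_embeds n L X"
proof -
  define L where "L = max 1 (max L0 L1)"
  have L: "1 \<le> L" "L0 \<le> L" "L1 \<le> L" by (auto simp: L_def)
  define s where "s = min c (1/4)"
  have s: "0 < s" "s \<le> 1/4" "s \<le> c" using c by (auto simp: s_def)
  \<comment> \<open>If both points are within \<open>c0 * D\<close> of \<open>E\<close>, replacing
    them by points of \<open>E\<close> within \<open>2 * c0 * D\<close> changes their distance by at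
    most \<open>D / 4\<close> and \<open>L\<close> times a coordinate of \<open>E\<close> also by at
    most \<open>D / 4\<close>.\<close>
  define c0 where "c0 = 1 / (16 * L\<^sup>2)"
  have L2: "1 \<le> L\<^sup>2" "L \<le> L\<^sup>2" using L by (auto simp: power2_eq_square mult_ge1_I)
  have c0: "0 < c0" "16 * (c0 * L\<^sup>2) = 1" using L by (auto simp: c0_def)
  have c01: "16 * c0 \<le> 1"
  proof -
    have "c0 * 1 \<le> c0 * L\<^sup>2" using c0 L2 by (intro mult_left_mono) auto
    then show ?thesis using c0 by linarith
  qed
  \<comment> \<open>If \<open>x\<close> is near \<open>p\<close> and \<open>y\<close> lies in the
    piece of \<open>q\<close>, then \<open>\<delta> p\<close> and \<open>\<delta> q\<close> differ
    by a factor of at most 3 and \<open>D \<le> 2 * \<delta> p / c0\<close>. With this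
    \<open>K\<close> the centres count as close, so they cannot share a colour unless they are
    equal.\<close>
  define K where "K = 3 + 6 / c0"
  have K: "1 \<le> K" using c0 by (simp add: K_def)
  define \<delta> where "\<delta> = (\<lambda>x. infdist x E)"
  have \<delta>_tri: "\<bar>\<delta> x - \<delta> y\<bar> \<le> dist x y" for x y
    unfolding \<delta>_def by (rule infdist_triangle_abs)
  have s4: "0 < s / 4" "s / 4 \<le> 1 / 4" using s by auto
  obtain Z :: "'a set" and col :: "'a \<Rightarrow> nat" and M :: nat where
    Z': "Z \<subseteq> X" "\<And>p. p \<in> Z \<Longrightarrow> 0 < infdist p E" and col: "\<And>p. p \<in> Z \<Longrightarrow> col p \<le> M" and
    cov': "\<And>x. x \<in> X \<Longrightarrow> 0 < infdist x E \<Longrightarrow> \<exists>p\<in>Z. dist x p \<le> s / 4 * infdist p E" and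
    far': "\<And>p q. p \<in> Z \<Longrightarrow> q \<in> Z \<Longrightarrow> p \<noteq> q \<Longrightarrow> col p = col q \<Longrightarrow>
       dist p q \<le> K * infdist p E \<Longrightarrow> dist p q \<le> K * infdist q E \<Longrightarrow> False"
    by (rule whitney_colouring[of X "s / 4" K E]) (erule sb, rule s4, rule s4, rule K, rule that)
  have Z: "Z \<subseteq> X" "\<And>p. p \<in> Z \<Longrightarrow> 0 < \<delta> p" using Z' by (auto simp: \<delta>_def)
  have cov: "\<exists>p\<in>Z. dist x p \<le> s / 4 * \<delta> p" if "x \<in> X" "0 < \<delta> x" for x
    using cov'[of x] that by (simp add: \<delta>_def)
  have far: False if "p \<in> Z" "q \<in> Z" "p \<noteq> q" "col p = col q" "dist p q \<le> K * \<delta> p" "dist p q \<le> K * \<delta> q" for p q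
    using far'[of p q] that by (simp add: \<delta>_def)
  define U where "U = (\<lambda>p. ball p (s * \<delta> p))"
  have U\<delta>: "\<bar>\<delta> p - \<delta> x\<bar> \<le> \<delta> p / 4" "dist p x < \<delta> p / 4" if "p \<in> Z" "x \<in> U p" for p x
  proof -
    have "dist p x < s * \<delta> p" using that by (simp add: U_def)
    also have "\<dots> \<le> 1/4 * \<delta> p" using s Z(2)[OF that(1)] by (intro mult_right_mono) auto
    finally show "dist p x < \<delta> p / 4" by simp
    then show "\<bar>\<delta> p - \<delta> x\<bar> \<le> \<delta> p / 4" using \<delta>_tri[of p x] by linarith
  qed
  have K3: "3 * t \<le> K * t" if "0 \<le> t" for t using that c0 by (simp add: K_def mult_right_mono)
  have disj: "p = q" if "p \<in> Z" "q \<in> Z" "col p = col q" "x \<in> U p" "x \<in> U q" for p q x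
  proof (rule ccontr)
    assume "p \<noteq> q"
    have "dist p q < \<delta> p / 4 + \<delta> q / 4"
      using U\<delta>(2)[OF that(1,4)] U\<delta>(2)[OF that(2,5)] dist_triangle[of p q x] by (simp add: dist_commute)
    moreover have "\<delta> p \<le> 3 * \<delta> q" "\<delta> q \<le> 3 * \<delta> p"
      using U\<delta>(1)[OF that(1,4)] U\<delta>(1)[OF that(2,5)] Z(2)[OF that(1)] Z(2)[OF that(2)] by linarith+
    ultimately have "dist p q \<le> K * \<delta> p" "dist p q \<le> K * \<delta> q"
      using K3[of "\<delta> p"] K3[of "\<delta> q"] Z(2)[OF that(1)] Z(2)[OF that(2)] by linarith+
    then show False using far that \<open>p \<noteq> q\<close> by blast
  qed
  have "\<exists>f. (\<forall>j. L-lipschitz_on UNIV (f j)) \<and> (\<forall>j. f j p = 0) \<and>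
     (\<forall>x\<in>X \<inter> ball p (c * \<delta> p). \<forall>y\<in>X \<inter> ball p (c * \<delta> p). x \<noteq> y \<longrightarrow> (\<exists>j<n1. dist x y \<le> L * \<bar>f j x - f j y\<bar>))"
    if p: "p \<in> Z" for p
  proof -
    have "coord_embeds n1 L (X \<inter> ball p (c * \<delta> p))"
      using coord_embeds_mono[OF loc[of p] order_refl order_refl L(3)] p Z by (auto simp: \<delta>_def)
    then obtain f :: "nat \<Rightarrow> 'a \<Rightarrow> real" where f: "\<And>j. L-lipschitz_on UNIV (f j)"
      "\<And>x y. x \<in> X \<inter> ball p (c * \<delta> p) \<Longrightarrow> y \<in> X \<inter> ball p (c * \<delta> p) \<Longrightarrow> x \<noteq> y \<Longrightarrow>
         \<exists>j<n1. dist x y \<le> L * \<bar>f j x - f j y\<bar>"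
      by (rule coord_embedsE) blast
    \<comment> \<open>Vanishing at the centre gives
      \<open>\<bar>\<Phi> p j w\<bar> \<le> L * dist w p\<close>, so that truncation by \<tau> is
      inactive on the ball of half the radius.\<close>
    have "L-lipschitz_on UNIV (\<lambda>x. f j x - f j p)" for j
      using f(1)[of j] by (auto simp: lipschitz_on_def dist_real_def)
    then show ?thesis using f(2) by (intro exI[of _ "\<lambda>j x. f j x - f j p"]) simp
  qed
  then obtain \<Phi> where \<Phi>: "\<And>p j. p \<in> Z \<Longrightarrow> L-lipschitz_on UNIV (\<Phi> p j)" "\<And>p j. p \<in> Z \<Longrightarrow> \<Phi> p j p = 0"
     "\<And>p x y. p \<in> Z \<Longrightarrow> x \<in> X \<inter> ball p (c * \<delta> p) \<Longrightarrow> y \<in> X \<inter> ball p (c * \<delta> p) \<Longrightarrow> x \<noteq> y \<Longrightarrow>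
         \<exists>j<n1. dist x y \<le> L * \<bar>\<Phi> p j x - \<Phi> p j y\<bar>"
    by metis
  define \<tau> where "\<tau> = (\<lambda>p x. L * max 0 (s * \<delta> p - dist x p))"
  have \<tau>_lip: "L-lipschitz_on UNIV (\<tau> p)" for p
  proof (rule lipschitz_on_realI)
    fix x y :: 'a
    have "max 0 (s * \<delta> p - dist x p) \<le> max 0 (s * \<delta> p - dist y p) + dist x y"
      using dist_triangle[of y p x] by (auto simp: dist_commute max_def)
    then have "\<tau> p x \<le> L * (max 0 (s * \<delta> p - dist y p) + dist x y)"
      unfolding \<tau>_def using L by (intro mult_left_mono) auto
    then show "\<tau> p x \<le> \<tau> p y + L * dist x y" by (simp add: \<tau>_def distrib_left)
  qed (use L in auto)
  \<comment> \<open>Index \<open>n1\<close> is the bump \<tau> itself. It separates a point close to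
    the centre from a point outside the half ball, where the truncated coordinates are no longer
    reliable.\<close>
  define h where "h = (\<lambda>j p x. if j < n1 then max (- \<tau> p x) (min (\<tau> p x) (\<Phi> p j x)) else \<tau> p x)"
  have h_lip: "L-lipschitz_on UNIV (h j p)" if "p \<in> Z" for j p
    unfolding h_def using lipschitz_clip[OF \<Phi>(1)[OF that] \<tau>_lip] \<tau>_lip by (cases "j < n1") auto
  have h_supp: "h j p x = 0" if "x \<notin> U p" for j p x
    using that by (auto simp: h_def \<tau>_def U_def dist_commute)
  have "\<exists>g. (\<forall>x y. \<bar>g x - g y\<bar> \<le> 2 * L * dist x y) \<and> (\<forall>p x. p \<in> Z \<and> col p = a \<and> x \<in> U p \<longrightarrow> g x = h j p x) \<and>
    (\<forall>x. (\<forall>p. p \<in> Z \<and> col p = a \<longrightarrow> x \<notin> U p) \<longrightarrow> g x = 0)" for a j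
  proof -
    obtain g where "\<And>x y. \<bar>g x - g y\<bar> \<le> 2 * L * dist x y"
      "\<And>p x. p \<in> {p \<in> Z. col p = a} \<Longrightarrow> x \<in> U p \<Longrightarrow> g x = h j p x"
      "\<And>x. (\<And>p. p \<in> {p \<in> Z. col p = a} \<Longrightarrow> x \<notin> U p) \<Longrightarrow> g x = 0"
    proof (rule lipschitz_glue_disjoint[of L "{p \<in> Z. col p = a}" "h j" U])
      show "0 \<le> L" using L by simp
      show "p = q" if "p \<in> {p \<in> Z. col p = a}" "q \<in> {p \<in> Z. col p = a}" "x \<in> U p" "x \<in> U q" for p q x
        by (rule disj[of p q x]) (use that in auto)
    qed (auto intro: h_lip h_supp)
    then show ?thesis by (intro exI[of _ g]) auto
  qed
  then obtain g where g: "\<And>a j x y. \<bar>g a j x - g a j y\<bar> \<le> 2 * L * dist x y"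
     "\<And>a j p x. p \<in> Z \<Longrightarrow> col p = a \<Longrightarrow> x \<in> U p \<Longrightarrow> g a j x = h j p x"
     "\<And>a j x. (\<And>p. p \<in> Z \<Longrightarrow> col p = a \<Longrightarrow> x \<notin> U p) \<Longrightarrow> g a j x = 0"
    by metis
  have "coord_embeds n0 L E" using coord_embeds_mono[OF E(2) order_refl order_refl L(2)] .
  then obtain F :: "nat \<Rightarrow> 'a \<Rightarrow> real" where F: "\<And>j x y. \<bar>F j x - F j y\<bar> \<le> L * dist x y"
      "\<And>x y. x \<in> E \<Longrightarrow> y \<in> E \<Longrightarrow> x \<noteq> y \<Longrightarrow> \<exists>j<n0. dist x y \<le> L * \<bar>F j x - F j y\<bar>"
    by (rule coord_embedsE) blast
  define G :: "nat \<times> nat \<times> nat \<Rightarrow> 'a \<Rightarrow> real" where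
    "G = (\<lambda>(k, a, j). if k = 0 then F j else if k = 1 then \<delta> else g a j)"
  define I where "I = {0::nat} \<times> {0::nat} \<times> {..<n0} \<union> {(1, 0, 0)} \<union> {2} \<times> {..M} \<times> {..n1}"
  define LL where "LL = 2 * L + 2 / c0 + 8 / (s * c0)"
  have LL: "2 * L \<le> LL" "2 / c0 \<le> LL" "8 / (s * c0) \<le> LL" "0 \<le> LL"
    using L s c0 by (auto simp: LL_def)
  have near: "\<exists>i\<in>I. dist x y \<le> LL * \<bar>G i x - G i y\<bar>"
    if x: "x \<in> X" and y: "y \<in> X" and xy: "x \<noteq> y"
      and dx: "c0 * dist x y < \<delta> x" and dxy: "\<bar>\<delta> x - \<delta> y\<bar> < c0 * dist x y / 2" for x y
  proof -
    define D where "D = dist x y"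
    have D: "0 < D" using xy by (simp add: D_def)
    have c0D: "0 < c0 * D" using c0 D by simp
    have \<delta>x: "0 < \<delta> x" using dx c0D by (simp add: D_def)
    obtain p where p: "p \<in> Z" "dist x p \<le> s / 4 * \<delta> p" using cov[OF x \<delta>x] by blast
    have \<delta>p: "0 < \<delta> p" using Z(2)[OF p(1)] .
    have sp: "s * \<delta> p \<le> \<delta> p / 4" "0 < s * \<delta> p" using s \<delta>p mult_right_mono[of s "1/4" "\<delta> p"] by auto
    have xU: "x \<in> U p" using p sp by (simp add: U_def dist_commute)
    have \<delta>px: "\<bar>\<delta> p - \<delta> x\<bar> \<le> \<delta> p / 16" using p(2) sp \<delta>_tri[of p x] by (simp add: dist_commute)
    have Dp: "c0 * D \<le> 2 * \<delta> p" "c0 * D \<le> 17 / 16 * \<delta> p" using \<delta>px dx unfolding D_def by linarith+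
    show ?thesis
    proof (cases "dist y p \<le> s * \<delta> p / 2")
      case True
      have "s * \<delta> p \<le> c * \<delta> p" using s \<delta>p by (simp add: mult_right_mono)
      then have "x \<in> X \<inter> ball p (c * \<delta> p)" "y \<in> X \<inter> ball p (c * \<delta> p)"
      proof -
        have "dist p x < c * \<delta> p" "dist p y < c * \<delta> p"
          using \<open>s * \<delta> p \<le> c * \<delta> p\<close> True p(2) sp dist_commute[of p x] dist_commute[of p y] by linarith+
        then show "x \<in> X \<inter> ball p (c * \<delta> p)" "y \<in> X \<inter> ball p (c * \<delta> p)" using x y by simp_all
      qed
      then obtain j where j: "j < n1" "dist x y \<le> L * \<bar>\<Phi> p j x - \<Phi> p j y\<bar>" using \<Phi>(3) p(1) xy by blast
      have eq: "g (col p) j w = \<Phi> p j w" if w: "dist w p \<le> s * \<delta> p / 2" for w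
      proof -
        have "w \<in> U p" using w sp by (simp add: U_def dist_commute)
        then have "g (col p) j w = h j p w" using g(2) p(1) by blast
        moreover have "\<bar>\<Phi> p j w\<bar> \<le> L * dist w p"
          using lipschitz_onD[OF \<Phi>(1)[OF p(1)], of w p j] \<Phi>(2)[OF p(1), of j] by (simp add: dist_real_def)
        moreover have "L * dist w p \<le> \<tau> p w" unfolding \<tau>_def
          using w L sp by (intro mult_left_mono) auto
        ultimately show ?thesis using j(1) by (simp add: h_def)
      qed
      have "dist x p \<le> s * \<delta> p / 2" using p(2) sp by simp
      then have "dist x y \<le> L * \<bar>G (2, col p, j) x - G (2, col p, j) y\<bar>"
        using j(2) eq True by (simp add: G_def)
      also have "\<dots> \<le> LL * \<bar>G (2, col p, j) x - G (2, col p, j) y\<bar>"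
        using LL(1) L by (intro mult_right_mono) auto
      finally show ?thesis using j(1) col[OF p(1)] by (intro bexI[of _ "(2, col p, j)"]) (auto simp: I_def)
    next
      case False
      have gx: "g (col p) n1 x = L * (s * \<delta> p - dist x p)"
        using g(2)[OF p(1) refl xU, of n1] p(2) sp by (simp add: h_def \<tau>_def)
      have gy: "g (col p) n1 y \<le> L * (s * \<delta> p / 2)"
      proof (cases "\<exists>q\<in>Z. col q = col p \<and> y \<in> U q")
        case True
        then obtain q where q: "q \<in> Z" "col q = col p" "y \<in> U q" by blast
        \<comment> \<open>The bump of another piece of the same colour at \<open>y\<close> could
          cancel the one at \<open>x\<close>; the choice of \<open>K\<close> excludes such a
          piece.\<close>
        have "q = p"
        proof (rule ccontr)
          assume "q \<noteq> p"
          have \<delta>q: "0 < \<delta> q" using Z(2)[OF q(1)] .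
          have "\<bar>\<delta> q - \<delta> y\<bar> \<le> \<delta> q / 4" "dist q y < \<delta> q / 4" using U\<delta>[OF q(1,3)] by auto
          moreover have "\<bar>\<delta> x - \<delta> y\<bar> < \<delta> x / 2" using dx dxy by simp
          ultimately have 3: "\<delta> p \<le> 3 * \<delta> q" "\<delta> q \<le> 3 * \<delta> p" using \<delta>px \<delta>p \<delta>q by linarith+
          have "dist p q \<le> dist x p + D + dist q y"
            unfolding D_def using dist_triangle[of p q x] dist_triangle[of x q y] by (simp add: dist_commute)
          also have "dist x p \<le> \<delta> p / 16" using p(2) sp by simp
          also have "D \<le> 2 * \<delta> p / c0" using Dp c0 by (simp add: field_simps)
          also have "dist q y \<le> \<delta> q / 4" using U\<delta>(2)[OF q(1,3)] by simp
          finally have d: "dist p q \<le> \<delta> p / 16 + 2 * \<delta> p / c0 + \<delta> q / 4" by simp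
          have "2 * \<delta> p / c0 \<le> 6 / c0 * \<delta> p" "2 * \<delta> p / c0 \<le> 6 / c0 * \<delta> q"
            using c0 3 \<delta>p by (auto simp: divide_simps)
          then have "dist p q \<le> K * \<delta> p" "dist p q \<le> K * \<delta> q"
            using d 3 \<delta>p \<delta>q unfolding K_def distrib_right by linarith+
          then show False using far[OF p(1) q(1) _ q(2)[symmetric]] \<open>q \<noteq> p\<close> by blast
        qed
        then have "g (col p) n1 y = L * max 0 (s * \<delta> p - dist y p)"
          using g(2)[OF q(1,2,3), of n1] by (simp add: h_def \<tau>_def)
        also have "max 0 (s * \<delta> p - dist y p) \<le> s * \<delta> p / 2" using False sp by linarith
        then have "L * max 0 (s * \<delta> p - dist y p) \<le> L * (s * \<delta> p / 2)" using L by (intro mult_left_mono) auto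
        finally show ?thesis .
      next
        case no: False
        then have "g (col p) n1 y = 0" by (intro g(3)) blast
        then show ?thesis using sp L by simp
      qed
      have "L * (s * \<delta> p / 4) \<le> L * ((s * \<delta> p - dist x p) - s * \<delta> p / 2)"
        using p(2) L by (intro mult_left_mono) auto
      also have "\<dots> \<le> \<bar>g (col p) n1 x - g (col p) n1 y\<bar>" using gx gy by (simp add: right_diff_distrib)
      finally have "s * \<delta> p / 4 \<le> \<bar>g (col p) n1 x - g (col p) n1 y\<bar>"
        using L sp mult_right_mono[of 1 L "s * \<delta> p / 4"] by simp
      moreover have "s * (c0 * D) \<le> s * (2 * \<delta> p)" using Dp s by (intro mult_left_mono) auto
      ultimately have "D * (s * c0) \<le> 8 * \<bar>g (col p) n1 x - g (col p) n1 y\<bar>" by (simp add: algebra_simps)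
      then have "D \<le> 8 / (s * c0) * \<bar>g (col p) n1 x - g (col p) n1 y\<bar>"
        using s c0 by (simp add: pos_le_divide_eq)
      also have "\<dots> \<le> LL * \<bar>g (col p) n1 x - g (col p) n1 y\<bar>" using LL(3) by (intro mult_right_mono) auto
      finally show ?thesis using col[OF p(1)]
        by (intro bexI[of _ "(2, col p, n1)"]) (auto simp: I_def G_def D_def)
    qed
  qed
  have "coord_embeds (card I) LL X"
  proof (rule coord_embedsI[of I _ _ _ G])
    show "finite I" by (simp add: I_def)
    show "\<bar>G i x - G i y\<bar> \<le> LL * dist x y" for i x y
    proof -
      have "\<bar>\<delta> x - \<delta> y\<bar> \<le> 1 * dist x y" using \<delta>_tri[of x y] by simp
      also have "\<dots> \<le> 2 * L * dist x y" using L by (intro mult_right_mono) auto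
      finally have 1: "\<bar>\<delta> x - \<delta> y\<bar> \<le> 2 * L * dist x y" .
      have 2: "L * dist x y \<le> 2 * L * dist x y" using L by simp
      have "\<bar>G i x - G i y\<bar> \<le> 2 * L * dist x y"
        using 1 order_trans[OF F(1) 2] g(1) by (cases i) (simp add: G_def)
      also have "\<dots> \<le> LL * dist x y" using LL(1) by (intro mult_right_mono) auto
      finally show ?thesis .
    qed
    fix x y assume x: "x \<in> X" and y: "y \<in> X" and xy: "x \<noteq> y"
    define D where "D = dist x y"
    have D: "0 < D" using xy by (simp add: D_def)
    have c0D: "0 < c0 * D" using c0 D by simp
    consider "c0 * D / 2 \<le> \<bar>\<delta> x - \<delta> y\<bar>" | "\<bar>\<delta> x - \<delta> y\<bar> < c0 * D / 2" "c0 * D < \<delta> x"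
      | "\<bar>\<delta> x - \<delta> y\<bar> < c0 * D / 2" "c0 * D < \<delta> y" | "\<delta> x \<le> c0 * D" "\<delta> y \<le> c0 * D" by linarith
    then show "\<exists>i\<in>I. dist x y \<le> LL * \<bar>G i x - G i y\<bar>"
    proof cases
      case 1
      then have "D \<le> 2 / c0 * \<bar>\<delta> x - \<delta> y\<bar>" using c0 by (simp add: field_simps)
      also have "\<dots> \<le> LL * \<bar>\<delta> x - \<delta> y\<bar>" using LL(2) by (intro mult_right_mono) auto
      finally show ?thesis by (intro bexI[of _ "(1, 0, 0)"]) (auto simp: I_def G_def D_def)
    next
      case 2
      then show ?thesis using near[OF x y xy] by (simp add: D_def)
    next
      case 3
      then show ?thesis using near[OF y x] xy by (simp add: D_def dist_commute abs_minus_commute)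
    next
      case 4
      have "infdist x E < 2 * c0 * D" "infdist y E < 2 * c0 * D" using 4 c0D by (auto simp: \<delta>_def)
      then obtain u v where u: "u \<in> E" "dist x u < 2 * c0 * D" and v: "v \<in> E" "dist y v < 2 * c0 * D"
        using infdist_lessE[OF _ E(1)] by metis
      have "D \<le> dist x u + dist u v + dist y v"
        unfolding D_def using dist_triangle[of x y u] dist_triangle[of u y v] by (simp add: dist_commute)
      then have uv: "D - 4 * (c0 * D) \<le> dist u v" using u v by simp
      have "16 * c0 * D \<le> 1 * D" using c01 D by (intro mult_right_mono) auto
      then have "u \<noteq> v" using uv D by auto
      then obtain j where j: "j < n0" "dist u v \<le> L * \<bar>F j u - F j v\<bar>" using F(2) u v by blast
      have "L * dist x u \<le> L * (2 * c0 * D)" "L * dist y v \<le> L * (2 * c0 * D)"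
        using u v L by (auto intro!: mult_left_mono)
      then have "\<bar>F j u - F j v\<bar> \<le> \<bar>F j x - F j y\<bar> + 4 * (L * c0 * D)"
        using F(1)[of j x u] F(1)[of j y v] by linarith
      then have "L * \<bar>F j u - F j v\<bar> \<le> L * (\<bar>F j x - F j y\<bar> + 4 * (L * c0 * D))"
        using L by (intro mult_left_mono) auto
      also have "\<dots> = L * \<bar>F j x - F j y\<bar> + 1/4 * ((16 * (c0 * L\<^sup>2)) * D)"
        by (simp add: algebra_simps power2_eq_square)
      finally have "L * \<bar>F j u - F j v\<bar> \<le> L * \<bar>F j x - F j y\<bar> + D / 4" using c0(2) by simp
      then have "D \<le> 2 * L * \<bar>F j x - F j y\<bar>"
        using j(2) uv \<open>16 * c0 * D \<le> 1 * D\<close> by (simp add: algebra_simps)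
      also have "\<dots> \<le> LL * \<bar>F j x - F j y\<bar>" using LL(1) by (intro mult_right_mono) auto
      finally show ?thesis using j(1) by (intro bexI[of _ "(0, 0, j)"]) (auto simp: I_def G_def D_def)
    qed
  qed (use LL in auto)
  then show ?thesis by blast
qed

section \<open>Nested partitions of an arc\<close>

lemma discrete_crossing:
  fixes f :: "nat \<Rightarrow> 'b::linorder"
  assumes "i \<le> i'" "f i \<le> j" "j < f i'"
  obtains t where "i \<le> t" "t < i'" "f t \<le> j" "j < f (Suc t)"
proof -
  have "\<exists>t. i \<le> t \<and> t < i' \<and> f t \<le> j \<and> j < f (Suc t)"
    using assms
  proof (induction i' rule: dec_induct)
    case (step n)
    then show ?case by (cases "j < f n") (auto intro: less_SucI)
  qed simp
  then show thesis using that by blast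
qed

definition hat :: "nat \<Rightarrow> nat \<Rightarrow> nat \<Rightarrow> real" where
  "hat l p c = (if 1 \<le> c \<and> c < l \<and> p = c then 1 else 0)"

text \<open>The slopes on the \<open>l\<close> children of a restarted interval: the \<open>c\<close>-th subdivision point gets the
  height 1 in coordinate \<open>c\<close>, the two endpoints stay at 0. As \<open>l \<ge> 3\<close>, no two of these vectors point in
  opposite directions.\<close>

definition dir :: "nat \<Rightarrow> nat \<Rightarrow> nat \<Rightarrow> real" where
  "dir l p c = hat l p (Suc c) - hat l p c"

lemma abs_dir_le: "\<bar>dir l p c\<bar> \<le> 1"
  by (auto simp: dir_def hat_def)

lemma sum_dir: "(\<Sum>c<l. dir l p c) = 0"
  unfolding dir_def by (subst sum_lessThan_telescope) (simp add: hat_def)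

text \<open>Unless \<open>c\<close> is the last child, coordinate \<open>Suc c\<close> carries
  \<open>s\<close>, and only \<open>c' = Suc c\<close> can oppose it. For the last child coordinate
  \<open>c\<close> carries \<open>- s\<close>, and only \<open>Suc c' = c\<close> can oppose it. As
  \<open>l\<close> and \<open>l'\<close> are at least 3, a second coordinate then shows
  \<open>s\<close> or \<open>t\<close> alone; if it shows \<open>t\<close>, one of \<open>t\<close>
  and \<open>\<bar>s - t\<bar>\<close> is at least \<open>s / 2\<close>.\<close>

lemma dir_no_cancel_aux:
  assumes "c < l" "3 \<le> l" "3 \<le> l'" "l \<le> M" "l' \<le> M" "0 \<le> s" "0 \<le> t"
  shows "\<exists>p\<le>M. s / 2 \<le> \<bar>s * dir l p c + t * dir l' p c'\<bar>"
proof (cases "Suc c < l")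
  case True
  show ?thesis
  proof (cases "c' = Suc c \<and> c' < l'")
    case F: False
    then show ?thesis using True assms by (intro exI[of _ "Suc c"]) (auto simp: dir_def hat_def)
  next
    case T: True
    show ?thesis
    proof (cases "c = 0")
      case F0: False
      then show ?thesis using True T assms by (intro exI[of _ c]) (auto simp: dir_def hat_def)
    next
      case c0: True
      have "s / 2 \<le> \<bar>s - t\<bar> \<or> s / 2 \<le> t" by linarith
      then show ?thesis
      proof
        assume "s / 2 \<le> \<bar>s - t\<bar>"
        then show ?thesis using True T c0 assms by (intro exI[of _ 1]) (auto simp: dir_def hat_def)
      next
        assume "s / 2 \<le> t"
        then show ?thesis using True T c0 assms by (intro exI[of _ 2]) (auto simp: dir_def hat_def)
      qed
    qed
  qed
next
  case False
  then have c: "Suc c = l" "2 \<le> c" using assms by auto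
  show ?thesis
  proof (cases "Suc c' = c \<and> c < l'")
    case F: False
    then show ?thesis using c assms by (intro exI[of _ c]) (auto simp: dir_def hat_def)
  next
    case T: True
    have "s / 2 \<le> \<bar>t - s\<bar> \<or> s / 2 \<le> t" by linarith
    then show ?thesis
    proof
      assume "s / 2 \<le> \<bar>t - s\<bar>"
      then show ?thesis using T c assms by (intro exI[of _ c]) (auto simp: dir_def hat_def)
    next
      assume "s / 2 \<le> t"
      then show ?thesis using T c assms by (intro exI[of _ c']) (auto simp: dir_def hat_def)
    qed
  qed
qed

lemma dir_no_cancel:
  assumes "c < l" "c' < l'" "3 \<le> l" "3 \<le> l'" "l \<le> M" "l' \<le> M" "0 \<le> s" "0 \<le> t"
  shows "\<exists>p\<le>M. max s t / 2 \<le> \<bar>s * dir l p c + t * dir l' p c'\<bar>"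
proof (cases "t \<le> s")
  case True
  then show ?thesis using dir_no_cancel_aux[of c l l' M s t c'] assms by (simp add: max_def)
next
  case False
  then show ?thesis using dir_no_cancel_aux[of c' l' l M t s c] assms by (simp add: max_def add.commute)
qed

lemma mod_Suc_cancel:
  fixes x y m :: nat
  assumes "Suc x mod m = Suc y mod m" "0 < m"
  shows "x mod m = y mod m"
proof -
  have "(Suc x + (m - 1)) mod m = (Suc y + (m - 1)) mod m" by (metis assms(1) mod_add_left_eq)
  moreover have "Suc z + (m - 1) = z + m" for z using assms(2) by simp
  ultimately show ?thesis by simp
qed

lemma mod_add_self_imp_zero:
  fixes a b m :: nat
  assumes "(b + a) mod m = b mod m" "a < m"
  shows "a = 0"
  using assms mod_eq_dvd_iff_nat[of b "b + a" m] by (auto dest: dvd_imp_le)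

text \<open>\<open>P k i\<close> is the \<open>i\<close>-th of the \<open>n k + 1\<close> subdivision points of level \<open>k\<close>, and \<open>s k i\<close> is its index among
  those of level \<open>k + 1\<close>.\<close>

locale arc_net =
  fixes P :: "nat \<Rightarrow> nat \<Rightarrow> 'a::metric_space" and n :: "nat \<Rightarrow> nat" and s :: "nat \<Rightarrow> nat \<Rightarrow> nat"
    and C \<rho> r0 :: real and M :: nat
  assumes n0: "n 0 = 1" and s0: "s k 0 = 0" and sn: "s k (n k) = n (Suc k)"
    and s3: "i < n k \<Longrightarrow> s k i + 3 \<le> s k (Suc i)" and sM: "i < n k \<Longrightarrow> s k (Suc i) \<le> s k i + M"
    and P_s: "i \<le> n k \<Longrightarrow> P (Suc k) (s k i) = P k i"
    and step_ge: "i < n k \<Longrightarrow> r0 * \<rho> ^ k / C \<le> dist (P k i) (P k (Suc i))"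
    and step_le: "i < n k \<Longrightarrow> dist (P k i) (P k (Suc i)) \<le> 2 * (r0 * \<rho> ^ k)"
    and turn: "i \<le> a \<Longrightarrow> a \<le> b \<Longrightarrow> b \<le> j \<Longrightarrow> j \<le> n k \<Longrightarrow> dist (P k a) (P k b) \<le> C * dist (P k i) (P k j)"
    and C1: "1 \<le> C" and \<rho>: "0 < \<rho>" "2 * C * \<rho> \<le> 1" and r0: "0 < r0"
begin

section \<open>Levels, descendants and parents\<close>

definition r :: "nat \<Rightarrow> real" where "r k = r0 * \<rho> ^ k"

definition \<delta> :: "nat \<Rightarrow> nat \<Rightarrow> real" where "\<delta> k i = dist (P k i) (P k (Suc i))"

lemma \<rho>_half: "2 * \<rho> \<le> 1"
proof -
  have "2 * \<rho> \<le> 2 * \<rho> * C" using \<rho>(1) C1 by simp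
  then show ?thesis using \<rho>(2) by (simp add: mult.commute mult.left_commute)
qed

lemma r_pos: "0 < r k" using r0 \<rho> by (simp add: r_def)

lemma r_Suc: "r (Suc k) = \<rho> * r k" by (simp add: r_def)

lemma r_add: "r (k + e) = \<rho> ^ e * r k" by (simp add: r_def power_add)

lemma \<delta>_ge: "i < n k \<Longrightarrow> r k / C \<le> \<delta> k i" using step_ge by (simp add: r_def \<delta>_def)

lemma \<delta>_le: "i < n k \<Longrightarrow> \<delta> k i \<le> 2 * r k" using step_le by (simp add: r_def \<delta>_def)

lemma \<delta>_pos: "i < n k \<Longrightarrow> 0 < \<delta> k i"
  using \<delta>_ge[of i k] r_pos[of k] C1 by (metis divide_pos_pos less_le_trans zero_less_one)

lemma M3: "3 \<le> M" using s3[of 0 0] sM[of 0 0] n0 by simp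

lemma s_less: "i < j \<Longrightarrow> j \<le> n k \<Longrightarrow> s k i + 3 \<le> s k j"
proof (induction j)
  case (Suc j)
  then show ?case using s3[of j k] by (cases "i = j") auto
qed simp

lemma s_mono: "i \<le> j \<Longrightarrow> j \<le> n k \<Longrightarrow> s k i \<le> s k j"
  using s_less[of i j k] by (cases "i = j") auto

text \<open>Composed refinement maps. Descendants are encoded as index ranges: those of depth
  \<open>e\<close> of the interval \<open>i\<close> are the \<open>j\<close> with
  \<open>up k e i \<le> j\<close> and \<open>j < up k e (Suc i)\<close>.\<close>

primrec up :: "nat \<Rightarrow> nat \<Rightarrow> nat \<Rightarrow> nat" where
  "up k 0 i = i"
| "up k (Suc e) i = s (k + e) (up k e i)"

lemma up_zero [simp]: "up k e 0 = 0" by (induction e) (auto simp: s0)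

lemma up_n [simp]: "up k e (n k) = n (k + e)" by (induction e) (auto simp: sn)

lemma up_less: "i < j \<Longrightarrow> j \<le> n k \<Longrightarrow> up k e i < up k e j \<and> up k e j \<le> n (k + e)"
proof (induction e)
  case (Suc e)
  then have "s (k + e) (up k e j) \<le> s (k + e) (n (k + e))" by (intro s_mono) auto
  then show ?case using Suc s_less[of "up k e i" "up k e j" "k + e"] by (auto simp: sn)
qed simp

lemma up_mono: "i \<le> j \<Longrightarrow> j \<le> n k \<Longrightarrow> up k e i \<le> up k e j"
  using up_less[of i j k e] by (cases "i = j") auto

lemma up_le_n: "i \<le> n k \<Longrightarrow> up k e i \<le> n (k + e)"
  using up_mono[of i "n k" k e] by simp

lemma up_less_iff: "i \<le> n k \<Longrightarrow> j \<le> n k \<Longrightarrow> up k e i < up k e j \<longleftrightarrow> i < j"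
  using up_less[of i j k e] up_mono[of j i k e] by (metis not_less)

lemma up_add: "up k (e + e') i = up (k + e) e' (up k e i)"
  by (induction e') (auto simp: add.assoc)

lemma up_Suc_top: "up k (Suc e) i = up (Suc k) e (s k i)"
  using up_add[of k 1 e i] by simp

lemma up_dist_ge: "i < j \<Longrightarrow> j \<le> n k \<Longrightarrow> up k (Suc e) i + 3 \<le> up k (Suc e) j"
  using up_less[of i j k e] s_less by auto

lemma P_up: "i \<le> n k \<Longrightarrow> P (k + e) (up k e i) = P k i"
  by (induction e) (auto simp: P_s up_le_n)

definition par :: "nat \<Rightarrow> nat \<Rightarrow> nat" where
  "par k j = (SOME i. i < n k \<and> s k i \<le> j \<and> j < s k (Suc i))"

lemma par: assumes "j < n (Suc k)" shows "par k j < n k" "s k (par k j) \<le> j" "j < s k (Suc (par k j))"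
proof -
  obtain t where "0 \<le> t" "t < n k" "s k t \<le> j" "j < s k (Suc t)"
    by (rule discrete_crossing[of 0 "n k" "s k" j]) (use assms in \<open>auto simp: s0 sn\<close>)
  then have "\<exists>i. i < n k \<and> s k i \<le> j \<and> j < s k (Suc i)" by blast
  from someI_ex[OF this] show "par k j < n k" "s k (par k j) \<le> j" "j < s k (Suc (par k j))"
    by (auto simp: par_def)
qed

lemma par_eqI: assumes "i < n k" "s k i \<le> j" "j < s k (Suc i)" shows "par k j = i"
proof -
  have "s k (Suc i) \<le> n (Suc k)" using s_mono[of "Suc i" "n k" k] assms by (simp add: sn)
  then have p: "par k j < n k" "s k (par k j) \<le> j" "j < s k (Suc (par k j))" using par[of j k] assms by auto
  have "\<not> Suc (par k j) \<le> i" using s_mono[of "Suc (par k j)" i k] p assms by auto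
  moreover have "\<not> Suc i \<le> par k j" using s_mono[of "Suc i" "par k j" k] p assms by auto
  ultimately show ?thesis by auto
qed

lemma par_up:
  assumes "i < n k" "up k (Suc e) i \<le> j" "j < up k (Suc e) (Suc i)"
  shows "up k e i \<le> par (k + e) j" "par (k + e) j < up k e (Suc i)" "j < n (Suc (k + e))"
proof -
  have "up k (Suc e) (Suc i) \<le> n (Suc (k + e))" using up_le_n[of "Suc i" k "Suc e"] assms by simp
  then show j: "j < n (Suc (k + e))" using assms by simp
  note p = par[OF j]
  show "up k e i \<le> par (k + e) j"
  proof (rule ccontr)
    assume "\<not> ?thesis"
    then have "s (k + e) (Suc (par (k + e) j)) \<le> s (k + e) (up k e i)"
      using up_le_n[of i k e] assms by (intro s_mono) auto
    then show False using p assms by simp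
  qed
  show "par (k + e) j < up k e (Suc i)"
  proof (rule ccontr)
    assume "\<not> ?thesis"
    then have "s (k + e) (up k e (Suc i)) \<le> s (k + e) (par (k + e) j)"
      using p by (intro s_mono) auto
    then show False using p assms by simp
  qed
qed

section \<open>Weights of the intervals\<close>

definition tot :: "nat \<Rightarrow> nat \<Rightarrow> real" where
  "tot k i = (\<Sum>j\<in>{s k i..<s k (Suc i)}. \<delta> (Suc k) j)"

lemma child_less: "i < n k \<Longrightarrow> j < s k (Suc i) \<Longrightarrow> j < n (Suc k)"
  using s_mono[of "Suc i" "n k" k] by (simp add: sn)

lemma \<delta>_le_tot: assumes "i < n k" shows "\<delta> k i \<le> tot k i"
proof -
  have "dist (P (Suc k) a) (P (Suc k) (a + d)) \<le> (\<Sum>j\<in>{a..<a + d}. \<delta> (Suc k) j)" for a d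
  proof (induction d)
    case (Suc d)
    have "dist (P (Suc k) a) (P (Suc k) (a + Suc d)) \<le> dist (P (Suc k) a) (P (Suc k) (a + d)) + \<delta> (Suc k) (a + d)"
      unfolding \<delta>_def add_Suc_right by (rule dist_triangle)
    then show ?case using Suc by simp
  qed simp
  from this[of "s k i" "s k (Suc i) - s k i"]
  show ?thesis using assms s3[OF assms] P_s[of i k] P_s[of "Suc i" k] by (simp add: tot_def \<delta>_def)
qed

lemma tot_pos: "i < n k \<Longrightarrow> 0 < tot k i" using \<delta>_le_tot \<delta>_pos by (meson less_le_trans)

lemma tot_le: assumes "i < n k" shows "tot k i \<le> 2 * M * r (Suc k)"
proof -
  have "tot k i \<le> (\<Sum>j\<in>{s k i..<s k (Suc i)}. 2 * r (Suc k))"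
    unfolding tot_def by (intro sum_mono \<delta>_le) (use child_less[OF assms] in auto)
  also have "\<dots> = real (s k (Suc i) - s k i) * (2 * r (Suc k))" by simp
  also have "\<dots> \<le> real M * (2 * r (Suc k))"
    using sM[OF assms] r_pos[of "Suc k"] by (intro mult_right_mono) auto
  finally show ?thesis by (simp add: mult_ac)
qed

text \<open>\<open>tot\<close> adds at most \<open>M\<close> distances of at most
  \<open>2 * r (Suc k)\<close>, while each child contributes at least \<open>r (Suc k) / C\<close>.
  The quotient bounds from below every weight and every factor by which a slope drops in one
  level.\<close>

definition \<theta> :: real where "\<theta> = 1 / (2 * M * C)"

lemma \<theta>: "0 < \<theta>" "\<theta> \<le> 1"
proof -
  have "1 * 1 \<le> 2 * real M * C" using M3 C1 by (intro mult_mono) auto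
  then have "1 \<le> 2 * real M * C" by simp
  moreover from this have "0 < 2 * real M * C" by linarith
  ultimately show "0 < \<theta>" "\<theta> \<le> 1" unfolding \<theta>_def by (simp_all only: zero_less_divide_1_iff divide_le_eq_1_pos)
qed

definition \<omega> :: "nat \<Rightarrow> nat \<Rightarrow> real" where "\<omega> k j = \<delta> (Suc k) j / tot k (par k j)"

lemma \<omega>_ge: assumes "j < n (Suc k)" shows "\<theta> \<le> \<omega> k j"
proof -
  note p = par[OF assms]
  have "\<theta> * tot k (par k j) \<le> \<theta> * (2 * M * r (Suc k))"
    using tot_le[OF p(1)] \<theta> by (intro mult_left_mono) auto
  also have "\<dots> = r (Suc k) / C" using M3 C1 by (simp add: \<theta>_def)
  also have "\<dots> \<le> \<delta> (Suc k) j" by (rule \<delta>_ge[OF assms])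
  finally show ?thesis using tot_pos[OF p(1)] by (simp add: \<omega>_def pos_le_divide_eq)
qed

lemma ratio_ge: assumes "i < n k" shows "\<theta> \<le> \<delta> k i / tot k i"
proof -
  have "\<theta> * tot k i \<le> \<theta> * (2 * M * r (Suc k))"
    using tot_le[OF assms] \<theta> by (intro mult_left_mono) auto
  also have "\<dots> = r (Suc k) / C" using M3 C1 by (simp add: \<theta>_def)
  also have "\<dots> \<le> r k / C" using r_pos[of k] \<rho> \<rho>_half C1
    by (intro divide_right_mono) (auto simp: r_Suc)
  also have "\<dots> \<le> \<delta> k i" by (rule \<delta>_ge[OF assms])
  finally show ?thesis using tot_pos[OF assms] by (simp add: pos_le_divide_eq)
qed

lemma sum_\<omega>: assumes "i < n k" shows "(\<Sum>j\<in>{s k i..<s k (Suc i)}. \<omega> k j) = 1"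
proof -
  have "(\<Sum>j\<in>{s k i..<s k (Suc i)}. \<omega> k j) = (\<Sum>j\<in>{s k i..<s k (Suc i)}. \<delta> (Suc k) j / tot k i)"
    using par_eqI[OF assms] by (intro sum.cong) (auto simp: \<omega>_def)
  also have "\<dots> = tot k i / tot k i" by (simp only: tot_def sum_divide_distrib)
  finally show ?thesis using tot_pos[OF assms] by simp
qed

text \<open>Increments compatible with refinement: by this property the partial sums
  \<open>cum f\<close> of different levels agree at common subdivision points.\<close>

definition additive :: "(nat \<Rightarrow> nat \<Rightarrow> real) \<Rightarrow> bool" where
  "additive f \<longleftrightarrow> (\<forall>k. \<forall>i<n k. (\<Sum>j\<in>{s k i..<s k (Suc i)}. f (Suc k) j) = f k i)"

definition cum :: "(nat \<Rightarrow> nat \<Rightarrow> real) \<Rightarrow> nat \<Rightarrow> nat \<Rightarrow> real" where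
  "cum f k i = (\<Sum>j<i. f k j)"

lemma cum_diff: "a \<le> b \<Longrightarrow> cum f k b - cum f k a = (\<Sum>j\<in>{a..<b}. f k j)"
  unfolding cum_def by (metis add_diff_cancel_left' atLeast0LessThan sum.atLeastLessThan_concat zero_le)

lemma cum_s: assumes "additive f" shows "i \<le> n k \<Longrightarrow> cum f (Suc k) (s k i) = cum f k i"
proof (induction i)
  case 0
  then show ?case by (simp add: cum_def s0)
next
  case (Suc i)
  have "cum f (Suc k) (s k (Suc i)) - cum f (Suc k) (s k i) = f k i"
    using assms Suc.prems s3[of i k] by (subst cum_diff) (auto simp: additive_def)
  then show ?case using Suc by (simp add: cum_def)
qed

lemma cum_up: assumes "additive f" "i \<le> n k" shows "cum f (k + e) (up k e i) = cum f k i"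
  by (induction e) (auto simp: cum_s[OF assms(1)] up_le_n assms(2))

text \<open>Reaching the right child costs \<open>M * A * r (Suc k)\<close>, and so, by induction,
  does moving inside it. As \<open>2 * \<rho> \<le> 1\<close>, the sum is again at most
  \<open>M * A * r k\<close>, whatever the depth.\<close>

lemma cum_osc:
  fixes A :: real
  assumes f: "additive f" and A: "0 \<le> A" "\<And>k j. j < n k \<Longrightarrow> \<bar>f k j\<bar> \<le> A * r k"
  shows "i < n k \<Longrightarrow> up k e i \<le> j \<Longrightarrow> j \<le> up k e (Suc i) \<Longrightarrow> \<bar>cum f (k + e) j - cum f k i\<bar> \<le> M * A * r k"
proof (induction e arbitrary: k i)
  case 0
  have "A * r k \<le> M * A * r k" using M3 A(1) r_pos[of k] mult_right_mono[of 1 "real M" A]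
    by (intro mult_right_mono) auto
  moreover have "j = i \<or> j = Suc i" using 0 by auto
  ultimately show ?case using A(2)[OF 0(1)] A(1) r_pos[of k] by (auto simp: cum_def)
next
  case (Suc e)
  have "\<exists>t. s k i \<le> t \<and> t < s k (Suc i) \<and> up (Suc k) e t \<le> j \<and> j \<le> up (Suc k) e (Suc t)"
  \<comment> \<open>The right endpoint lies in none of the half-open child ranges and is assigned to
    the last child.\<close>
  proof (cases "j = up k (Suc e) (Suc i)")
    case True
    have "Suc (s k (Suc i) - 1) = s k (Suc i)" using s3[OF Suc.prems(1)] by simp
    moreover have "up (Suc k) e (s k (Suc i) - 1) \<le> up (Suc k) e (s k (Suc i))"
      using Suc.prems(1) s_mono[of "Suc i" "n k" k] by (intro up_mono) (auto simp: sn)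
    ultimately show ?thesis using True s3[OF Suc.prems(1)]
      by (intro exI[of _ "s k (Suc i) - 1"]) (auto simp: up_Suc_top simp del: up.simps)
  next
    case False
    have "s k i \<le> s k (Suc i)" using s3[OF Suc.prems(1)] by simp
    moreover have "up (Suc k) e (s k i) \<le> j" "j < up (Suc k) e (s k (Suc i))"
      using Suc.prems(2,3) False by (auto simp: up_Suc_top simp del: up.simps)
    ultimately show ?thesis by (rule discrete_crossing[of _ _ "up (Suc k) e"]) (auto intro: less_imp_le)
  qed
  then obtain t where t: "s k i \<le> t" "t < s k (Suc i)" "up (Suc k) e t \<le> j" "j \<le> up (Suc k) e (Suc t)" by blast
  have 1: "\<bar>cum f (Suc k + e) j - cum f (Suc k) t\<bar> \<le> M * A * r (Suc k)"
    using t child_less[OF Suc.prems(1)] by (intro Suc.IH) auto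
  have "\<bar>cum f (Suc k) t - cum f (Suc k) (s k i)\<bar> = \<bar>\<Sum>j\<in>{s k i..<t}. f (Suc k) j\<bar>"
    using t by (simp add: cum_diff)
  also have "\<dots> \<le> (\<Sum>j\<in>{s k i..<t}. \<bar>f (Suc k) j\<bar>)" by (rule sum_abs)
  also have "\<dots> \<le> (\<Sum>j\<in>{s k i..<t}. A * r (Suc k))"
    using t child_less[OF Suc.prems(1)] by (intro sum_mono A(2)) auto
  also have "\<dots> = real (t - s k i) * (A * r (Suc k))" by simp
  also have "\<dots> \<le> real M * (A * r (Suc k))"
    using t sM[OF Suc.prems(1)] A(1) r_pos[of "Suc k"] by (intro mult_right_mono) auto
  finally have "\<bar>cum f (Suc k + e) j - cum f k i\<bar> \<le> 2 * (M * A * r (Suc k))"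
    using 1 cum_s[OF f, of i k] Suc.prems(1) by simp
  also have "\<dots> = 2 * \<rho> * (M * A * r k)" by (simp add: r_Suc)
  also have "\<dots> \<le> 1 * (M * A * r k)" using \<rho>_half A(1) r_pos[of k] by (intro mult_right_mono) auto
  finally show ?case by simp
qed

end

section \<open>Zigzag coordinates of an arc\<close>

text \<open>Two points whose distance is comparable to \<open>\<rho> ^ k\<close> are rounded to subdivision points of level \<open>k + H\<close>.
  Since \<open>2 * H < m\<close>, a block that was restarted recently is not restarted again on the \<open>H\<close> levels in between. The
  conditions on \<open>H\<close> and \<open>e\<close> make the rounding errors and the contributions of depth \<open>e\<close> negligible.\<close>

locale arc_embedding = arc_net +
  fixes m e H :: nat
  assumes e1: "1 \<le> e" and e_small: "2 * (M * (8 * C / \<rho>) * \<rho> ^ e) \<le> \<theta>\<^sup>2 / (16 * C)"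
    and eH: "e \<le> H" and H_small: "3 * (M * (8 * C / \<rho>) * \<rho> ^ H) \<le> \<theta> ^ (e + 1) / (32 * C)"
    and mH: "2 * H < m" and m_small: "4 * C / \<rho> * (1 / 2) ^ m \<le> 1 / 8"
begin

text \<open>\<open>A0 / 2\<close> bounds the ratio of the endpoint distance of an interval to that
  of a child, hence the slope of a fresh zigzag on the children.\<close>

definition A0 :: real where "A0 = 4 * C / \<rho>"

lemma A0: "2 \<le> A0" "0 < A0" "A0 * (1 / 2) ^ m \<le> 1 / 8"
proof -
  have "2 * \<rho> \<le> 4 * C" using \<rho>_half C1 by linarith
  then show "2 \<le> A0" using \<rho>(1) by (simp add: A0_def pos_le_divide_eq)
  then show "0 < A0" by linarith
qed (use m_small in \<open>simp add: A0_def\<close>)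

lemma m0: "0 < m" using mH by simp

text \<open>On the \<open>j\<close>-th interval of level \<open>k\<close>, \<open>\<sigma> k j\<close> is the fraction left of the slope of the latest zigzag,
  \<open>gen k j\<close> the number of restarts so far, \<open>inc b p k j\<close> the increment of coordinate \<open>p\<close> of block \<open>b\<close>, and
  \<open>\<mu> k j\<close> the weight.\<close>

primrec \<sigma> :: "nat \<Rightarrow> nat \<Rightarrow> real" where
  "\<sigma> 0 = (\<lambda>j. 1)"
| "\<sigma> (Suc k) = (\<lambda>j. if \<sigma> k (par k j) \<le> 1 / 2 then 1
     else \<sigma> k (par k j) * (\<delta> k (par k j) / tot k (par k j)))"

primrec gen :: "nat \<Rightarrow> nat \<Rightarrow> nat" where
  "gen 0 = (\<lambda>j. 0)"
| "gen (Suc k) = (\<lambda>j. gen k (par k j) + (if \<sigma> k (par k j) \<le> 1 / 2 then 1 else 0))"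

definition restart :: "nat \<Rightarrow> nat \<Rightarrow> nat \<Rightarrow> bool" where
  "restart b k i \<longleftrightarrow> \<sigma> k i \<le> 1 / 2 \<and> Suc (gen k i) mod m = b"

primrec inc :: "nat \<Rightarrow> nat \<Rightarrow> nat \<Rightarrow> nat \<Rightarrow> real" where
  "inc b p 0 = (\<lambda>j. if b = 0 \<and> p = 1 then \<delta> 0 0 else 0)"
| "inc b p (Suc k) = (\<lambda>j. inc b p k (par k j) * \<omega> k j +
     (if restart b k (par k j)
      then \<delta> k (par k j) * dir (s k (Suc (par k j)) - s k (par k j)) p (j - s k (par k j)) else 0))"

primrec \<mu> :: "nat \<Rightarrow> nat \<Rightarrow> real" where
  "\<mu> 0 = (\<lambda>j. 1)"
| "\<mu> (Suc k) = (\<lambda>j. \<mu> k (par k j) * \<omega> k j)"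

lemma additive_\<mu>: "additive \<mu>"
  unfolding additive_def
proof (intro allI impI)
  fix k i assume i: "i < n k"
  have "(\<Sum>j\<in>{s k i..<s k (Suc i)}. \<mu> (Suc k) j) = (\<Sum>j\<in>{s k i..<s k (Suc i)}. \<mu> k i * \<omega> k j)"
    using par_eqI[OF i] by (intro sum.cong) auto
  also have "\<dots> = \<mu> k i" using sum_\<omega>[OF i] by (simp add: sum_distrib_left[symmetric])
  finally show "(\<Sum>j\<in>{s k i..<s k (Suc i)}. \<mu> (Suc k) j) = \<mu> k i" .
qed

lemma additive_inc: "additive (inc b p)"
  unfolding additive_def
proof (intro allI impI)
  fix k i assume i: "i < n k"
  let ?l = "s k (Suc i) - s k i"
  have "(\<Sum>j\<in>{s k i..<s k (Suc i)}. inc b p (Suc k) j) = (\<Sum>j\<in>{s k i..<s k (Suc i)}. inc b p k i * \<omega> k j +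
     (if restart b k i then \<delta> k i * dir ?l p (j - s k i) else 0))"
    using par_eqI[OF i] by (intro sum.cong) auto
  also have "\<dots> = inc b p k i + (\<Sum>j\<in>{s k i..<s k (Suc i)}. if restart b k i then \<delta> k i * dir ?l p (j - s k i) else 0)"
    using sum_\<omega>[OF i] by (simp add: sum.distrib sum_distrib_left[symmetric])
  also have "(\<Sum>j\<in>{s k i..<s k (Suc i)}. if restart b k i then \<delta> k i * dir ?l p (j - s k i) else 0) =
      (if restart b k i then \<delta> k i * (\<Sum>j\<in>{s k i..<s k (Suc i)}. dir ?l p (j - s k i)) else 0)"
    by (simp add: sum_distrib_left)
  also have "(\<Sum>j\<in>{s k i..<s k (Suc i)}. dir ?l p (j - s k i)) = (\<Sum>c<?l. dir ?l p c)"
    using s3[OF i] by (intro sum.reindex_bij_witness[of _ "\<lambda>c. c + s k i" "\<lambda>j. j - s k i"]) auto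
  finally show "(\<Sum>j\<in>{s k i..<s k (Suc i)}. inc b p (Suc k) j) = inc b p k i" by (simp add: sum_dir)
qed

text \<open>A value above \<open>1 / 2\<close> loses at most a factor \<theta> in one level, and any
  other value is reset to 1 on the next level.\<close>

lemma \<sigma>_bounds: "j < n k \<Longrightarrow> \<theta> / 2 \<le> \<sigma> k j \<and> \<sigma> k j \<le> 1"
proof (induction k arbitrary: j)
  case 0
  then show ?case using \<theta> by simp
next
  case (Suc k)
  note p = par[OF Suc.prems]
  define i where "i = par k j"
  have i: "i < n k" using p by (simp add: i_def)
  show ?case
  proof (cases "\<sigma> k i \<le> 1 / 2")
    case True
    then show ?thesis using \<theta> by (simp add: i_def)
  next
    case False
    have "1 / 2 * \<theta> \<le> \<sigma> k i * (\<delta> k i / tot k i)"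
      using False ratio_ge[OF i] \<theta> by (intro mult_mono) auto
    moreover have "\<sigma> k i * (\<delta> k i / tot k i) \<le> 1 * 1"
      using Suc.IH[OF i] False \<delta>_le_tot[OF i] tot_pos[OF i] \<delta>_pos[OF i] by (intro mult_mono) auto
    ultimately show ?thesis using False by (simp add: i_def)
  qed
qed

lemma \<mu>_pos: "j < n k \<Longrightarrow> 0 < \<mu> k j"
proof (induction k arbitrary: j)
  case (Suc k)
  have "0 < \<omega> k j" using \<omega>_ge[OF Suc.prems] \<theta> by linarith
  then show ?case using Suc.IH[OF par(1)[OF Suc.prems]] by simp
qed simp

lemma descendant_induct [consumes 3, case_names base step]:
  assumes "i < n k" "up k d i \<le> j" "j < up k d (Suc i)"
    and "Q 0 i"
    and "\<And>d j. up k (Suc d) i \<le> j \<Longrightarrow> j < up k (Suc d) (Suc i) \<Longrightarrow> up k d i \<le> par (k + d) j \<Longrightarrow>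
       par (k + d) j < up k d (Suc i) \<Longrightarrow> par (k + d) j < n (k + d) \<Longrightarrow> j < n (Suc (k + d)) \<Longrightarrow>
       Q d (par (k + d) j) \<Longrightarrow> Q (Suc d) j"
  shows "Q d j"
  using assms(2,3)
proof (induction d arbitrary: j)
  case 0
  then have "j = i" by simp
  then show ?case using assms(4) by simp
next
  case (Suc d)
  note p = par_up[OF assms(1) Suc.prems]
  show ?case using assms(5)[OF Suc.prems p(1,2) par(1)[OF p(3)] p(3) Suc.IH[OF p(1,2)]] .
qed

lemma \<mu>_descendant:
  assumes "i < n k" "up k d i \<le> j" "j < up k d (Suc i)"
  shows "\<theta> ^ d * \<mu> k i \<le> \<mu> (k + d) j"
  using assms
proof (induction rule: descendant_induct)
  case (step d j)
  have "\<theta> ^ d * \<mu> k i * \<theta> \<le> \<mu> (k + d) (par (k + d) j) * \<omega> (k + d) j"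
    using step \<omega>_ge[of j "k + d"] \<theta> \<mu>_pos[of "par (k + d) j" "k + d"] \<mu>_pos[OF assms(1)] by (intro mult_mono) auto
  then show ?case by (simp add: mult_ac)
qed simp

lemma gen_descendant:
  assumes "i < n k" "up k d i \<le> j" "j < up k d (Suc i)"
  shows "gen k i \<le> gen (k + d) j \<and> gen (k + d) j \<le> gen k i + d"
  using assms by (induction rule: descendant_induct) auto

text \<open>\<open>a\<close> is the age of block \<open>b\<close>, counted in restarts since its
  last turn in the cyclic order. Without a restart both sides are multiplied by the same factor. At
  a restart \<sigma> is reset from at most \<open>1 / 2\<close> to 1, and this factor pays for the
  increase of the age by one. In the block whose turn it is, the remainder of age
  \<open>m - 1\<close> drops to at most an eighth of the endpoint distance, and the new zigzag adds
  at most \<open>A0 / 2\<close> times that distance.\<close>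

lemma inc_le:
  "j < n k \<Longrightarrow> a < m \<Longrightarrow> (b + a) mod m = gen k j mod m \<Longrightarrow> \<bar>inc b p k j\<bar> \<le> A0 * (1 / 2) ^ a * \<sigma> k j * \<delta> k j"
proof (induction k arbitrary: j a)
  case 0
  show ?case
  proof (cases "b = 0 \<and> p = 1")
    case True
    then have "a = 0" using 0 m0 by simp
    moreover have "j = 0" using 0 n0 by simp
    ultimately show ?thesis using True A0 mult_right_mono[of 1 A0 "\<delta> 0 0"] \<delta>_pos[of 0 0] n0 by simp
  next
    case False
    then have "inc b p 0 j = 0" by auto
    moreover have "0 \<le> A0 * (1 / 2) ^ a * \<sigma> 0 j * \<delta> 0 j" using A0 \<delta>_pos[OF 0(1)] by simp
    ultimately show ?thesis by simp
  qed
next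
  case (Suc k)
  note p = par[OF Suc.prems(1)]
  define i where "i = par k j"
  have i: "i < n k" using p by (simp add: i_def)
  have \<omega>: "0 < \<omega> k j" using \<omega>_ge[OF Suc.prems(1)] \<theta> by linarith
  have \<delta>\<omega>: "\<delta> k i * \<omega> k j = \<delta> k i / tot k i * \<delta> (Suc k) j" by (simp add: \<omega>_def i_def)
  have \<delta>\<omega>_le: "\<delta> k i * \<omega> k j \<le> \<delta> (Suc k) j"
  proof -
    have "\<delta> k i / tot k i * \<delta> (Suc k) j \<le> 1 * \<delta> (Suc k) j"
      using \<delta>_le_tot[OF i] tot_pos[OF i] \<delta>_pos[OF Suc.prems(1)] by (intro mult_right_mono) auto
    then show ?thesis using \<delta>\<omega> by simp
  qed
  have \<delta>_par: "\<delta> k i \<le> A0 / 2 * \<delta> (Suc k) j"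
  proof -
    have "\<delta> k i \<le> 2 * r k" by (rule \<delta>_le[OF i])
    also have "\<dots> = A0 / 2 * (r (Suc k) / C)" using \<rho> C1 by (simp add: A0_def r_Suc)
    also have "\<dots> \<le> A0 / 2 * \<delta> (Suc k) j" using A0 \<delta>_ge[OF Suc.prems(1)] by (intro mult_left_mono) auto
    finally show ?thesis .
  qed
  have scale: "\<bar>inc b p k i * \<omega> k j\<bar> \<le> A0 * (1 / 2) ^ c * \<sigma> k i * (\<delta> k i * \<omega> k j)"
    if "c < m" "(b + c) mod m = gen k i mod m" for c
  proof -
    have "\<bar>inc b p k i\<bar> * \<omega> k j \<le> A0 * (1 / 2) ^ c * \<sigma> k i * \<delta> k i * \<omega> k j"
      using Suc.IH[OF i that] \<omega> by (intro mult_right_mono) auto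
    then show ?thesis using \<omega> by (simp add: abs_mult mult_ac)
  qed
  show ?case
  proof (cases "\<sigma> k i \<le> 1 / 2")
    case False
    then have "gen (Suc k) j = gen k i" "\<not> restart b k i" by (auto simp: i_def restart_def)
    then have "inc b p (Suc k) j = inc b p k i * \<omega> k j" by (simp add: i_def)
    moreover have "\<sigma> (Suc k) j * \<delta> (Suc k) j = \<sigma> k i * (\<delta> k i * \<omega> k j)"
      using False \<delta>\<omega> by (simp add: i_def)
    ultimately show ?thesis using scale[OF Suc.prems(2)] Suc.prems(3) \<open>gen (Suc k) j = gen k i\<close>
      by (metis mult.assoc)
  next
    case True
    have g: "gen (Suc k) j = Suc (gen k i)" and \<sigma>1: "\<sigma> (Suc k) j = 1" using True by (auto simp: i_def)
    have half: "A0 * (1 / 2) ^ c * \<sigma> k i * (\<delta> k i * \<omega> k j) \<le> A0 * (1 / 2) ^ Suc c * \<delta> (Suc k) j" for c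
    proof -
      have "A0 * (1 / 2) ^ c * (\<sigma> k i * (\<delta> k i * \<omega> k j)) \<le> A0 * (1 / 2) ^ c * (1 / 2 * \<delta> (Suc k) j)"
        using A0 True \<sigma>_bounds[OF i] \<theta> \<delta>\<omega>_le \<delta>_pos[OF i] \<omega> by (intro mult_left_mono mult_mono) auto
      then show ?thesis by (simp add: mult_ac)
    qed
    show ?thesis
    proof (cases a)
      case (Suc c)
      have "Suc (b + c) mod m = Suc (gen k i) mod m" using Suc.prems(3) g Suc by simp
      then have bc: "(b + c) mod m = gen k i mod m" by (rule mod_Suc_cancel[OF _ m0])
      have "\<not> restart b k i"
      proof
        assume "restart b k i"
        then have "(b + a) mod m = b mod m" using Suc.prems(3) g by (auto simp: restart_def)
        then show False using mod_add_self_imp_zero[of b a m] Suc.prems(2) Suc by simp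
      qed
      then have "inc b p (Suc k) j = inc b p k i * \<omega> k j" by (simp add: i_def)
      then show ?thesis using scale[of c] bc Suc.prems(2) Suc half[of c] \<sigma>1 by (simp add: mult_ac)
    next
      case 0
      define c where "c = m - 1"
      have c: "Suc c = m" using m0 by (simp add: c_def)
      have "Suc (b + c) mod m = Suc (gen k i) mod m"
        using Suc.prems(3) g 0 c by (metis add_0_right add_Suc_right mod_add_self2)
      then have bc: "(b + c) mod m = gen k i mod m" by (rule mod_Suc_cancel[OF _ m0])
      have "\<bar>inc b p k i * \<omega> k j\<bar> \<le> A0 * (1 / 2) ^ m * \<delta> (Suc k) j"
        using scale[of c] bc c half[of c] by simp
      also have "\<dots> \<le> 1 / 8 * \<delta> (Suc k) j" using A0 \<delta>_pos[OF Suc.prems(1)] by (intro mult_right_mono) auto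
      finally have 1: "\<bar>inc b p k i * \<omega> k j\<bar> \<le> 1 / 8 * \<delta> (Suc k) j" .
      let ?x = "if restart b k i then \<delta> k i * dir (s k (Suc i) - s k i) p (j - s k i) else 0"
      have "\<bar>?x\<bar> \<le> \<delta> k i * 1"
        using abs_dir_le[of "s k (Suc i) - s k i" p "j - s k i"] \<delta>_pos[OF i]
        by (auto simp: abs_mult mult_left_le)
      moreover have "1 / 8 * \<delta> (Suc k) j + A0 / 2 * \<delta> (Suc k) j \<le> A0 * \<delta> (Suc k) j"
      proof -
        have "(1 / 8 + A0 / 2) * \<delta> (Suc k) j \<le> A0 * \<delta> (Suc k) j"
          using A0 \<delta>_pos[OF Suc.prems(1)] by (intro mult_right_mono) auto
        then show ?thesis by (simp add: distrib_right)
      qed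
      moreover have "inc b p (Suc k) j = inc b p k i * \<omega> k j + ?x" by (simp add: i_def)
      ultimately have "\<bar>inc b p (Suc k) j\<bar> \<le> A0 * \<delta> (Suc k) j" using 1 \<delta>_par by linarith
      then show ?thesis using \<sigma>1 0 by simp
    qed
  qed
qed

lemma age_exists: obtains a where "a < m" "(b + a) mod m = g mod m"
proof -
  define a where "a = (g + (m - b mod m)) mod m"
  have "(b + a) mod m = (b mod m + (g + (m - b mod m))) mod m"
    unfolding a_def by (metis mod_add_left_eq mod_add_right_eq)
  also have "b mod m + (g + (m - b mod m)) = g + m" using mod_less_divisor[OF m0, of b] by arith
  finally show thesis using that[of a] m0 by (simp add: a_def)
qed

lemma inc_le_r: assumes "j < n k" shows "\<bar>inc b p k j\<bar> \<le> 2 * A0 * r k"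
proof -
  obtain a where a: "a < m" "(b + a) mod m = gen k j mod m" by (rule age_exists)
  have "\<bar>inc b p k j\<bar> \<le> A0 * (1 / 2) ^ a * \<sigma> k j * \<delta> k j" by (rule inc_le[OF assms a])
  also have "\<dots> \<le> A0 * 1 * 1 * (2 * r k)"
    using A0 \<sigma>_bounds[OF assms] \<theta> \<delta>_le[OF assms] \<delta>_pos[OF assms]
    by (intro mult_mono) (auto simp: power_le_one)
  finally show ?thesis by (simp add: mult_ac)
qed

text \<open>Since its last restart the vector of block \<open>b\<close> has only been rescaled by
  weights, and what it held before had age \<open>m - 1\<close> and is negligible by
  \<open>inc_le\<close>. So it keeps the direction of one child vector \<open>dir l p c\<close>. In
  the block restarted last its size is at least that of the current slope.\<close>

lemma inc_direction:
  "j < n k \<Longrightarrow> \<exists>\<kappa> l c. 0 \<le> \<kappa> \<and> 3 \<le> l \<and> l \<le> M \<and> c < l \<and> (\<forall>p. \<bar>inc b p k j - \<kappa> * dir l p c\<bar> \<le> \<kappa> / 8) \<and>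
     (b = gen k j mod m \<longrightarrow> \<sigma> k j * \<delta> k j \<le> \<kappa>)"
proof (induction k arbitrary: j)
  case 0
  then have j: "j = 0" using n0 by simp
  show ?case
  proof (cases "b = 0")
    case True
    \<comment> \<open>The initial slope is treated as the first child of a fictitious subdivision
      into three, whose vector lives in coordinate 1 only.\<close>
    have "inc b p 0 j - \<delta> 0 0 * dir 3 p 0 = 0" for p by (simp add: True dir_def hat_def)
    then show ?thesis using M3 j \<delta>_pos[of 0 0] n0
      by (intro exI[of _ "\<delta> 0 0"] exI[of _ 3] exI[of _ 0]) (simp del: inc.simps)
  next
    case False
    then show ?thesis using M3 by (intro exI[of _ 0] exI[of _ 3]) auto
  qed
next
  case (Suc k)
  note p = par[OF Suc.prems]
  define i where "i = par k j"
  have i: "i < n k" using p by (simp add: i_def)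
  have \<omega>: "0 < \<omega> k j" using \<omega>_ge[OF Suc.prems(1)] \<theta> by linarith
  show ?case
  proof (cases "restart b k i")
    case False
    obtain \<kappa> l c where IH: "0 \<le> \<kappa>" "3 \<le> l" "l \<le> M" "c < l" "\<And>p. \<bar>inc b p k i - \<kappa> * dir l p c\<bar> \<le> \<kappa> / 8"
       "b = gen k i mod m \<Longrightarrow> \<sigma> k i * \<delta> k i \<le> \<kappa>"
      using Suc.IH[OF i] by blast
    have inc: "inc b p (Suc k) j = inc b p k i * \<omega> k j" for p using False by (simp add: i_def)
    have "\<bar>inc b p (Suc k) j - \<kappa> * \<omega> k j * dir l p c\<bar> \<le> \<kappa> * \<omega> k j / 8" for p
    proof -
      have "\<bar>(inc b p k i - \<kappa> * dir l p c) * \<omega> k j\<bar> \<le> \<kappa> / 8 * \<omega> k j"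
        using IH(5) \<omega> by (simp add: abs_mult mult_right_mono)
      then show ?thesis unfolding inc by (simp add: algebra_simps del: inc.simps)
    qed
    moreover have "\<sigma> (Suc k) j * \<delta> (Suc k) j \<le> \<kappa> * \<omega> k j" if b: "b = gen (Suc k) j mod m"
    proof (cases "\<sigma> k i \<le> 1 / 2")
      case True
      then show ?thesis using b False by (simp add: i_def restart_def)
    next
      case nr: False
      then have "\<sigma> k i * \<delta> k i * \<omega> k j \<le> \<kappa> * \<omega> k j" using IH(6) b \<omega> by (intro mult_right_mono) (auto simp: i_def)
      then show ?thesis using nr by (simp add: i_def \<omega>_def)
    qed
    ultimately show ?thesis using IH \<omega> by (intro exI[of _ "\<kappa> * \<omega> k j"] exI[of _ l] exI[of _ c]) (simp del: inc.simps \<sigma>.simps gen.simps)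
  next
    case True
    define l where "l = s k (Suc i) - s k i"
    define c where "c = j - s k i"
    have lc: "3 \<le> l" "l \<le> M" "c < l" using s3[OF i] sM[OF i] p by (auto simp: l_def c_def i_def)
    have inc: "inc b p (Suc k) j = inc b p k i * \<omega> k j + \<delta> k i * dir l p c" for p
      using True by (simp add: i_def l_def c_def)
    have \<sigma>1: "\<sigma> (Suc k) j = 1" and \<sigma>2: "\<sigma> k i \<le> 1 / 2" using True by (auto simp: i_def restart_def)
    \<comment> \<open>By \<open>2 * C * \<rho> \<le> 1\<close> no child has a larger endpoint
      distance than its parent; this makes \<open>\<kappa> = \<delta> k i\<close> large enough after
      the restart.\<close>
    have "\<delta> (Suc k) j \<le> 2 * \<rho> * r k" using \<delta>_le[OF Suc.prems] by (simp add: r_Suc)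
    also have "2 * \<rho> * r k \<le> r k / C"
    proof -
      have "2 * C * \<rho> * r k \<le> 1 * r k" using \<rho>(2) r_pos[of k] by (intro mult_right_mono) auto
      then show ?thesis using C1 by (simp add: pos_le_divide_eq mult_ac)
    qed
    also have "\<dots> \<le> \<delta> k i" by (rule \<delta>_ge[OF i])
    finally have \<delta>\<delta>: "\<delta> (Suc k) j \<le> \<delta> k i" .
    define a where "a = m - 1"
    have a: "Suc a = m" "a < m" using m0 by (auto simp: a_def)
    have "Suc (b + a) mod m = Suc (gen k i) mod m"
    proof -
      have "Suc (b + a) mod m = b mod m" using a(1) by (metis add_Suc_right mod_add_self2)
      also have "\<dots> = Suc (gen k i) mod m" using True by (auto simp: restart_def)
      finally show ?thesis .
    qed
    then have ba: "(b + a) mod m = gen k i mod m" by (rule mod_Suc_cancel[OF _ m0])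
    have small: "\<bar>inc b p k i * \<omega> k j\<bar> \<le> \<delta> k i / 8" for p
    proof -
      have "\<bar>inc b p k i\<bar> \<le> A0 * (1 / 2) ^ a * \<sigma> k i * \<delta> k i" by (rule inc_le[OF i a(2) ba])
      also have "\<dots> \<le> A0 * (1 / 2) ^ a * (1 / 2) * \<delta> k i"
        using A0 \<sigma>2 \<delta>_pos[OF i] by (intro mult_right_mono mult_left_mono) auto
      also have "\<dots> = A0 * (1 / 2) ^ m * \<delta> k i" unfolding a(1)[symmetric] by simp
      also have "\<dots> \<le> 1 / 8 * \<delta> k i" using A0 \<delta>_pos[OF i] by (intro mult_right_mono) auto
      finally have "\<bar>inc b p k i\<bar> * \<omega> k j \<le> 1 / 8 * \<delta> k i * \<omega> k j" using \<omega> by (intro mult_right_mono) auto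
      also have "\<dots> = 1 / 8 * (\<delta> k i / tot k i * \<delta> (Suc k) j)" by (simp add: \<omega>_def i_def)
      also have "\<dots> \<le> 1 / 8 * (1 * \<delta> (Suc k) j)"
        using \<delta>_le_tot[OF i] tot_pos[OF i] \<delta>_pos[OF Suc.prems(1)] by (intro mult_left_mono mult_right_mono) auto
      also have "\<dots> \<le> \<delta> k i / 8" using \<delta>\<delta> by simp
      finally show ?thesis using \<omega> by (simp add: abs_mult)
    qed
    show ?thesis
      using lc \<delta>_pos[OF i] small \<delta>\<delta> \<sigma>1
      by (intro exI[of _ "\<delta> k i"] exI[of _ l] exI[of _ c]) (simp add: inc del: inc.simps \<sigma>.simps gen.simps)
  qed
qed

end

section \<open>The scale of a pair of points\<close>

context arc_net
begin

text \<open>Level \<open>k\<close> is one where two adjacent intervals still contain the pair, while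
  on level \<open>k + 1\<close> this fails. It exists because level 0 is a single interval and
  \<open>I + 3 \<le> J\<close> rules out level \<open>\<Lambda>\<close>. On level
  \<open>k + 1\<close> the interval containing \<open>I\<close> and its right neighbour do not reach
  \<open>J\<close>, so this neighbour lies between the points. The \<open>min\<close> is for the
  last interval, which has no neighbour.\<close>

lemma scale_exists:
  assumes "I + 3 \<le> J" "J \<le> n \<Lambda>"
  obtains k i w where "k < \<Lambda>" "i < n k" "w < n (Suc k)" "up k (\<Lambda> - k) i \<le> I"
    "J \<le> up k (\<Lambda> - k) (min (i + 2) (n k))"
    "I \<le> up (Suc k) (\<Lambda> - Suc k) w" "up (Suc k) (\<Lambda> - Suc k) (Suc w) \<le> J"
proof -
  define Q where "Q = (\<lambda>k. \<exists>i<n k. up k (\<Lambda> - k) i \<le> I \<and> J \<le> up k (\<Lambda> - k) (min (i + 2) (n k)))"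
  have "Q 0" using assms up_n[of 0 \<Lambda>] by (auto simp: Q_def n0)
  have "\<not> Q \<Lambda>" using assms by (auto simp: Q_def)
  have "\<exists>k<\<Lambda>. Q k \<and> \<not> Q (Suc k)"
  proof (rule ccontr)
    assume "\<not> ?thesis"
    then have step: "Q k \<Longrightarrow> k < \<Lambda> \<Longrightarrow> Q (Suc k)" for k by blast
    have "k \<le> \<Lambda> \<Longrightarrow> Q k" for k by (induction k) (use \<open>Q 0\<close> step in auto)
    then show False using \<open>\<not> Q \<Lambda>\<close> by blast
  qed
  then obtain k where k: "k < \<Lambda>" "Q k" "\<not> Q (Suc k)" by blast
  obtain i where i: "i < n k" "up k (\<Lambda> - k) i \<le> I" "J \<le> up k (\<Lambda> - k) (min (i + 2) (n k))"
    using k(2) by (auto simp: Q_def)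
  let ?u = "up (Suc k) (\<Lambda> - Suc k)"
  have un: "?u (n (Suc k)) = n \<Lambda>" using up_n[of "Suc k" "\<Lambda> - Suc k"] k(1) by simp
  obtain v where v: "v < n (Suc k)" "?u v \<le> I" "I < ?u (Suc v)"
    by (rule discrete_crossing[of 0 "n (Suc k)" ?u I]) (use assms un in auto)
  have "\<not> J \<le> ?u (min (v + 2) (n (Suc k)))" using k(3) v by (auto simp: Q_def)
  moreover have "v + 2 < n (Suc k)"
  proof (rule ccontr)
    assume "\<not> ?thesis"
    then have "min (v + 2) (n (Suc k)) = n (Suc k)" by simp
    then show False using calculation assms un by simp
  qed
  ultimately show thesis using that[of k i "Suc v"] k(1) i v by simp
qed

end

context arc_embedding
begin

lemma H1: "1 \<le> H" using e1 eH by simp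

text \<open>One level down, three children per interval provide the gap that
  \<open>scale_exists\<close> requires. Another \<open>H\<close> levels make the common level at
  least \<open>k + H\<close>, the level of rounding, even when \<open>k + H\<close> exceeds
  \<open>l\<close>.\<close>

lemma pair_scale:
  assumes "i < j" "j \<le> n l"
  obtains k i0 w d I J where "i0 < n k" "w < n (Suc k)" "J \<le> n (k + H + d)" "I < J"
    "P (k + H + d) I = P l i" "P (k + H + d) J = P l j"
    "\<And>f. additive f \<Longrightarrow> cum f (k + H + d) I = cum f l i" "\<And>f. additive f \<Longrightarrow> cum f (k + H + d) J = cum f l j"
    "up (k + H) d (up k H i0) \<le> I" "J \<le> up (k + H) d (up k H (min (i0 + 2) (n k)))"
    "I \<le> up (k + H) d (up (Suc k) (H - 1) w)" "up (k + H) d (up (Suc k) (H - 1) (Suc w)) \<le> J"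
proof -
  have j: "up l 1 j \<le> n (Suc l)" using up_le_n[of j l 1] assms by simp
  have "up l 1 i + 3 \<le> up l 1 j" using up_dist_ge[of i j l 0] assms by simp
  from scale_exists[OF this j]
  obtain k i0 w where k: "k < Suc l" "i0 < n k" "w < n (Suc k)" "up k (Suc l - k) i0 \<le> up l 1 i"
    "up l 1 j \<le> up k (Suc l - k) (min (i0 + 2) (n k))"
    "up l 1 i \<le> up (Suc k) (Suc l - Suc k) w" "up (Suc k) (Suc l - Suc k) (Suc w) \<le> up l 1 j" .
  define d where "d = Suc l - k"
  have kd: "k + d = Suc l" "k + H + d = l + (1 + H)" "k + H + d = Suc l + H" using k by (auto simp: d_def)
  define I where "I = up (Suc l) H (up l 1 i)"
  define J where "J = up (Suc l) H (up l 1 j)"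
  have IJ: "I = up l (1 + H) i" "J = up l (1 + H) j" by (simp_all only: I_def J_def up_add Suc_eq_plus1)
  have A: "up (k + H) d (up k H x) = up (Suc l) H (up k (Suc l - k) x)" for x
    using up_add[of k H d x] up_add[of k d H x] kd by (simp add: d_def[symmetric] add.commute)
  have B: "up (k + H) d (up (Suc k) (H - 1) x) = up (Suc l) H (up (Suc k) (Suc l - Suc k) x)" for x
  proof -
    have "Suc k + (H - 1) = k + H" "Suc k + (Suc l - Suc k) = Suc l" "H - 1 + d = Suc l - Suc k + H"
      using H1 k(1) by (auto simp: d_def)
    then show ?thesis using up_add[of "Suc k" "H - 1" d x] up_add[of "Suc k" "Suc l - Suc k" H x] by simp
  qed
  have mono: "up (Suc l) H x \<le> up (Suc l) H y" if "x \<le> y" "y \<le> n (Suc l)" for x y by (rule up_mono[OF that])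
  have i: "up l 1 i \<le> n (Suc l)" using up_le_n[of i l 1] assms by simp
  have le: "up k (Suc l - k) (min (i0 + 2) (n k)) \<le> n (Suc l)"
    using up_le_n[of "min (i0 + 2) (n k)" k d] kd by (simp add: d_def)
  have lw: "up (Suc k) (Suc l - Suc k) w \<le> n (Suc l)"
    using up_le_n[of w "Suc k" "Suc l - Suc k"] k by simp
  show thesis
  proof (rule that[of i0 k w J d I])
    show "i0 < n k" "w < n (Suc k)" by fact+
    show "J \<le> n (k + H + d)" unfolding kd(2) IJ by (rule up_le_n) (rule assms)
    show "I < J" unfolding IJ using up_less assms by blast
    show "P (k + H + d) I = P l i" "P (k + H + d) J = P l j"
      unfolding kd(2) IJ by (rule P_up, use assms in simp)+
    show "cum f (k + H + d) I = cum f l i" "cum f (k + H + d) J = cum f l j" if "additive f" for f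
      unfolding kd(2) IJ by (rule cum_up[OF that], use assms in simp)+
    show "up (k + H) d (up k H i0) \<le> I" unfolding A I_def by (rule mono) fact+
    show "J \<le> up (k + H) d (up k H (min (i0 + 2) (n k)))" unfolding A J_def by (rule mono) fact+
    show "I \<le> up (k + H) d (up (Suc k) (H - 1) w)" unfolding B I_def by (rule mono) fact+
    show "up (k + H) d (up (Suc k) (H - 1) (Suc w)) \<le> J" unfolding B J_def by (rule mono) fact+
  qed
qed

text \<open>The generation number grows by at most one per level, and a block of age
  \<open>a\<close> has its turn only at the restart number \<open>m - a\<close> from here, which is
  more than \<open>H\<close>.\<close>

lemma no_restart:
  assumes "i < n k" "b < m" "(b + a) mod m = gen k i mod m" "a + H < m" "d < H"
    "up k d i \<le> j" "j < up k d (Suc i)"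
  shows "\<not> restart b (k + d) j"
proof
  assume re: "restart b (k + d) j"
  obtain t where t: "gen (k + d) j = gen k i + t" "t \<le> d"
    using gen_descendant[OF assms(1,6,7)] by (metis add_le_cancel_left le_Suc_ex)
  have "(b + (a + t + 1)) mod m = ((b + a) mod m + (t + 1)) mod m" unfolding mod_add_left_eq by (simp add: add.assoc)
  also have "\<dots> = (gen k i + (t + 1)) mod m" unfolding assms(3) by (rule mod_add_left_eq)
  also have "\<dots> = b mod m" using re t assms(2) by (auto simp: restart_def)
  finally have "a + t + 1 = 0" by (rule mod_add_self_imp_zero) (use assms t in simp)
  then show False by simp
qed

lemma inc_linear:
  assumes "i < n k" "up k d i \<le> j" "j < up k d (Suc i)"
    and b: "b < m" "(b + a) mod m = gen k i mod m" "a + H < m"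
  shows "d \<le> H \<longrightarrow> inc b p (k + d) j * \<mu> k i = inc b p k i * \<mu> (k + d) j"
  using assms(1-3)
proof (induction rule: descendant_induct)
  case (step d j)
  show ?case
  proof
    assume d: "Suc d \<le> H"
    have "\<not> restart b (k + d) (par (k + d) j)"
      using no_restart[OF assms(1) b, of d] d step by simp
    then show "inc b p (k + Suc d) j * \<mu> k i = inc b p k i * \<mu> (k + Suc d) j"
      using step d by simp
  qed
qed simp

text \<open>As long as the block is not restarted, its increments and \<mu> are multiplied by the
  same weights. Their quotient is therefore constant on \<open>H\<close> levels, where the block is
  linear in \<open>cum \<mu>\<close>.\<close>

lemma cum_linear:
  assumes "i < n k" "up k H i \<le> x" "x \<le> y" "y \<le> up k H (Suc i)"
    and b: "b < m" "(b + a) mod m = gen k i mod m" "a + H < m"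
  shows "cum (inc b p) (k + H) y - cum (inc b p) (k + H) x =
     (cum \<mu> (k + H) y - cum \<mu> (k + H) x) / \<mu> k i * inc b p k i"
proof -
  have "(cum (inc b p) (k + H) y - cum (inc b p) (k + H) x) * \<mu> k i = (\<Sum>j\<in>{x..<y}. inc b p (k + H) j * \<mu> k i)"
    using assms by (simp add: cum_diff sum_distrib_right)
  also have "\<dots> = (\<Sum>j\<in>{x..<y}. inc b p k i * \<mu> (k + H) j)"
    using inc_linear[OF assms(1) _ _ b, of H] assms(2-4) by (intro sum.cong) auto
  also have "\<dots> = inc b p k i * (cum \<mu> (k + H) y - cum \<mu> (k + H) x)"
    using assms by (simp add: cum_diff sum_distrib_left)
  finally show ?thesis using \<mu>_pos[OF assms(1)] by (simp add: field_simps)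
qed

lemma cum_\<mu>_mono: assumes "x \<le> y" "y \<le> n k" shows "cum \<mu> k x \<le> cum \<mu> k y"
proof -
  have "0 \<le> (\<Sum>j\<in>{x..<y}. \<mu> k j)" using assms by (intro sum_nonneg less_imp_le[OF \<mu>_pos]) auto
  then show ?thesis using cum_diff[OF assms(1), of \<mu> k] by simp
qed

text \<open>Used in both directions: a full child guarantees a large share of \<mu>, and a small
  share of a range that starts or ends at an endpoint of the interval confines it to one descendant
  of depth \<open>e\<close>.\<close>

lemma cum_\<mu>_ge:
  assumes "i < n k" "d \<le> H" "up k d i \<le> z" "z < up k d (Suc i)"
    and "x \<le> up (k + d) (H - d) z" "up (k + d) (H - d) (Suc z) \<le> y" "y \<le> n (k + H)"
  shows "\<theta> ^ d \<le> (cum \<mu> (k + H) y - cum \<mu> (k + H) x) / \<mu> k i"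
proof -
  have z: "z < n (k + d)" using assms up_le_n[of "Suc i" k d] by simp
  have kd: "k + d + (H - d) = k + H" using assms by simp
  have "up (k + d) (H - d) z \<le> n (k + H)" using up_le_n[of z "k + d" "H - d"] z kd by simp
  then have "cum \<mu> (k + H) x \<le> cum \<mu> (k + H) (up (k + d) (H - d) z)" by (rule cum_\<mu>_mono[OF assms(5)])
  moreover have "cum \<mu> (k + H) (up (k + d) (H - d) (Suc z)) \<le> cum \<mu> (k + H) y" by (rule cum_\<mu>_mono) fact+
  moreover have "cum \<mu> (k + H) (up (k + d) (H - d) z) = cum \<mu> (k + d) z"
    using cum_up[OF additive_\<mu>, of z "k + d" "H - d"] z kd by simp
  moreover have "cum \<mu> (k + H) (up (k + d) (H - d) (Suc z)) = cum \<mu> (k + d) (Suc z)"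
    using cum_up[OF additive_\<mu>, of "Suc z" "k + d" "H - d"] z kd by simp
  ultimately have "\<mu> (k + d) z \<le> cum \<mu> (k + H) y - cum \<mu> (k + H) x" by (simp add: cum_def)
  then have "\<theta> ^ d * \<mu> k i \<le> cum \<mu> (k + H) y - cum \<mu> (k + H) x"
    using \<mu>_descendant[OF assms(1,3,4)] by simp
  then show ?thesis using \<mu>_pos[OF assms(1)] by (simp add: pos_le_divide_eq)
qed

lemma inc_osc:
  "i < n k \<Longrightarrow> up k d i \<le> j \<Longrightarrow> j \<le> up k d (Suc i) \<Longrightarrow>
    \<bar>cum (inc b p) (k + d) j - cum (inc b p) k i\<bar> \<le> M * (2 * A0) * r k"
  using cum_osc[OF additive_inc, of "2 * A0" b p i k d j] inc_le_r A0 by simp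

text \<open>Of the two blocks restarted last on two intervals, one has age at most \<open>m / 2\<close> on the other interval,
  so it is linear on both and its slopes do not cancel. If the resulting difference is
  too small, the interval of that block contributes little, and the block of the other interval
  separates the points.\<close>

lemma core_aux:
  assumes i: "i < n k" and i': "i' < n k" and \<alpha>: "0 \<le> \<alpha>" and \<gamma>: "0 \<le> \<gamma>" and big: "\<theta> \<le> \<alpha> \<or> \<theta> \<le> \<gamma>"
    and lin: "\<And>b p a. b < m \<Longrightarrow> (b + a) mod m = gen k i mod m \<Longrightarrow> a + H < m \<Longrightarrow> X b p = \<alpha> * inc b p k i"
    and lin': "\<And>b p a. b < m \<Longrightarrow> (b + a) mod m = gen k i' mod m \<Longrightarrow> a + H < m \<Longrightarrow> X' b p = \<gamma> * inc b p k i'"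
    and small: "\<And>b p. \<alpha> < \<theta> ^ e \<Longrightarrow> \<bar>X b p\<bar> \<le> 2 * (M * (2 * A0) * r (k + e))"
    and a: "(gen k i mod m + a) mod m = gen k i' mod m" "2 * a \<le> m"
  shows "\<exists>b<m. \<exists>p\<le>M. \<theta> ^ (e + 1) / (16 * C) * r k \<le> \<bar>X b p + X' b p\<bar>"
proof -
  have main: "\<theta> / 2 * (r k / C) \<le> \<sigma> k j * \<delta> k j" if "j < n k" for j
    using \<sigma>_bounds[OF that] \<delta>_ge[OF that] \<theta> r_pos[of k] C1 by (intro mult_mono) auto
  show ?thesis
  proof (cases "\<theta> ^ e \<le> \<alpha>")
    case True
    define b where "b = gen k i mod m"
    have b: "b < m" using m0 by (simp add: b_def)
    obtain \<kappa> l c where \<kappa>: "0 \<le> \<kappa>" "3 \<le> l" "l \<le> M" "c < l" "\<And>p. \<bar>inc b p k i - \<kappa> * dir l p c\<bar> \<le> \<kappa> / 8"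
       "\<sigma> k i * \<delta> k i \<le> \<kappa>" using inc_direction[OF i, of b] b_def by blast
    obtain \<kappa>' l' c' where \<kappa>': "0 \<le> \<kappa>'" "3 \<le> l'" "l' \<le> M" "c' < l'" "\<And>p. \<bar>inc b p k i' - \<kappa>' * dir l' p c'\<bar> \<le> \<kappa>' / 8"
      using inc_direction[OF i', of b] by blast
    have nn: "0 \<le> \<alpha> * \<kappa>" "0 \<le> \<gamma> * \<kappa>'" using \<alpha> \<gamma> \<kappa> \<kappa>' by auto
    obtain p where p: "p \<le> M" "max (\<alpha> * \<kappa>) (\<gamma> * \<kappa>') / 2 \<le> \<bar>\<alpha> * \<kappa> * dir l p c + \<gamma> * \<kappa>' * dir l' p c'\<bar>"
      using dir_no_cancel[OF \<kappa>(4) \<kappa>'(4) \<kappa>(2) \<kappa>'(2) \<kappa>(3) \<kappa>'(3) nn] by blast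
    have X: "X b p = \<alpha> * inc b p k i" using lin[of b 0 p] b mH by (simp add: b_def)
    have X': "X' b p = \<gamma> * inc b p k i'" using lin'[of b a p] b a mH by (simp add: b_def)
    have 1: "\<bar>\<alpha> * inc b p k i - \<alpha> * \<kappa> * dir l p c\<bar> \<le> \<alpha> * \<kappa> / 8"
      using mult_left_mono[OF \<kappa>(5)[of p] \<alpha>] \<alpha> by (simp add: abs_mult right_diff_distrib[symmetric] mult.assoc)
    have 2: "\<bar>\<gamma> * inc b p k i' - \<gamma> * \<kappa>' * dir l' p c'\<bar> \<le> \<gamma> * \<kappa>' / 8"
      using mult_left_mono[OF \<kappa>'(5)[of p] \<gamma>] \<gamma> by (simp add: abs_mult right_diff_distrib[symmetric] mult.assoc)
    \<comment> \<open>The two direction errors take at most an eighth of the maximum each off its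
      half, which leaves a quarter.\<close>
    have "\<alpha> * \<kappa> / 4 \<le> \<bar>X b p + X' b p\<bar>" unfolding X X' using p(2) 1 2 nn by linarith
    moreover have "\<theta> ^ e * (\<theta> / 2 * (r k / C)) \<le> \<alpha> * \<kappa>"
      using True \<alpha> main[OF i] \<kappa>(6) \<theta> r_pos[of k] C1 by (intro mult_mono) auto
    moreover have "\<theta> ^ e * (\<theta> / 2 * (r k / C)) = 8 * (\<theta> ^ (e + 1) / (16 * C) * r k)" by simp
    moreover have "0 \<le> \<theta> ^ (e + 1) / (16 * C) * r k" using \<theta> r_pos[of k] C1 by simp
    ultimately show ?thesis using b p(1) by (intro exI[of _ b] exI[of _ p] conjI) linarith+
  next
    case False
    have "\<theta> ^ e \<le> \<theta> ^ 1" using \<theta> e1 by (intro power_decreasing) auto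
    then have \<gamma>\<theta>: "\<theta> \<le> \<gamma>" using False big by simp
    define b where "b = gen k i' mod m"
    have b: "b < m" using m0 by (simp add: b_def)
    obtain \<kappa> l c where \<kappa>: "0 \<le> \<kappa>" "3 \<le> l" "l \<le> M" "c < l" "\<And>p. \<bar>inc b p k i' - \<kappa> * dir l p c\<bar> \<le> \<kappa> / 8"
       "\<sigma> k i' * \<delta> k i' \<le> \<kappa>" using inc_direction[OF i', of b] b_def by blast
    have nn: "0 \<le> \<gamma> * \<kappa>" using \<gamma> \<kappa> by auto
    obtain p where p: "p \<le> M" "\<gamma> * \<kappa> / 2 \<le> \<bar>\<gamma> * \<kappa> * dir l p c\<bar>"
      using dir_no_cancel_aux[OF \<kappa>(4) \<kappa>(2) \<kappa>(2) \<kappa>(3) \<kappa>(3) nn order_refl, of c] by auto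
    have X': "X' b p = \<gamma> * inc b p k i'" using lin'[of b 0 p] b mH by (simp add: b_def)
    have "\<bar>\<gamma> * inc b p k i' - \<gamma> * \<kappa> * dir l p c\<bar> \<le> \<gamma> * \<kappa> / 8"
      using mult_left_mono[OF \<kappa>(5)[of p] \<gamma>] \<gamma> by (simp add: abs_mult right_diff_distrib[symmetric] mult.assoc)
    then have "\<gamma> * \<kappa> / 4 \<le> \<bar>X' b p\<bar>" unfolding X' using p(2) nn by linarith
    moreover have "\<theta> * (\<theta> / 2 * (r k / C)) \<le> \<gamma> * \<kappa>"
      using \<gamma>\<theta> \<gamma> main[OF i'] \<kappa>(6) \<theta> r_pos[of k] C1 by (intro mult_mono) auto
    moreover have "\<theta> * (\<theta> / 2 * (r k / C)) = 8 * (\<theta>\<^sup>2 / (16 * C) * r k)" by (simp add: power2_eq_square)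
    moreover have "\<bar>X b p\<bar> \<le> \<theta>\<^sup>2 / (16 * C) * r k"
    proof -
      have "\<bar>X b p\<bar> \<le> 2 * (M * (8 * C / \<rho>) * \<rho> ^ e) * r k"
        using small[of b p] False by (simp add: A0_def r_add mult_ac)
      also have "\<dots> \<le> \<theta>\<^sup>2 / (16 * C) * r k" using e_small r_pos[of k] by (intro mult_right_mono) auto
      finally show ?thesis .
    qed
    moreover have "\<theta> ^ (e + 1) / (16 * C) * r k \<le> \<theta>\<^sup>2 / (16 * C) * r k"
      using \<theta> e1 r_pos[of k] C1 by (intro mult_right_mono divide_right_mono power_decreasing) auto
    ultimately have "\<theta> ^ (e + 1) / (16 * C) * r k \<le> \<bar>X b p + X' b p\<bar>" by linarith
    then show ?thesis using b p(1) by blast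
  qed
qed

lemma core:
  assumes i: "i < n k" and i': "i' < n k" and \<alpha>: "0 \<le> \<alpha>" and \<gamma>: "0 \<le> \<gamma>" and big: "\<theta> \<le> \<alpha> \<or> \<theta> \<le> \<gamma>"
    and lin: "\<And>b p a. b < m \<Longrightarrow> (b + a) mod m = gen k i mod m \<Longrightarrow> a + H < m \<Longrightarrow> X b p = \<alpha> * inc b p k i"
    and lin': "\<And>b p a. b < m \<Longrightarrow> (b + a) mod m = gen k i' mod m \<Longrightarrow> a + H < m \<Longrightarrow> X' b p = \<gamma> * inc b p k i'"
    and small: "\<And>b p. \<alpha> < \<theta> ^ e \<Longrightarrow> \<bar>X b p\<bar> \<le> 2 * (M * (2 * A0) * r (k + e))"
    and small': "\<And>b p. \<gamma> < \<theta> ^ e \<Longrightarrow> \<bar>X' b p\<bar> \<le> 2 * (M * (2 * A0) * r (k + e))"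
  shows "\<exists>b<m. \<exists>p\<le>M. \<theta> ^ (e + 1) / (16 * C) * r k \<le> \<bar>X b p + X' b p\<bar>"
proof -
  obtain a where a: "a < m" "(gen k i mod m + a) mod m = gen k i' mod m" by (rule age_exists)
  show ?thesis
  proof (cases "2 * a \<le> m")
    case True
    show ?thesis by (rule core_aux[OF i i' \<alpha> \<gamma> big lin lin' small a(2) True])
  next
    case False
    \<comment> \<open>Exchanging the two intervals turns the age \<open>a\<close> into
      \<open>m - a\<close>, and one of these is at most half of \<open>m\<close>.\<close>
    have "(gen k i' mod m + (m - a)) mod m = (gen k i mod m + a + (m - a)) mod m"
      unfolding a(2)[symmetric] by (rule mod_add_left_eq)
    also have "gen k i mod m + a + (m - a) = gen k i mod m + m" using a(1) by simp
    finally have a': "(gen k i' mod m + (m - a)) mod m = gen k i mod m" by simp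
    have "2 * (m - a) \<le> m" using False by simp
    from core_aux[OF i' i \<gamma> \<alpha> _ lin' lin small' a' this] big
    show ?thesis by (simp add: add.commute disj_commute)
  qed
qed

end

section \<open>Separation of points at one scale\<close>

context arc_embedding
begin

lemma up_H: "up k H i = up (Suc k) (H - 1) (s k i)"
  using up_Suc_top[of k "H - 1" i] H1 by simp

lemma up_H_split: "d \<le> H \<Longrightarrow> up k H i = up (k + d) (H - d) (up k d i)"
  using up_add[of k d "H - d" i] by simp

lemma up_le_iff: "i \<le> n k \<Longrightarrow> j \<le> n k \<Longrightarrow> up k d i \<le> up k d j \<longleftrightarrow> i \<le> j"
  using up_less_iff[of j k i d] by auto

lemma level_H: "Suc k + (H - 1) = k + H"
  using H1 by simp

lemma weight_ge_child:
  assumes "i < n k" "s k i \<le> w" "w < s k (Suc i)" "x \<le> up (Suc k) (H - 1) w"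
    "up (Suc k) (H - 1) (Suc w) \<le> y" "y \<le> n (k + H)"
  shows "\<theta> \<le> (cum \<mu> (k + H) y - cum \<mu> (k + H) x) / \<mu> k i"
  using cum_\<mu>_ge[OF assms(1) H1, of w x y] assms by simp

lemma weight_nonneg:
  assumes "i < n k" "x \<le> y" "y \<le> n (k + H)"
  shows "0 \<le> (cum \<mu> (k + H) y - cum \<mu> (k + H) x) / \<mu> k i"
  using cum_\<mu>_mono[OF assms(2,3)] \<mu>_pos[OF assms(1)] by simp

lemma level_separation_single:
  assumes i: "i < n k" and w: "w < n (Suc k)"
    and x: "up k H i \<le> x" "x \<le> up (Suc k) (H - 1) w" and y: "up (Suc k) (H - 1) (Suc w) \<le> y" "y \<le> up k H (Suc i)"
  shows "\<exists>b<m. \<exists>p\<le>M. \<theta> ^ (e + 1) / (16 * C) * r k \<le> \<bar>cum (inc b p) (k + H) y - cum (inc b p) (k + H) x\<bar>"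
proof -
  let ?\<alpha> = "(cum \<mu> (k + H) y - cum \<mu> (k + H) x) / \<mu> k i"
  have si: "s k i \<le> n (Suc k)" "s k (Suc i) \<le> n (Suc k)"
    using up_le_n[of i k 1] up_le_n[of "Suc i" k 1] i by auto
  have "up (Suc k) (H - 1) (s k i) \<le> up (Suc k) (H - 1) w" using x unfolding up_H by simp
  then have 1: "s k i \<le> w" using up_le_iff si w by simp
  have "up (Suc k) (H - 1) (Suc w) \<le> up (Suc k) (H - 1) (s k (Suc i))" using y unfolding up_H by simp
  then have 2: "w < s k (Suc i)" using up_le_iff[of "Suc w" "Suc k" "s k (Suc i)"] si w by simp
  have yn: "y \<le> n (k + H)" using y(2) up_le_n[of "Suc i" k H] i by simp
  have \<theta>\<alpha>: "\<theta> \<le> ?\<alpha>" by (rule weight_ge_child[OF i 1 2 x(2) y(1) yn])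
  have "up (Suc k) (H - 1) w \<le> up (Suc k) (H - 1) (Suc w)" using w by (intro up_mono) auto
  then have xy: "x \<le> y" using x y by simp
  have "\<theta> ^ e \<le> \<theta> ^ 1" using \<theta> e1 by (intro power_decreasing) auto
  then have \<theta>e: "\<not> ?\<alpha> < \<theta> ^ e" using \<theta>\<alpha> by simp
  have "\<exists>b<m. \<exists>p\<le>M. \<theta> ^ (e + 1) / (16 * C) * r k \<le>
      \<bar>(cum (inc b p) (k + H) y - cum (inc b p) (k + H) x) + 0\<bar>"
  \<comment> \<open>A single interval is the degenerate case of two equal intervals in which the
    second share is 0.\<close>
  proof (rule core[OF i i, where \<alpha> = ?\<alpha> and \<gamma> = 0])
    show "0 \<le> ?\<alpha>" using \<theta>\<alpha> \<theta> by linarith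
    show "cum (inc b p) (k + H) y - cum (inc b p) (k + H) x = ?\<alpha> * inc b p k i"
      if "b < m" "(b + a) mod m = gen k i mod m" "a + H < m" for b p a
      by (rule cum_linear[OF i x(1) xy y(2) that])
    show "\<bar>0::real\<bar> \<le> 2 * (M * (2 * A0) * r (k + e))" using A0 r_pos[of "k + e"] by simp
  qed (use \<theta>\<alpha> \<theta>e in auto)
  then show ?thesis by simp
qed

lemma level_separation:
  assumes i: "i < n k" and w: "w < n (Suc k)"
    and x: "up k H i \<le> x" "x \<le> up (Suc k) (H - 1) w"
    and y: "up (Suc k) (H - 1) (Suc w) \<le> y" "y \<le> up k H (min (i + 2) (n k))"
  shows "\<exists>b<m. \<exists>p\<le>M. \<theta> ^ (e + 1) / (16 * C) * r k \<le> \<bar>cum (inc b p) (k + H) y - cum (inc b p) (k + H) x\<bar>"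
proof -
  define mid where "mid = up k H (Suc i)"
  have "up (Suc k) (H - 1) w < up (Suc k) (H - 1) (Suc w)" using up_less[of w "Suc w" "Suc k"] w by auto
  then have xy: "x < y" using x y by simp
  show ?thesis
  proof (cases "y \<le> mid")
    case True
    then show ?thesis using level_separation_single[OF i w x y(1)] by (simp add: mid_def)
  next
    case False
    have i2: "Suc i < n k" "min (i + 2) (n k) = Suc (Suc i)"
    proof -
      have "\<not> min (i + 2) (n k) \<le> Suc i"
      proof
        assume "min (i + 2) (n k) \<le> Suc i"
        then have "up k H (min (i + 2) (n k)) \<le> mid" unfolding mid_def using i by (intro up_mono) auto
        then show False using False y(2) by simp
      qed
      then show "Suc i < n k" "min (i + 2) (n k) = Suc (Suc i)" using i by (auto simp: min_def split: if_splits)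
    qed
    have y2: "y \<le> up k H (Suc (Suc i))" using y(2) i2 by simp
    have yn: "y \<le> n (k + H)" using y2 up_le_n[of "Suc (Suc i)" k H] i2 by simp
    show ?thesis
    proof (cases "mid \<le> x")
      case True
      then show ?thesis using level_separation_single[OF i2(1) w _ x(2) y(1) y2] by (simp add: mid_def)
    next
      case x_mid: False
      have midn: "mid \<le> n (k + H)" using False yn by simp
      let ?\<alpha> = "(cum \<mu> (k + H) mid - cum \<mu> (k + H) x) / \<mu> k i"
      let ?\<gamma> = "(cum \<mu> (k + H) y - cum \<mu> (k + H) mid) / \<mu> k (Suc i)"
      have si: "s k i \<le> n (Suc k)" "s k (Suc i) \<le> n (Suc k)" "s k (Suc (Suc i)) \<le> n (Suc k)"
        using up_le_n[of i k 1] up_le_n[of "Suc i" k 1] up_le_n[of "Suc (Suc i)" k 1] i i2 by auto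
      have "up (Suc k) (H - 1) (s k i) \<le> up (Suc k) (H - 1) w" using x unfolding up_H by simp
      then have 1: "s k i \<le> w" using up_le_iff si w by simp
      have "up (Suc k) (H - 1) (Suc w) \<le> up (Suc k) (H - 1) (s k (Suc (Suc i)))" using y y2 unfolding up_H by simp
      then have 2: "w < s k (Suc (Suc i))" using up_le_iff[of "Suc w" "Suc k" "s k (Suc (Suc i))"] si w by simp
      \<comment> \<open>The full child \<open>w\<close> lies on one side of \<open>mid\<close>,
        because \<open>mid\<close> is itself a subdivision point of level
        \<open>k + 1\<close>.\<close>
      have big: "\<theta> \<le> ?\<alpha> \<or> \<theta> \<le> ?\<gamma>"
      proof (cases "w < s k (Suc i)")
        case True
        have "up (Suc k) (H - 1) (Suc w) \<le> mid" unfolding mid_def up_H using True si by (intro up_mono) auto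
        then show ?thesis using weight_ge_child[OF i 1 True x(2) _ midn] by simp
      next
        case False
        have "mid \<le> up (Suc k) (H - 1) w" unfolding mid_def up_H using False w by (intro up_mono) auto
        then show ?thesis using weight_ge_child[OF i2(1) _ 2 _ y(1) yn] False by simp
      qed
      have ke: "k + e + (H - e) = k + H" using eH by simp
      have upe: "up k e (Suc i) \<le> n (k + e)" "up k e i < up k e (Suc i)" "up k e (Suc i) < up k e (Suc (Suc i))"
        "up k e (Suc (Suc i)) \<le> n (k + e)"
        using up_le_n[of "Suc i" k e] up_less[of i "Suc i" k e] up_less[of "Suc i" "Suc (Suc i)" k e] i i2 by auto
      have mid_e: "mid = up (k + e) (H - e) (up k e (Suc i))" unfolding mid_def by (rule up_H_split[OF eH])
      have "\<exists>b<m. \<exists>p\<le>M. \<theta> ^ (e + 1) / (16 * C) * r k \<le>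
        \<bar>(cum (inc b p) (k + H) mid - cum (inc b p) (k + H) x) + (cum (inc b p) (k + H) y - cum (inc b p) (k + H) mid)\<bar>"
      proof (rule core[OF i i2(1) _ _ big])
        show "0 \<le> ?\<alpha>" "0 \<le> ?\<gamma>" using weight_nonneg[OF i _ midn, of x] weight_nonneg[OF i2(1) _ yn, of mid] x_mid False by auto
        show "cum (inc b p) (k + H) mid - cum (inc b p) (k + H) x = ?\<alpha> * inc b p k i"
          if "b < m" "(b + a) mod m = gen k i mod m" "a + H < m" for b p a
          by (rule cum_linear[OF i x(1) _ _ that]) (use x_mid in \<open>auto simp: mid_def\<close>)
        show "cum (inc b p) (k + H) y - cum (inc b p) (k + H) mid = ?\<gamma> * inc b p k (Suc i)"
          if "b < m" "(b + a) mod m = gen k (Suc i) mod m" "a + H < m" for b p a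
          by (rule cum_linear[OF i2(1) _ _ y2 that]) (use False in \<open>auto simp: mid_def\<close>)
        show "\<bar>cum (inc b p) (k + H) mid - cum (inc b p) (k + H) x\<bar> \<le> 2 * (M * (2 * A0) * r (k + e))"
          if small: "?\<alpha> < \<theta> ^ e" for b p
        proof -
          \<comment> \<open>The last descendant of depth \<open>e\<close> before \<open>mid\<close>.
            A share below \<open>\<theta> ^ e\<close> keeps \<open>x\<close> inside it, so the block
            changes little between \<open>x\<close> and \<open>mid\<close>.\<close>
          define z where "z = up k e (Suc i) - 1"
          have z: "Suc z = up k e (Suc i)" "up k e i \<le> z" "z < up k e (Suc i)" "z < n (k + e)"
            using upe by (auto simp: z_def)
          have "\<not> x \<le> up (k + e) (H - e) z"
            using cum_\<mu>_ge[OF i eH z(2,3), of x mid] small midn mid_e z(1) by auto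
          then have "up (k + e) (H - e) z \<le> x" "x \<le> up (k + e) (H - e) (Suc z)" "up (k + e) (H - e) z \<le> mid"
            "mid \<le> up (k + e) (H - e) (Suc z)" using x_mid mid_e z(1) by auto
          then show ?thesis
            using inc_osc[OF z(4), of "H - e" x b p] inc_osc[OF z(4), of "H - e" mid b p] unfolding ke by linarith
        qed
        show "\<bar>cum (inc b p) (k + H) y - cum (inc b p) (k + H) mid\<bar> \<le> 2 * (M * (2 * A0) * r (k + e))"
          if small: "?\<gamma> < \<theta> ^ e" for b p
        proof -
          \<comment> \<open>The mirror image: the first descendant of depth \<open>e\<close> after
            \<open>mid\<close>.\<close>
          define z where "z = up k e (Suc i)"
          have z: "up k e (Suc i) \<le> z" "z < up k e (Suc (Suc i))" "z < n (k + e)" "mid = up (k + e) (H - e) z"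
            using upe mid_e by (auto simp: z_def)
          have "\<not> up (k + e) (H - e) (Suc z) \<le> y"
            using cum_\<mu>_ge[OF i2(1) eH z(1,2), of mid y] small yn z(4) by auto
          moreover have "mid \<le> up (k + e) (H - e) (Suc z)" unfolding z(4) using z(3) by (intro up_mono) auto
          ultimately show ?thesis
            using inc_osc[OF z(3), of "H - e" y b p] inc_osc[OF z(3), of "H - e" mid b p] z(4) False
            unfolding ke by linarith
        qed
      qed
      then show ?thesis by simp
    qed
  qed
qed

lemma inc_osc_double:
  assumes i: "i < n k" and j: "up k d i \<le> j" "j \<le> up k d (min (i + 2) (n k))"
  shows "\<bar>cum (inc b p) (k + d) j - cum (inc b p) k i\<bar> \<le> 2 * (M * (2 * A0) * r k)"
proof -
  have nn: "0 \<le> M * (2 * A0) * r k" using A0 r_pos[of k] by simp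
  show ?thesis
  proof (cases "j \<le> up k d (Suc i)")
    case True
    then show ?thesis using inc_osc[OF i j(1), of b p] nn by simp
  next
    case False
    have "\<not> min (i + 2) (n k) \<le> Suc i"
    proof
      assume "min (i + 2) (n k) \<le> Suc i"
      then have "up k d (min (i + 2) (n k)) \<le> up k d (Suc i)" using i by (intro up_mono) auto
      then show False using False j(2) by simp
    qed
    then have i2: "Suc i < n k" "min (i + 2) (n k) = Suc (Suc i)"
      using i by (auto simp: min_def split: if_splits)
    have "2 * A0 * r k \<le> M * (2 * A0 * r k)" using M3 A0 r_pos[of k] mult_right_mono[of 1 "real M" "2 * A0 * r k"] by simp
    then have "\<bar>cum (inc b p) k (Suc i) - cum (inc b p) k i\<bar> \<le> M * (2 * A0) * r k"
      using inc_le_r[OF i, of b p] by (simp add: cum_def mult_ac)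
    moreover have "\<bar>cum (inc b p) (k + d) j - cum (inc b p) k (Suc i)\<bar> \<le> M * (2 * A0) * r k"
      by (rule inc_osc[OF i2(1)]) (use False j i2 in auto)
    ultimately show ?thesis by linarith
  qed
qed

text \<open>At the scale \<open>k\<close> of the pair, \<open>r k\<close> is comparable to the
  distance: an interval of level \<open>k + 1\<close> fits between the points, and two adjacent ones
  of level \<open>k\<close> contain them; turning converts both facts into estimates. Oscillation
  then yields the Lipschitz bound. The lower bound comes from the separation of the points rounded
  to level \<open>k + H\<close>, of which the rounding errors consume at most half.\<close>

theorem arc_net_bilipschitz:
  assumes ij: "i < j" "j \<le> n l"
  shows "\<bar>cum (inc b p) l i - cum (inc b p) l j\<bar> \<le> 4 * (M * (2 * A0)) * C\<^sup>2 / \<rho> * dist (P l i) (P l j)" (is ?lip)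
    and "\<exists>b<m. \<exists>p\<le>M. dist (P l i) (P l j) \<le> 128 * C\<^sup>2 / \<theta> ^ (e + 1) * \<bar>cum (inc b p) l i - cum (inc b p) l j\<bar>" (is ?sep)
proof -
  obtain k i0 w d I J where i0: "i0 < n k" and w: "w < n (Suc k)" and J: "J \<le> n (k + H + d)" "I < J"
    and PI: "P (k + H + d) I = P l i" "P (k + H + d) J = P l j"
    and cI: "\<And>f. additive f \<Longrightarrow> cum f (k + H + d) I = cum f l i" "\<And>f. additive f \<Longrightarrow> cum f (k + H + d) J = cum f l j"
    and b1: "up (k + H) d (up k H i0) \<le> I" and b2: "J \<le> up (k + H) d (up k H (min (i0 + 2) (n k)))"
    and b3: "I \<le> up (k + H) d (up (Suc k) (H - 1) w)" and b4: "up (k + H) d (up (Suc k) (H - 1) (Suc w)) \<le> J"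
    by (rule pair_scale[OF ij]) (rule that)
  define D where "D = dist (P l i) (P l j)"
  define N where "N = k + H + d"
  define i1 where "i1 = min (i0 + 2) (n k)"
  have i1: "i1 \<le> n k" "i1 = Suc i0 \<or> i1 = Suc (Suc i0)" "i0 < i1" using i0 by (auto simp: i1_def)
  have upN: "up (k + H) d (up k H t) = up k (H + d) t" for t by (simp add: up_add)
  have kN: "k + (H + d) = N" by (simp add: N_def)
  have upS: "up (k + H) d (up (Suc k) (H - 1) t) = up (Suc k) (H - 1 + d) t" for t
    using up_add[of "Suc k" "H - 1" d t] level_H by simp
  have kS: "Suc k + (H - 1 + d) = N" using level_H[of k] by (simp add: N_def)
  have D_low: "r (Suc k) / C \<le> C * D"
  proof -
    have "r (Suc k) / C \<le> dist (P (Suc k) w) (P (Suc k) (Suc w))" using \<delta>_ge[OF w] by (simp add: \<delta>_def)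
    also have "\<dots> = dist (P N (up (Suc k) (H - 1 + d) w)) (P N (up (Suc k) (H - 1 + d) (Suc w)))"
      using P_up[of w "Suc k" "H - 1 + d"] P_up[of "Suc w" "Suc k" "H - 1 + d"] w unfolding kS by simp
    also have "\<dots> \<le> C * dist (P N I) (P N J)"
      by (rule turn) (use b3 b4 J w upS up_mono[of w "Suc w" "Suc k"] in \<open>auto simp: N_def\<close>)
    finally show ?thesis using PI by (simp add: N_def D_def)
  qed
  have rk: "r k \<le> C\<^sup>2 / \<rho> * D"
    using D_low C1 \<rho> by (simp add: r_Suc power2_eq_square field_simps)
  have D_up: "D \<le> 4 * C * r k"
  proof -
    have "D = dist (P N I) (P N J)" using PI by (simp add: N_def D_def)
    also have "\<dots> \<le> C * dist (P N (up k (H + d) i0)) (P N (up k (H + d) i1))"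
      by (rule turn) (use b1 b2 J i1 upN up_le_n[of i1 k "H + d"] kN in \<open>auto simp: i1_def\<close>)
    also have "\<dots> = C * dist (P k i0) (P k i1)"
      using P_up[of i0 k "H + d"] P_up[of i1 k "H + d"] i0 i1 unfolding kN by simp
    also have "dist (P k i0) (P k i1) \<le> 4 * r k"
    proof (cases "i1 = Suc i0")
      case True
      then show ?thesis using \<delta>_le[OF i0] r_pos[of k] by (simp add: \<delta>_def)
    next
      case False
      then have "i1 = Suc (Suc i0)" "Suc i0 < n k" using i1 by auto
      then show ?thesis using \<delta>_le[OF i0] \<delta>_le[of "Suc i0" k] dist_triangle[of "P k i0" "P k i1" "P k (Suc i0)"]
        by (simp add: \<delta>_def)
    qed
    finally show ?thesis using C1 by simp
  qed
  let ?Z = "M * (2 * A0)"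
  have Z: "0 \<le> ?Z" using A0 by simp
  show ?lip
  proof -
    have "\<bar>cum (inc b p) N I - cum (inc b p) k i0\<bar> \<le> 2 * (?Z * r k)"
      unfolding kN[symmetric] by (rule inc_osc_double[OF i0]) (use b1 b2 J upN in auto)
    moreover have "\<bar>cum (inc b p) N J - cum (inc b p) k i0\<bar> \<le> 2 * (?Z * r k)"
      unfolding kN[symmetric] by (rule inc_osc_double[OF i0]) (use b1 b2 J upN in auto)
    ultimately have "\<bar>cum (inc b p) l i - cum (inc b p) l j\<bar> \<le> 4 * ?Z * r k"
      using cI[OF additive_inc, of b p] by (simp add: N_def)
    also have "\<dots> \<le> 4 * ?Z * (C\<^sup>2 / \<rho> * D)" using rk Z by (intro mult_left_mono) auto
    finally show ?thesis by (simp add: D_def)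
  qed
  show ?sep
  proof -

    obtain x where x: "x < n (k + H)" "up (k + H) d x \<le> I" "I < up (k + H) d (Suc x)"
      by (rule discrete_crossing[of 0 "n (k + H)" "up (k + H) d" I]) (use J in auto)
    \<comment> \<open>Rounding up goes through \<open>J - 1\<close>: the interval containing it ends
      at \<open>J\<close> or later, so \<open>Suc y\<close> replaces \<open>J\<close>.\<close>
    obtain y where y: "y < n (k + H)" "up (k + H) d y \<le> J - 1" "J - 1 < up (k + H) d (Suc y)"
      by (rule discrete_crossing[of 0 "n (k + H)" "up (k + H) d" "J - 1"]) (use J in auto)
    have in_n: "up k H i0 \<le> n (k + H)" "up k H i1 \<le> n (k + H)"
      "up (Suc k) (H - 1) w \<le> n (k + H)" "up (Suc k) (H - 1) (Suc w) \<le> n (k + H)"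
      using up_le_n[of i0 k H] up_le_n[of i1 k H] up_le_n[of w "Suc k" "H - 1"] up_le_n[of "Suc w" "Suc k" "H - 1"]
        i0 i1 w unfolding level_H by auto
    have "up (k + H) d (up k H i0) < up (k + H) d (Suc x)" using b1 x by simp
    then have 1: "up k H i0 \<le> x" using up_less_iff in_n x by simp
    have "up (k + H) d x \<le> up (k + H) d (up (Suc k) (H - 1) w)" using b3 x by simp
    then have 2: "x \<le> up (Suc k) (H - 1) w" using up_le_iff in_n x by simp
    have "up (k + H) d (up (Suc k) (H - 1) (Suc w)) \<le> up (k + H) d (Suc y)" using b4 y by simp
    then have 3: "up (Suc k) (H - 1) (Suc w) \<le> Suc y" using up_le_iff in_n y by simp
    have "up (k + H) d y < up (k + H) d (up k H i1)" using b2 y J by (simp add: i1_def)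
    then have 4: "Suc y \<le> up k H i1" using up_less_iff[of y "k + H" "up k H i1" d] in_n y by simp
    from level_separation[OF i0 w 1 2 3] 4 obtain b p where bp: "b < m" "p \<le> M"
      "\<theta> ^ (e + 1) / (16 * C) * r k \<le> \<bar>cum (inc b p) (k + H) (Suc y) - cum (inc b p) (k + H) x\<bar>"
      unfolding i1_def by blast
    have e1: "\<bar>cum (inc b p) N I - cum (inc b p) (k + H) x\<bar> \<le> ?Z * r (k + H)"
      unfolding N_def by (rule inc_osc[OF x(1)]) (use x in auto)
    have e2: "\<bar>cum (inc b p) N J - cum (inc b p) (k + H) y\<bar> \<le> ?Z * r (k + H)"
      unfolding N_def by (rule inc_osc[OF y(1)]) (use y J in auto)
    have "2 * A0 * r (k + H) \<le> M * (2 * A0 * r (k + H))"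
      using M3 A0 r_pos[of "k + H"] mult_right_mono[of 1 "real M" "2 * A0 * r (k + H)"] by simp
    then have e3: "\<bar>cum (inc b p) (k + H) (Suc y) - cum (inc b p) (k + H) y\<bar> \<le> ?Z * r (k + H)"
      using inc_le_r[OF y(1), of b p] by (simp add: cum_def mult_ac)
    \<comment> \<open>Rounding \<open>I\<close>, rounding \<open>J\<close> down to \<open>y\<close>,
      and the step from \<open>y\<close> to \<open>Suc y\<close> cost one oscillation each; hence
      the factor 3 in \<open>H_small\<close>.\<close>
    have "3 * (?Z * r (k + H)) = 3 * (M * (8 * C / \<rho>) * \<rho> ^ H) * r k" by (simp add: A0_def r_add mult_ac)
    also have "\<dots> \<le> \<theta> ^ (e + 1) / (32 * C) * r k" using H_small r_pos[of k] by (intro mult_right_mono) auto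
    finally have e4: "3 * (?Z * r (k + H)) \<le> \<theta> ^ (e + 1) / (32 * C) * r k" .
    have "\<theta> ^ (e + 1) / (16 * C) * r k = 2 * (\<theta> ^ (e + 1) / (32 * C) * r k)" by simp
    then have "\<theta> ^ (e + 1) / (32 * C) * r k \<le> \<bar>cum (inc b p) N I - cum (inc b p) N J\<bar>"
      using bp(3) e1 e2 e3 e4 by linarith
    then have low: "\<theta> ^ (e + 1) / (32 * C) * r k \<le> \<bar>cum (inc b p) l i - cum (inc b p) l j\<bar>"
      using cI[OF additive_inc, of b p] by (simp add: N_def)
    have "D \<le> 128 * C\<^sup>2 / \<theta> ^ (e + 1) * (\<theta> ^ (e + 1) / (32 * C) * r k)"
      using D_up \<theta> C1 by (simp add: power2_eq_square)
    also have "\<dots> \<le> 128 * C\<^sup>2 / \<theta> ^ (e + 1) * \<bar>cum (inc b p) l i - cum (inc b p) l j\<bar>"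
      using low \<theta> C1 by (intro mult_left_mono) auto
    finally show ?thesis using bp by (auto simp: D_def)
  qed
qed

end

section \<open>Coordinate functions on the subdivision points\<close>

context arc_embedding
begin

lemma lift_common_level:
  assumes "i \<le> n k" "j \<le> n l"
  obtains N i' j' where "i' \<le> n N" "j' \<le> n N" "P N i' = P k i" "P N j' = P l j"
    "\<And>f. additive f \<Longrightarrow> cum f N i' = cum f k i" "\<And>f. additive f \<Longrightarrow> cum f N j' = cum f l j"
proof -
  have kl: "k + l = l + k" by simp
  show thesis
  proof (rule that[of "up k l i" "k + l" "up l k j"])
    show "up k l i \<le> n (k + l)" "P (k + l) (up k l i) = P k i" by (rule up_le_n P_up, fact)+
    show "up l k j \<le> n (k + l)" "P (k + l) (up l k j) = P l j"
      unfolding kl by (rule up_le_n P_up, fact)+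
    show "cum f (k + l) (up k l i) = cum f k i" if "additive f" for f by (rule cum_up[OF that assms(1)])
    show "cum f (k + l) (up l k j) = cum f l j" if "additive f" for f
      unfolding kl by (rule cum_up[OF that assms(2)])
  qed
qed

lemma inc_dist_le:
  assumes "i \<le> n l" "j \<le> n l"
  shows "\<bar>cum (inc b p) l i - cum (inc b p) l j\<bar> \<le> 4 * (M * (2 * A0)) * C\<^sup>2 / \<rho> * dist (P l i) (P l j)"
  using arc_net_bilipschitz(1)[of i j l b p] arc_net_bilipschitz(1)[of j i l b p] assms
  by (cases i j rule: linorder_cases) (auto simp: dist_commute abs_minus_commute)

text \<open>A point may be \<open>P k i\<close> for several pairs. Two such pairs are lifted to a
  common level, where the Lipschitz bound at distance 0 makes the values agree.\<close>

lemma net_coordinates: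
  obtains F where "\<And>b p k i. i \<le> n k \<Longrightarrow> F b p (P k i) = cum (inc b p) k i"
proof -
  define rep where "rep = (\<lambda>x. SOME (k, i). i \<le> n k \<and> P k i = x)"
  define F where "F = (\<lambda>b p x. cum (inc b p) (fst (rep x)) (snd (rep x)))"
  have "F b p (P k i) = cum (inc b p) k i" if i: "i \<le> n k" for b p k i
  proof -
    have "\<exists>y. case y of (k', i') \<Rightarrow> i' \<le> n k' \<and> P k' i' = P k i" using i by (intro exI[of _ "(k, i)"]) simp
    from someI_ex[OF this] have rep: "snd (rep (P k i)) \<le> n (fst (rep (P k i)))"
      "P (fst (rep (P k i))) (snd (rep (P k i))) = P k i" by (auto simp: rep_def split: prod.splits)
    obtain N i' j' where N: "i' \<le> n N" "j' \<le> n N" "P N i' = P (fst (rep (P k i))) (snd (rep (P k i)))" "P N j' = P k i"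
      "\<And>f. additive f \<Longrightarrow> cum f N i' = cum f (fst (rep (P k i))) (snd (rep (P k i)))"
      "\<And>f. additive f \<Longrightarrow> cum f N j' = cum f k i"
      by (rule lift_common_level[OF rep(1) i]) (rule that)
    have "\<bar>cum (inc b p) N i' - cum (inc b p) N j'\<bar> \<le> 0"
      using inc_dist_le[OF N(1,2), of b p] N(3,4) rep(2) by simp
    then show ?thesis using N(5,6)[OF additive_inc, of b p] by (simp add: F_def)
  qed
  then show thesis by (rule that)
qed

theorem net_coord_embeds:
  "coord_embeds (m * Suc M) (4 * (M * (8 * C / \<rho>)) * C\<^sup>2 / \<rho> + 128 * C\<^sup>2 / \<theta> ^ (e + 1)) {P k i | k i. i \<le> n k}"
    (is "coord_embeds _ ?L ?S")
proof -
  obtain F where F: "\<And>b p k i. i \<le> n k \<Longrightarrow> F b p (P k i) = cum (inc b p) k i" by (rule net_coordinates) (rule that)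
  let ?L1 = "4 * (M * (8 * C / \<rho>)) * C\<^sup>2 / \<rho>" and ?L2 = "128 * C\<^sup>2 / \<theta> ^ (e + 1)"
  have L: "0 \<le> ?L1" "0 \<le> ?L2" using C1 \<rho> \<theta> by auto
  have A: "4 * (M * (2 * A0)) * C\<^sup>2 / \<rho> = ?L1" by (simp add: A0_def)
  show ?thesis
  proof (rule coord_embedsI[of "{..<m} \<times> {..M}" _ _ _ "\<lambda>(b, p). F b p"])
    show "card ({..<m} \<times> {..M}) \<le> m * Suc M" by (simp add: card_cartesian_product)
    show "\<bar>(case bp of (b, p) \<Rightarrow> F b p) x - (case bp of (b, p) \<Rightarrow> F b p) y\<bar> \<le> ?L * dist x y"
      if xy: "x \<in> ?S" "y \<in> ?S" for bp x y
    proof -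
      obtain k i l j where x: "x = P k i" "i \<le> n k" and y: "y = P l j" "j \<le> n l" using xy by blast
      obtain N i' j' where N: "i' \<le> n N" "j' \<le> n N" "P N i' = P k i" "P N j' = P l j"
        by (rule lift_common_level[OF x(2) y(2)]) (rule that)
      obtain b p where bp: "bp = (b, p)" by (cases bp)
      have Fx: "F b p x = cum (inc b p) N i'" using F[OF N(1), of b p] N(3) x by simp
      have Fy: "F b p y = cum (inc b p) N j'" using F[OF N(2), of b p] N(4) y by simp
      have dxy: "dist (P N i') (P N j') = dist x y" using N(3,4) x y by simp
      have "\<bar>F b p x - F b p y\<bar> \<le> ?L1 * dist x y"
        unfolding Fx Fy dxy[symmetric] A[symmetric] by (rule inc_dist_le[OF N(1,2)])
      also have "\<dots> \<le> ?L * dist x y" using L by (intro mult_right_mono) auto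
      finally show ?thesis by (simp add: bp)
    qed
    show "\<exists>bp\<in>{..<m} \<times> {..M}. dist x y \<le> ?L * \<bar>(case bp of (b, p) \<Rightarrow> F b p) x - (case bp of (b, p) \<Rightarrow> F b p) y\<bar>"
      if xy: "x \<in> ?S" "y \<in> ?S" "x \<noteq> y" for x y
    proof -
      obtain k i l j where x: "x = P k i" "i \<le> n k" and y: "y = P l j" "j \<le> n l" using xy by blast
      obtain N i' j' where N: "i' \<le> n N" "j' \<le> n N" "P N i' = P k i" "P N j' = P l j"
        by (rule lift_common_level[OF x(2) y(2)]) (rule that)
      have "i' \<noteq> j'" using N x y xy(3) by auto
      then have "\<exists>b<m. \<exists>p\<le>M. dist (P N i') (P N j') \<le> ?L2 * \<bar>cum (inc b p) N i' - cum (inc b p) N j'\<bar>"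
        using arc_net_bilipschitz(2)[of i' j' N] arc_net_bilipschitz(2)[of j' i' N] N(1,2)
        by (cases i' j' rule: linorder_cases) (auto simp: dist_commute abs_minus_commute)
      then obtain b p where bp: "b < m" "p \<le> M" "dist x y \<le> ?L2 * \<bar>F b p x - F b p y\<bar>"
        using F[OF N(1)] F[OF N(2)] N(3,4) x y by auto
      have "?L2 * \<bar>F b p x - F b p y\<bar> \<le> ?L * \<bar>F b p x - F b p y\<bar>" using L by (intro mult_right_mono) auto
      then show ?thesis using bp by (intro bexI[of _ "(b, p)"]) auto
    qed
  qed (use L in auto)
qed

end

section \<open>Subdivisions of a quasi-arc\<close>

lemma power_eventually_small:
  fixes A x \<epsilon> :: real
  assumes "0 \<le> A" "0 \<le> x" "x < 1" "0 < \<epsilon>"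
  obtains k where "k0 \<le> k" "A * x ^ k \<le> \<epsilon>"
proof -
  have "(\<lambda>k. A * x ^ k) \<longlonglongrightarrow> A * 0" by (intro tendsto_mult_left LIMSEQ_power_zero) (use assms in auto)
  then have "eventually (\<lambda>k. A * x ^ k < \<epsilon>) sequentially" by (rule order_tendstoD) (use assms in simp)
  then have "eventually (\<lambda>k. A * x ^ k < \<epsilon> \<and> k0 \<le> k) sequentially"
    using eventually_ge_at_top[of k0] by eventually_elim simp
  then obtain k where "A * x ^ k < \<epsilon> \<and> k0 \<le> k" by (auto simp: eventually_sequentially)
  then show thesis using that[of k] by simp
qed

text \<open>Steps of distance exactly \<eta> are taken as long as a point at distance at least
  \<eta> remains ahead. By uniform continuity each step uses up a parameter length of at least
  \<open>d\<close>, so this ends. The last step is prolonged to the endpoint: the triangle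
  inequality keeps it below \<open>2 * \<eta>\<close>, and turning keeps it above
  \<open>\<eta> / C\<close>.\<close>

lemma arc_subdivision:
  fixes g :: "real \<Rightarrow> 'a::metric_space"
  assumes cont: "continuous_on {0..1} g" and C: "1 \<le> C"
    and turn: "\<And>s u v t. 0 \<le> s \<Longrightarrow> s \<le> u \<Longrightarrow> u \<le> v \<Longrightarrow> v \<le> t \<Longrightarrow> t \<le> 1 \<Longrightarrow> dist (g u) (g v) \<le> C * dist (g s) (g t)"
    and \<eta>: "0 < \<eta>" and ab: "0 \<le> a" "a \<le> b" "b \<le> 1" "\<eta> \<le> dist (g a) (g b)"
  obtains l t where "t 0 = a" "t l = b" "\<And>c. c < l \<Longrightarrow> t c \<le> t (Suc c)"
    "\<And>c. c < l \<Longrightarrow> \<eta> / C \<le> dist (g (t c)) (g (t (Suc c)))"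
    "\<And>c. c < l \<Longrightarrow> dist (g (t c)) (g (t (Suc c))) \<le> 2 * \<eta>"
proof -
  obtain d where d: "0 < d" "\<And>x y. x \<in> {0..1} \<Longrightarrow> y \<in> {0..1} \<Longrightarrow> dist y x < d \<Longrightarrow> dist (g y) (g x) < \<eta>"
    using compact_uniformly_continuous[OF cont] \<eta> unfolding uniformly_continuous_on_def by (metis compact_Icc)
  have "\<exists>l t. t 0 = a \<and> t l = b \<and> (\<forall>c<l. t c \<le> t (Suc c) \<and> \<eta> / C \<le> dist (g (t c)) (g (t (Suc c))) \<and>
     dist (g (t c)) (g (t (Suc c))) \<le> 2 * \<eta>)"
    if "0 \<le> a" "a \<le> b" "b - a \<le> real k * d" "\<exists>s\<in>{a..b}. \<eta> \<le> dist (g a) (g s)" for a k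
    using that
  proof (induction k arbitrary: a)
    case 0
    then have "a = b" by simp
    then show ?case using 0 \<eta> by auto
  next
    case (Suc k)
    obtain s where s: "a \<le> s" "s \<le> b" "\<eta> \<le> dist (g a) (g s)" using Suc.prems(4) by auto
    have "continuous_on {a..s} (\<lambda>x. dist (g a) (g x))"
      by (intro continuous_intros continuous_on_subset[OF cont]) (use Suc.prems s ab in auto)
    then obtain u where u: "a \<le> u" "u \<le> s" "dist (g a) (g u) = \<eta>"
      using IVT'[of "\<lambda>x. dist (g a) (g x)" a \<eta> s] s \<eta> by auto
    have ua: "d \<le> u - a"
    proof (rule ccontr)
      assume "\<not> ?thesis"
      then have "dist (g u) (g a) < \<eta>" using u s Suc.prems ab by (intro d(2)) (auto simp: dist_real_def)
      then show False using u(3) by (simp add: dist_commute)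
    qed
    show ?case
    proof (cases "\<exists>s\<in>{u..b}. \<eta> \<le> dist (g u) (g s)")
      case True
      have "0 \<le> u" "u \<le> b" "b - u \<le> real k * d" using u s Suc.prems ua by (auto simp: algebra_simps)
      from Suc.IH[OF this True] obtain l t where t: "t 0 = u" "t l = b"
        "\<forall>c<l. t c \<le> t (Suc c) \<and> \<eta> / C \<le> dist (g (t c)) (g (t (Suc c))) \<and> dist (g (t c)) (g (t (Suc c))) \<le> 2 * \<eta>"
        by blast
      define t' where "t' = (\<lambda>c. case c of 0 \<Rightarrow> a | Suc c \<Rightarrow> t c)"
      have \<eta>C: "\<eta> / C \<le> \<eta>" using C \<eta> by (simp add: divide_le_eq mult_left_le)
      have "t' c \<le> t' (Suc c) \<and> \<eta> / C \<le> dist (g (t' c)) (g (t' (Suc c))) \<and> dist (g (t' c)) (g (t' (Suc c))) \<le> 2 * \<eta>"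
        if "c < Suc l" for c
        using t u \<eta> \<eta>C that by (cases c) (auto simp: t'_def)
      then show ?thesis using t by (intro exI[of _ "Suc l"] exI[of _ t']) (auto simp: t'_def)
    next
      case False
      then have ub: "dist (g u) (g b) < \<eta>" using u s by (auto simp: not_le)
      have "dist (g a) (g b) \<le> 2 * \<eta>" using dist_triangle[of "g a" "g b" "g u"] ub u by simp
      moreover have "\<eta> \<le> C * dist (g a) (g b)" using turn[of a a u b] u s Suc.prems ab by simp
      then have "\<eta> / C \<le> dist (g a) (g b)" using C by (simp add: divide_le_eq mult.commute)
      ultimately show ?thesis using Suc.prems
        by (intro exI[of _ 1] exI[of _ "\<lambda>c. if c = 0 then a else b"]) auto
    qed
  qed
  moreover obtain k where "b - a \<le> real k * d"
    using reals_Archimedean3[OF d(1)] by (metis less_imp_le mult.commute)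
  moreover have "\<exists>s\<in>{a..b}. \<eta> \<le> dist (g a) (g s)" using ab by (intro bexI[of _ b]) auto
  ultimately show thesis using that ab by blast
qed

lemma concat_sequences:
  fixes l :: "nat \<Rightarrow> nat" and t :: "nat \<Rightarrow> nat \<Rightarrow> 'b"
  assumes "\<And>i. Suc i < N \<Longrightarrow> t i (l i) = t (Suc i) 0"
  shows "\<exists>T. \<forall>i<N. \<forall>c\<le>l i. T ((\<Sum>i'<i. l i') + c) = t i c"
  using assms
proof (induction N)
  case (Suc N)
  have "\<exists>T. \<forall>i<N. \<forall>c\<le>l i. T ((\<Sum>i'<i. l i') + c) = t i c" by (rule Suc.IH) (simp add: Suc.prems)
  then obtain T where T: "\<And>i c. i < N \<Longrightarrow> c \<le> l i \<Longrightarrow> T ((\<Sum>i'<i. l i') + c) = t i c" by auto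
  define T' where "T' = (\<lambda>j. if j < (\<Sum>i'<N. l i') then T j else t N (j - (\<Sum>i'<N. l i')))"
  have "T' ((\<Sum>i'<i. l i') + c) = t i c" if "i < Suc N" "c \<le> l i" for i c
  proof (cases "i = N")
    case False
    then have i: "i < N" using that by simp
    have le: "(\<Sum>i'<Suc i. l i') \<le> (\<Sum>i'<N. l i')" using i by (intro sum_mono2) auto
    show ?thesis
    proof (cases "(\<Sum>i'<i. l i') + c < (\<Sum>i'<N. l i')")
      case True
      then show ?thesis using T[OF i that(2)] by (simp add: T'_def)
    next
      case False
      then have eq: "(\<Sum>i'<i. l i') + c = (\<Sum>i'<N. l i')" "c = l i" using le that(2) by auto
      \<comment> \<open>Here \<open>T'\<close> already reads the sequence \<open>t N\<close>. The
        pieces between \<open>i\<close> and \<open>N\<close> are empty, and their matching endpoints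
        carry the value across.\<close>
      have zero: "\<forall>i'\<in>{Suc i..<N}. l i' = 0"
      proof -
        have "(\<Sum>i'<N. l i') = (\<Sum>i'<Suc i. l i') + (\<Sum>i'\<in>{Suc i..<N}. l i')"
          using i by (metis Suc_leI atLeast0LessThan le0 sum.atLeastLessThan_concat)
        then have "(\<Sum>i'\<in>{Suc i..<N}. l i') = 0" using eq by simp
        then show ?thesis by simp
      qed
      have "t i (l i) = t j 0" if "j \<le> N" "Suc i \<le> j" for j
        using that(2,1)
      proof (induction j rule: dec_induct)
        case base
        then show ?case using Suc.prems[of i] i by simp
      next
        case (step j)
        then have "t j (l j) = t (Suc j) 0" "l j = 0" using Suc.prems[of j] zero by auto
        then show ?case using step by simp
      qed
      then have "t i c = t N 0" using eq i by simp
      then show ?thesis using eq by (simp add: T'_def)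
    qed
  qed (simp add: T'_def)
  then show ?case by blast
qed simp

section \<open>Embedding quasi-arcs\<close>

definition partition_level :: "(real \<Rightarrow> 'a::metric_space) \<Rightarrow> real \<Rightarrow> real \<Rightarrow> nat \<Rightarrow> (nat \<Rightarrow> real) \<Rightarrow> bool" where
  "partition_level g C r N T \<longleftrightarrow> 1 \<le> N \<and> T 0 = 0 \<and> T N = 1 \<and>
     (\<forall>i<N. T i \<le> T (Suc i) \<and> r / C \<le> dist (g (T i)) (g (T (Suc i))) \<and> dist (g (T i)) (g (T (Suc i))) \<le> 2 * r)"

definition partition_refines :: "nat \<Rightarrow> nat \<Rightarrow> (nat \<Rightarrow> real) \<Rightarrow> nat \<Rightarrow> (nat \<Rightarrow> real) \<Rightarrow> (nat \<Rightarrow> nat) \<Rightarrow> bool" where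
  "partition_refines M N T N' T' s \<longleftrightarrow> s 0 = 0 \<and> s N = N' \<and>
     (\<forall>i<N. s i + 3 \<le> s (Suc i) \<and> s (Suc i) \<le> s i + M) \<and> (\<forall>i\<le>N. T' (s i) = T i)"

lemma mono_upto:
  fixes t :: "nat \<Rightarrow> real"
  assumes "\<And>c. c < l \<Longrightarrow> t c \<le> t (Suc c)"
  shows "c \<le> c' \<Longrightarrow> c' \<le> l \<Longrightarrow> t c \<le> t c'"
proof (induction c' rule: dec_induct)
  case (step c')
  then show ?case using assms[of c'] by simp
qed simp

lemma dist_le_sum_dist: "dist (f 0) (f l) \<le> (\<Sum>c<l. dist (f c) (f (Suc c)))" for f :: "nat \<Rightarrow> 'a::metric_space"
proof (induction l)
  case (Suc l)
  then show ?case using dist_triangle[of "f 0" "f (Suc l)" "f l"] by simp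
qed simp

lemma partition_level_range:
  assumes "partition_level g C r N T" "i \<le> j" "j \<le> N"
  shows "0 \<le> T i" "T i \<le> T j" "T j \<le> 1"
proof -
  have "T c \<le> T c'" if "c \<le> c'" "c' \<le> N" for c c'
    by (rule mono_upto[of N]) (use assms(1) that in \<open>auto simp: partition_level_def\<close>)
  from this[of 0 i] this[of i j] this[of j N] show "0 \<le> T i" "T i \<le> T j" "T j \<le> 1"
    using assms by (auto simp: partition_level_def)
qed

text \<open>With \<open>\<rho> = 1 / (6 * C)\<close> a piece spans at most a third of
  \<open>r / C\<close>, so an interval has at least three. By turning, the left endpoints of the
  pieces are \<open>\<rho> * r / C / C\<close> apart, and they lie within \<open>4 * C * r\<close>
  of \<open>g a\<close>; the ratio is the packing scale \<open>\<rho> / (4 * C ^ 3)\<close>, which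
  bounds their number by \<open>M\<close>.\<close>

lemma refine_partition:
  fixes g :: "real \<Rightarrow> 'a::metric_space"
  assumes cont: "continuous_on {0..1} g" and gX: "g ` {0..1} \<subseteq> X" and C: "1 \<le> C"
    and turn: "\<And>s u v t. 0 \<le> s \<Longrightarrow> s \<le> u \<Longrightarrow> u \<le> v \<Longrightarrow> v \<le> t \<Longrightarrow> t \<le> 1 \<Longrightarrow> dist (g u) (g v) \<le> C * dist (g s) (g t)"
    and \<rho>: "\<rho> = 1 / (6 * C)" and M: "separation_bound X (\<rho> / (4 * C ^ 3)) M"
    and r: "0 < r" and T: "partition_level g C r N T"
  shows "\<exists>N' T' s. partition_level g C (\<rho> * r) N' T' \<and> partition_refines M N T N' T' s"
proof -
  have \<rho>0: "0 < \<rho>" using \<rho> C by simp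
  have "\<exists>l t. t 0 = T i \<and> t l = T (Suc i) \<and> 3 \<le> l \<and> l \<le> M \<and> (\<forall>c<l. t c \<le> t (Suc c) \<and>
     \<rho> * r / C \<le> dist (g (t c)) (g (t (Suc c))) \<and> dist (g (t c)) (g (t (Suc c))) \<le> 2 * (\<rho> * r))"
    if i: "i < N" for i
  proof -
    define a where "a = T i"
    define b where "b = T (Suc i)"
    have ab: "0 \<le> a" "a \<le> b" "b \<le> 1" using partition_level_range[OF T, of i "Suc i"] i by (auto simp: a_def b_def)
    have dab: "r / C \<le> dist (g a) (g b)" "dist (g a) (g b) \<le> 2 * r"
      using T i by (auto simp: partition_level_def a_def b_def)
    have "\<rho> * r \<le> r / C" using C r by (simp add: \<rho> divide_simps)
    then have \<eta>: "0 < \<rho> * r" "\<rho> * r \<le> dist (g a) (g b)" using \<rho>0 r dab by auto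
    obtain l t where t: "t 0 = a" "t l = b" "\<And>c. c < l \<Longrightarrow> t c \<le> t (Suc c)"
      "\<And>c. c < l \<Longrightarrow> \<rho> * r / C \<le> dist (g (t c)) (g (t (Suc c)))"
      "\<And>c. c < l \<Longrightarrow> dist (g (t c)) (g (t (Suc c))) \<le> 2 * (\<rho> * r)"
      by (rule arc_subdivision[OF cont C turn \<eta>(1) ab \<eta>(2)]) (assumption+, rule that)
    have t_mono: "t c \<le> t c'" if "c \<le> c'" "c' \<le> l" for c c' using mono_upto[of l t] t(3) that by blast
    have "r / C \<le> (\<Sum>c<l. dist (g (t c)) (g (t (Suc c))))"
      using dist_le_sum_dist[of "\<lambda>c. g (t c)" l] t dab by simp
    also have "\<dots> \<le> (\<Sum>c<l. 2 * (\<rho> * r))" using t(5) by (intro sum_mono) auto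
    also have "\<dots> = real l * (r / C) / 3" by (simp add: \<rho>)
    finally have "r / C \<le> real l * (r / C) / 3" .
    then have "3 * (r / C) \<le> real l * (r / C)" by (simp only: le_divide_eq_numeral1(1) mult.commute)
    moreover have "0 < r / C" using r C by simp
    ultimately have "3 \<le> real l" by (rule mult_right_le_imp_le)
    then have l3: "3 \<le> l" by simp
    define S where "S = (\<lambda>c. g (t c)) ` {..<l}"
    define R where "R = 4 * C * r"
    have R: "0 < R" using C r by (simp add: R_def)
    have \<epsilon>R: "\<rho> / (4 * C ^ 3) * R = \<rho> * r / C / C" using C by (simp add: R_def power3_eq_cube)
    have far: "\<rho> * r / C / C \<le> dist (g (t c)) (g (t c'))" if "c < c'" "c' < l" for c c'
    proof -
      have "dist (g (t c)) (g (t (Suc c))) \<le> C * dist (g (t c)) (g (t c'))"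
        using t_mono[of 0 c] t_mono[of c "Suc c"] t_mono[of "Suc c" c'] t_mono[of c' l] t(1,2) that ab
        by (intro turn) auto
      then have "\<rho> * r / C \<le> C * dist (g (t c)) (g (t c'))" using t(4)[of c] that by simp
      then show ?thesis using C by (simp add: pos_divide_le_eq mult.commute)
    qed
    have pos: "0 < \<rho> * r / C / C" using \<eta> C by simp
    have far': "\<rho> * r / C / C \<le> dist (g (t c)) (g (t c'))" if "c \<noteq> c'" "c < l" "c' < l" for c c'
      using far[of c c'] far[of c' c] that by (cases c c' rule: linorder_cases) (auto simp: dist_commute)
    have "inj_on (\<lambda>c. g (t c)) {..<l}"
    proof (rule inj_onI, rule ccontr)
      fix c c' assume "c \<in> {..<l}" "c' \<in> {..<l}" "g (t c) = g (t c')" "c \<noteq> c'"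
      then show False using far'[of c c'] pos by simp
    qed
    then have cardS: "card S = l" by (simp add: S_def card_image)
    have t01: "t c \<in> {0..1}" if "c \<le> l" for c using t_mono[of 0 c] t_mono[of c l] t(1,2) ab that by auto
    have "S \<subseteq> X \<inter> ball (g a) R"
    proof
      fix x assume "x \<in> S"
      then obtain c where c: "c < l" "x = g (t c)" by (auto simp: S_def)
      have "dist (g a) (g (t c)) \<le> C * dist (g a) (g b)"
        using t_mono[of 0 c] t_mono[of c l] t(1,2) ab c by (intro turn) auto
      also have "\<dots> \<le> C * (2 * r)" using dab C by (intro mult_left_mono) auto
      also have "\<dots> < R" using C r by (simp add: R_def)
      finally show "x \<in> X \<inter> ball (g a) R" using c gX t01[of c] by auto
    qed
    moreover have "separated (\<rho> / (4 * C ^ 3) * R) S"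
      unfolding \<epsilon>R separated_def
    proof (intro ballI impI)
      fix x y assume "x \<in> S" "y \<in> S" "x \<noteq> y"
      then obtain c c' where "c < l" "c' < l" "x = g (t c)" "y = g (t c')" by (auto simp: S_def)
      then show "\<rho> * r / C / C \<le> dist x y" using far'[of c c'] \<open>x \<noteq> y\<close> by metis
    qed
    moreover have "g a \<in> X" using gX ab by auto
    ultimately have "card S \<le> M" using M R unfolding separation_bound_def by blast
    then show ?thesis using t l3 cardS by (intro exI[of _ l] exI[of _ t]) (auto simp: a_def b_def)
  qed
  then obtain l t where lt: "\<And>i. i < N \<Longrightarrow> t i 0 = T i \<and> t i (l i) = T (Suc i) \<and> 3 \<le> l i \<and> l i \<le> M \<and>
     (\<forall>c<l i. t i c \<le> t i (Suc c) \<and> \<rho> * r / C \<le> dist (g (t i c)) (g (t i (Suc c))) \<and>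
     dist (g (t i c)) (g (t i (Suc c))) \<le> 2 * (\<rho> * r))"
    by metis
  define s where "s = (\<lambda>i. \<Sum>i'<i. l i')"
  have s_Suc: "s (Suc i) = s i + l i" for i by (simp add: s_def)
  have "\<exists>T'. \<forall>i<N. \<forall>c\<le>l i. T' ((\<Sum>i'<i. l i') + c) = t i c"
    by (rule concat_sequences) (simp add: lt)
  then obtain T' where T': "\<And>i c. i < N \<Longrightarrow> c \<le> l i \<Longrightarrow> T' (s i + c) = t i c" by (auto simp: s_def)
  have N: "1 \<le> N" "T 0 = 0" "T N = 1" using T by (auto simp: partition_level_def)
  have Ts: "T' (s i) = T i" if "i \<le> N" for i
  proof (cases "i < N")
    case True
    then show ?thesis using T'[of i 0] lt by simp
  next
    case False
    then have i: "i = Suc (N - 1)" "N - 1 < N" using that N by auto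
    have "T' (s (N - 1) + l (N - 1)) = T (Suc (N - 1))" using T'[OF i(2), of "l (N - 1)"] lt[OF i(2)] by simp
    then show ?thesis unfolding i(1) s_Suc by (simp only: )
  qed
  have "partition_level g C (\<rho> * r) (s N) T'"
    unfolding partition_level_def
  proof (intro conjI allI impI)
    have "s 1 \<le> s N" unfolding s_def using N by (intro sum_mono2) auto
    moreover have "3 \<le> s 1" using lt[of 0] N by (simp add: s_def)
    ultimately show "1 \<le> s N" by simp
    show "T' 0 = 0" using Ts[of 0] N by (simp add: s_def)
    show "T' (s N) = 1" using Ts[of N] N by simp
    fix j assume j: "j < s N"
    obtain i where i: "0 \<le> i" "i < N" "s i \<le> j" "j < s (Suc i)"
      by (rule discrete_crossing[of 0 N s j]) (use j in \<open>auto simp: s_def\<close>)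
    define c where "c = j - s i"
    have c: "j = s i + c" "c < l i" using i by (auto simp: c_def s_Suc)
    have "T' j = t i c" "T' (Suc j) = t i (Suc c)" using T'[OF i(2), of c] T'[OF i(2), of "Suc c"] c by auto
    then show "T' j \<le> T' (Suc j)" "\<rho> * r / C \<le> dist (g (T' j)) (g (T' (Suc j)))"
      "dist (g (T' j)) (g (T' (Suc j))) \<le> 2 * (\<rho> * r)" using lt[OF i(2)] c by auto
  qed
  moreover have "partition_refines M N T (s N) T' s"
    unfolding partition_refines_def
  proof (intro conjI allI impI)
    show "s 0 = 0" by (simp add: s_def)
    show "s i + 3 \<le> s (Suc i)" "s (Suc i) \<le> s i + M" if "i < N" for i using lt[OF that] by (auto simp: s_Suc)
    show "T' (s i) = T i" if "i \<le> N" for i by (rule Ts[OF that])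
  qed simp
  ultimately show ?thesis by blast
qed

text \<open>All constants come from \<open>C\<close> and the packing bounds of \<open>X\<close>
  before any arc is given; unions of arcs and the gluing rely on this uniformity. The order is
  \<rho>, \<open>M\<close>, \<open>th\<close>, \<open>e\<close>, \<open>H\<close>, \<open>m\<close>,
  each depending on the previous ones. The subdivision points are dense in the arc, so the closure
  lemma completes the embedding.\<close>

theorem quasiarc_coord_embeds:
  fixes X :: "'a::metric_space set"
  assumes sb: "\<And>\<epsilon>. 0 < \<epsilon> \<Longrightarrow> \<exists>M. separation_bound X \<epsilon> M" and C: "1 \<le> C"
  shows "\<exists>n L. \<forall>g. continuous_on {0..1::real} g \<longrightarrow> g ` {0..1} \<subseteq> X \<longrightarrow> g 0 \<noteq> g 1 \<longrightarrow>
     (\<forall>s u v t. 0 \<le> s \<longrightarrow> s \<le> u \<longrightarrow> u \<le> v \<longrightarrow> v \<le> t \<longrightarrow> t \<le> 1 \<longrightarrow> dist (g u) (g v) \<le> C * dist (g s) (g t)) \<longrightarrow>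
     coord_embeds n L (g ` {0..1})"
proof -
  define \<rho> where "\<rho> = 1 / (6 * C)"
  have \<rho>: "0 < \<rho>" "2 * C * \<rho> \<le> 1" "\<rho> < 1" using C by (auto simp: \<rho>_def divide_simps)
  have "0 < \<rho> / (4 * C ^ 3)" using \<rho> C by simp
  then obtain M0 where M0: "separation_bound X (\<rho> / (4 * C ^ 3)) M0" using sb by blast
  \<comment> \<open>The successor makes \<open>th\<close> positive at a stage where no arc is
    available to force \<open>M\<close> to be positive.\<close>
  define M where "M = Suc M0"
  have M: "separation_bound X (\<rho> / (4 * C ^ 3)) M"
    using M0 unfolding separation_bound_def M_def by (meson le_SucI)
  define th where "th = 1 / (2 * real M * C)"
  have th: "0 < th" using C by (simp add: th_def M_def)
  have A: "0 \<le> 2 * (M * (8 * C / \<rho>))" "0 \<le> 3 * (M * (8 * C / \<rho>))" "0 \<le> 4 * C / \<rho>" using C \<rho> by auto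
  have \<rho>': "0 \<le> \<rho>" using \<rho> by simp
  have \<epsilon>1: "0 < th\<^sup>2 / (16 * C)" using th C by simp
  obtain e where e: "1 \<le> e" "2 * (M * (8 * C / \<rho>)) * \<rho> ^ e \<le> th\<^sup>2 / (16 * C)"
    using power_eventually_small[OF A(1) \<rho>' \<rho>(3) \<epsilon>1] .
  have \<epsilon>2: "0 < th ^ (e + 1) / (32 * C)" using th C by simp
  obtain H where H: "e \<le> H" "3 * (M * (8 * C / \<rho>)) * \<rho> ^ H \<le> th ^ (e + 1) / (32 * C)"
    using power_eventually_small[OF A(2) \<rho>' \<rho>(3) \<epsilon>2] .
  obtain m where m: "Suc (2 * H) \<le> m" "4 * C / \<rho> * (1 / 2) ^ m \<le> 1 / 8"
    using power_eventually_small[OF A(3), of "1 / 2" "1 / 8" "Suc (2 * H)"] by auto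
  define L where "L = 4 * (M * (8 * C / \<rho>)) * C\<^sup>2 / \<rho> + 128 * C\<^sup>2 / th ^ (e + 1)"
  have "coord_embeds (m * Suc M) (2 * L + 1) (g ` {0..1})"
    if cont: "continuous_on {0..1} g" and gX: "g ` {0..1} \<subseteq> X" and ne: "g 0 \<noteq> g 1"
      and turn: "\<And>s u v t. 0 \<le> s \<Longrightarrow> s \<le> u \<Longrightarrow> u \<le> v \<Longrightarrow> v \<le> t \<Longrightarrow> t \<le> 1 \<Longrightarrow> dist (g u) (g v) \<le> C * dist (g s) (g t)"
    for g :: "real \<Rightarrow> 'a"
  proof -
    define r0 where "r0 = dist (g 0) (g 1)"
    have r0: "0 < r0" using ne by (simp add: r0_def)
    define P where "P = (\<lambda>k x. partition_level g C (r0 * \<rho> ^ k) (fst x) (snd x) \<and> (k = 0 \<longrightarrow> fst x = 1))"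
    define Q where "Q = (\<lambda>(k::nat) x y. \<exists>s. partition_refines M (fst x) (snd x) (fst y) (snd y) s)"
    have "\<exists>f. \<forall>k. P k (f k) \<and> Q k (f k) (f (Suc k))"
    proof (rule dependent_nat_choice)
      have "r0 / C \<le> r0" using C r0 by (simp add: divide_le_eq mult_left_le)
      then show "\<exists>x. P 0 x" using r0
        by (intro exI[of _ "(1, real)"]) (auto simp: P_def partition_level_def r0_def[symmetric])
      fix x k assume "P k x"
      then have "partition_level g C (r0 * \<rho> ^ k) (fst x) (snd x)" by (simp add: P_def)
      moreover have "0 < r0 * \<rho> ^ k" using r0 \<rho> by simp
      ultimately obtain N' T' s where "partition_level g C (\<rho> * (r0 * \<rho> ^ k)) N' T'"
        "partition_refines M (fst x) (snd x) N' T' s"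
        using refine_partition[OF cont gX C turn \<rho>_def M] by blast
      then show "\<exists>y. P (Suc k) y \<and> Q k x y"
        by (intro exI[of _ "(N', T')"]) (auto simp: P_def Q_def mult_ac)
    qed
    then obtain f where f: "\<And>k. P k (f k)" "\<And>k. Q k (f k) (f (Suc k))" by blast
    define n where "n = (\<lambda>k. fst (f k))"
    define T where "T = (\<lambda>k. snd (f k))"
    have lev: "partition_level g C (r0 * \<rho> ^ k) (n k) (T k)" for k using f(1)[of k] by (simp add: P_def n_def T_def)
    have n0: "n 0 = 1" using f(1)[of 0] by (simp add: P_def n_def)
    have "\<forall>k. \<exists>s. partition_refines M (n k) (T k) (n (Suc k)) (T (Suc k)) s"
      using f(2) by (simp add: Q_def n_def T_def)
    then obtain s where s: "\<And>k. partition_refines M (n k) (T k) (n (Suc k)) (T (Suc k)) (s k)" by metis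
    note turn_g = turn and \<rho>_less_1 = \<rho>(3)
    interpret arc_net "\<lambda>k i. g (T k i)" n s C \<rho> r0 M
    proof unfold_locales
      show "n 0 = 1" by (rule n0)
      show "s k 0 = 0" "s k (n k) = n (Suc k)" for k using s[of k] by (auto simp: partition_refines_def)
      show "s k i + 3 \<le> s k (Suc i)" "s k (Suc i) \<le> s k i + M" if "i < n k" for i k
        using s[of k] that by (auto simp: partition_refines_def)
      show "g (T (Suc k) (s k i)) = g (T k i)" if "i \<le> n k" for i k
        using s[of k] that by (auto simp: partition_refines_def)
      show "r0 * \<rho> ^ k / C \<le> dist (g (T k i)) (g (T k (Suc i)))"
        "dist (g (T k i)) (g (T k (Suc i))) \<le> 2 * (r0 * \<rho> ^ k)" if "i < n k" for i k
        using lev[of k] that by (auto simp: partition_level_def)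
      show "dist (g (T k a)) (g (T k b)) \<le> C * dist (g (T k i)) (g (T k j))"
        if "i \<le> a" "a \<le> b" "b \<le> j" "j \<le> n k" for i a b j k
        using partition_level_range[OF lev, of i a k] partition_level_range[OF lev, of a b k]
          partition_level_range[OF lev, of b j k] that by (intro turn) auto
    qed (use C \<rho> r0 in auto)
    have \<theta>_eq: "\<theta> = th" by (simp add: \<theta>_def th_def)
    interpret arc_embedding "\<lambda>k i. g (T k i)" n s C \<rho> r0 M m e H
      by unfold_locales (use e H m in \<open>auto simp: \<theta>_eq mult.assoc\<close>)
    define S where "S = {g (T k i) | k i. i \<le> n k}"
    have "coord_embeds (m * Suc M) L S"
      using net_coord_embeds unfolding \<theta>_eq L_def S_def .
    moreover have "g ` {0..1} \<subseteq> closure S"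
    proof
      fix y assume "y \<in> g ` {0..1}"
      then obtain t where t: "0 \<le> t" "t \<le> 1" "y = g t" by auto
      have "\<exists>x\<in>S. dist x y < \<epsilon>" if \<epsilon>: "0 < \<epsilon>" for \<epsilon>
      proof (cases "t = 1")
        case True
        then have "y = g (T 0 (n 0))" using lev[of 0] t by (simp add: partition_level_def)
        then have "y \<in> S" unfolding S_def by blast
        then show ?thesis using \<epsilon> by (intro bexI[of _ y]) simp_all
      next
        case False
        have "0 \<le> C * (2 * r0)" "0 < \<epsilon> / 2" using C r0 \<epsilon> by auto
        then obtain k where k: "C * (2 * r0) * \<rho> ^ k \<le> \<epsilon> / 2"
          using power_eventually_small[OF _ \<rho>' \<rho>_less_1] by metis
        have T01: "T k 0 = 0" "T k (n k) = 1" using lev[of k] by (auto simp: partition_level_def)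
        obtain i where i: "0 \<le> i" "i < n k" "T k i \<le> t" "t < T k (Suc i)"
          by (rule discrete_crossing[of 0 "n k" "T k" t]) (use t False T01 in auto)
        have "dist (g (T k i)) (g t) \<le> C * dist (g (T k i)) (g (T k (Suc i)))"
          using partition_level_range[OF lev, of i "Suc i" k] i by (intro turn_g) auto
        also have "\<dots> \<le> C * (2 * (r0 * \<rho> ^ k))" using step_le[OF i(2)] C by (intro mult_left_mono) auto
        also have "\<dots> < \<epsilon>" using k \<epsilon> by simp
        finally have "dist (g (T k i)) y < \<epsilon>" using t by simp
        moreover have "g (T k i) \<in> S" unfolding S_def using i(2) less_imp_le by blast
        ultimately show ?thesis by blast
      qed
      then show "y \<in> closure S" by (auto simp: closure_approachable)
    qed
    ultimately show ?thesis by (rule coord_embeds_closure)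
  qed
  then show ?thesis by blast
qed

section \<open>Paths in spaces of bounded turning\<close>

text \<open>A net of mesh \<open>l / 6\<close> in the continuum has bounded size. Its graph of
  distances up to \<open>l / 2\<close> joins the endpoints because the continuum is connected, so
  the number of steps is bounded independently of \<open>p\<close> and \<open>q\<close>.\<close>

lemma bounded_turning_chain:
  fixes X :: "'a::metric_space set"
  assumes sb: "\<And>e. 0 < e \<Longrightarrow> \<exists>M. separation_bound X e M" and C: "0 \<le> C"
    and turn: "\<And>x y. x \<in> X \<Longrightarrow> y \<in> X \<Longrightarrow>
      \<exists>K\<subseteq>X. compact K \<and> connected K \<and> x \<in> K \<and> y \<in> K \<and> diameter K \<le> C * dist x y"
  obtains m :: nat where "0 < m" "\<And>p q. p \<in> X \<Longrightarrow> q \<in> X \<Longrightarrow> \<exists>c. c 0 = p \<and> c m = q \<and>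
      (\<forall>j\<le>m. c j \<in> X) \<and> (\<forall>j<m. dist (c j) (c (Suc j)) \<le> dist p q / 2)"
proof -
  define e where "e = 1 / (6 * (C + 1))"
  have "0 < e" using C by (simp add: e_def)
  then obtain M where M: "separation_bound X e M" using sb by blast
  \<comment> \<open>The graph on the net and the two endpoints has at most this many edges, and some
    chain is no longer than the number of edges.\<close>
  define m where "m = (M + 2) ^ 2"
  have "\<exists>c. c 0 = p \<and> c m = q \<and> (\<forall>j\<le>m. c j \<in> X) \<and> (\<forall>j<m. dist (c j) (c (Suc j)) \<le> dist p q / 2)"
    if p: "p \<in> X" and q: "q \<in> X" for p q
  proof (cases "p = q")
    case True
    then show ?thesis using p by (intro exI[of _ "\<lambda>_. p"]) auto
  next
    case False
    define l where "l = dist p q"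
    have l: "0 < l" using False by (simp add: l_def)
    obtain K where K: "K \<subseteq> X" "compact K" "connected K" "p \<in> K" "q \<in> K" "diameter K \<le> C * l"
      using turn[OF p q] by (auto simp: l_def)
    define R where "R = (C + 1) * l"
    have R: "0 < R" "e * R = l / 6"
    proof -
      show "0 < R" using l C by (simp add: R_def)
      show "e * R = l / 6" using C by (simp add: R_def e_def field_simps)
    qed
    have "K \<subseteq> X \<inter> ball p R"
    proof
      fix x assume x: "x \<in> K"
      have "dist p x \<le> diameter K" using diameter_bounded_bound[OF compact_imp_bounded[OF K(2)] K(4) x] .
      also have "\<dots> \<le> C * l" by (rule K)
      also have "\<dots> < R" using l by (simp add: R_def distrib_right)
      finally show "x \<in> X \<inter> ball p R" using x K by auto
    qed
    then obtain S where S: "S \<subseteq> K" "finite S" "card S \<le> M" "\<And>a. a \<in> K \<Longrightarrow> \<exists>s\<in>S. dist a s < e * R \<or> a = s"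
      using separation_bound_net[OF M p R(1)] by metis
    define V where "V = insert p (insert q S)"
    have V: "finite V" "V \<subseteq> K" "p \<in> V" "q \<in> V" using S K by (auto simp: V_def)
    have "card V \<le> M + 2" unfolding V_def using S(2,3) by (simp add: card_insert_if)
    define r where "r = {(a, b) \<in> V \<times> V. dist a b \<le> l / 2}"
    have finr: "finite r" unfolding r_def by (rule finite_subset[of _ "V \<times> V"]) (use V in auto)
    have cardr: "card r \<le> m"
    proof -
      have "card r \<le> card (V \<times> V)" unfolding r_def by (rule card_mono) (use V in auto)
      also have "\<dots> = card V ^ 2" by (simp add: card_cartesian_product power2_eq_square)
      also have "\<dots> \<le> m" unfolding m_def using \<open>card V \<le> M + 2\<close> by (rule power_mono) simp
      finally show ?thesis .
    qed
    have pq: "(p, q) \<in> r\<^sup>*"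
    proof (rule ccontr)
      assume no: "(p, q) \<notin> r\<^sup>*"
      \<comment> \<open>The balls around reachable and around unreachable net points would
        disconnect \<open>K\<close>: a common point brings two centres within \<open>l / 3\<close>,
        so they would be joined by an edge.\<close>
      define A where "A = (\<Union>v\<in>{v \<in> V. (p, v) \<in> r\<^sup>*}. ball v (l / 6))"
      define B where "B = (\<Union>v\<in>{v \<in> V. (p, v) \<notin> r\<^sup>*}. ball v (l / 6))"
      have "open A" "open B" by (auto simp: A_def B_def)
      moreover have "K \<subseteq> A \<union> B"
      proof
        fix a assume "a \<in> K"
        then obtain s where s: "s \<in> S" "dist a s < l / 6 \<or> a = s" using S(4) R by auto
        then have "a \<in> ball s (l / 6)" "s \<in> V" using l by (auto simp: dist_commute V_def)
        then show "a \<in> A \<union> B" unfolding A_def B_def by blast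
      qed
      moreover have "A \<inter> B \<inter> K = {}"
      proof (rule ccontr)
        assume "A \<inter> B \<inter> K \<noteq> {}"
        then obtain z v w where v: "v \<in> V" "(p, v) \<in> r\<^sup>*" "dist v z < l / 6"
          and w: "w \<in> V" "(p, w) \<notin> r\<^sup>*" "dist w z < l / 6" by (auto simp: A_def B_def)
        have "dist v w \<le> l / 2" using dist_triangle2[of v w z] v w l by simp
        then have "(v, w) \<in> r" using v w by (simp add: r_def)
        then show False using v w by (meson rtrancl.rtrancl_into_rtrancl)
      qed
      moreover have "p \<in> A \<inter> K" using V K l by (auto simp: A_def)
      moreover have "q \<in> B \<inter> K" using V K l no by (auto simp: B_def)
      ultimately show False using connectedD[OF K(3), of A B] by blast
    qed
    then obtain k where k: "k \<le> card r" "(p, q) \<in> r ^^ k" using rtrancl_finite_eq_relpow[OF finr] by auto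
    then obtain f where f: "f 0 = p" "f k = q" "\<And>i. i < k \<Longrightarrow> (f i, f (Suc i)) \<in> r"
      unfolding relpow_fun_conv by blast
    have fX: "f i \<in> X" if "i \<le> k" for i
      using f(3)[of i] f(2) that q V K(1) by (cases "i = k") (auto simp: r_def)
    show ?thesis
    \<comment> \<open>Shorter chains wait at \<open>q\<close>, so that all have exactly
      \<open>m\<close> steps.\<close>
    proof (intro exI[of _ "\<lambda>j. f (min j k)"] conjI allI impI)
      show "dist (f (min j k)) (f (min (Suc j) k)) \<le> dist p q / 2" if "j < m" for j
        using f(3)[of j] l by (cases "j < k") (auto simp: r_def l_def min_def)
      show "f (min m k) = q" using f(2) k(1) cardr by simp
    qed (use f(1) fX in auto)
  qed
  moreover have "0 < m" by (simp add: m_def)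
  ultimately show thesis using that by blast
qed

section \<open>Paths as limits of chains\<close>

lemma halving_eventually_small:
  fixes b e :: real
  assumes "0 \<le> b" "0 < e"
  obtains k where "b / 2 ^ k < e"
proof -
  obtain k where "b * (1 / 2) ^ k \<le> e / 2"
    by (rule power_eventually_small[of b "1 / 2" "e / 2" 0]) (use assms in auto)
  then have "b * (1 / 2) ^ k < e" using assms(2) by linarith
  then have "b / 2 ^ k < e" by (simp add: power_one_over)
  then show thesis by (rule that)
qed

lemma geometric_limit:
  fixes x :: "nat \<Rightarrow> 'a::metric_space"
  assumes X: "complete X" "\<And>k. x k \<in> X" and a: "0 \<le> a" and step: "\<And>k. dist (x k) (x (Suc k)) \<le> a / 2 ^ k"
  shows "\<exists>l\<in>X. \<forall>k. dist (x k) l \<le> 2 * a / 2 ^ k"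
proof -
  \<comment> \<open>Subtracting the tail of the geometric series is what lets the induction on
    \<open>j\<close> close.\<close>
  have tele: "dist (x k) (x (k + j)) \<le> 2 * a / 2 ^ k - 2 * a / 2 ^ (k + j)" for k j
  proof (induction j)
    case (Suc j)
    have "dist (x k) (x (k + Suc j)) \<le> dist (x k) (x (k + j)) + dist (x (k + j)) (x (Suc (k + j)))"
      using dist_triangle by simp
    also have "\<dots> \<le> 2 * a / 2 ^ k - 2 * a / 2 ^ (k + j) + a / 2 ^ (k + j)" using Suc step[of "k + j"] by simp
    also have "\<dots> = 2 * a / 2 ^ k - 2 * a / 2 ^ (k + Suc j)" by simp
    finally show ?case .
  qed simp
  have le: "dist (x k) (x (k + j)) \<le> 2 * a / 2 ^ k" for k j
  proof -
    have "0 \<le> 2 * a / 2 ^ (k + j)" using a by simp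
    then show ?thesis using tele[of k j] by linarith
  qed
  have "Cauchy x"
  proof (rule metric_CauchyI)
    fix e :: real assume e: "0 < e"
    obtain k where k: "2 * a / 2 ^ k < e / 2"
      by (rule halving_eventually_small[of "2 * a" "e / 2"]) (use a e in auto)
    show "\<exists>M. \<forall>m\<ge>M. \<forall>n\<ge>M. dist (x m) (x n) < e"
    proof (intro exI[of _ k] allI impI)
      fix i j assume "k \<le> i" "k \<le> j"
      then have "dist (x k) (x i) < e / 2" "dist (x k) (x j) < e / 2"
        using le[of k "i - k"] le[of k "j - k"] k by auto
      then show "dist (x i) (x j) < e" using dist_triangle3[of "x i" "x j" "x k"] by simp
    qed
  qed
  then obtain l where l: "l \<in> X" "x \<longlonglongrightarrow> l" using X unfolding complete_def by blast
  have "dist (x k) l \<le> 2 * a / 2 ^ k" for k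
  proof (rule tendsto_upperbound)
    show "(\<lambda>j. dist (x k) (x (j + k))) \<longlonglongrightarrow> dist (x k) l"
      by (intro tendsto_dist tendsto_const LIMSEQ_ignore_initial_segment l)
    show "eventually (\<lambda>j. dist (x k) (x (j + k)) \<le> 2 * a / 2 ^ k) sequentially"
      using le[of k] by (simp add: add.commute)
  qed simp
  then show ?thesis using l by blast
qed

lemma nat_floor_diff_le_one:
  fixes x y :: real
  assumes "0 \<le> x" "x \<le> y" "y < x + 1"
  shows "nat \<lfloor>y\<rfloor> = nat \<lfloor>x\<rfloor> \<or> nat \<lfloor>y\<rfloor> = Suc (nat \<lfloor>x\<rfloor>)"
proof -
  have "\<lfloor>x\<rfloor> \<le> \<lfloor>y\<rfloor>" "\<lfloor>y\<rfloor> \<le> \<lfloor>x\<rfloor> + 1" "0 \<le> \<lfloor>x\<rfloor>" using assms by (auto simp: floor_mono le_floor_iff floor_le_iff) linarith+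
  then show ?thesis by linarith
qed

text \<open>Replacing each step of a chain by a chain of \<open>m\<close> steps of half the size gives Hoelder
  parametrisations at all \<open>m\<close>-adic times; no local path-connectedness is needed beforehand.\<close>

lemma chain_imp_path:
  fixes X :: "'a::metric_space set"
  assumes X: "complete X" and m: "0 < m"
    and chain: "\<And>p q. p \<in> X \<Longrightarrow> q \<in> X \<Longrightarrow> \<exists>c. c 0 = p \<and> c m = q \<and>
      (\<forall>j\<le>m. c j \<in> X) \<and> (\<forall>j<m. dist (c j) (c (Suc j)) \<le> dist p q / 2)"
    and pq: "p \<in> X" "q \<in> X"
  obtains f where "path f" "path_image f \<subseteq> X \<inter> cball p ((2 * real m + 1) * dist p q)" "pathstart f = p" "pathfinish f = q"
proof -
  define l where "l = dist p q"
  define ch where "ch = (\<lambda>p q. SOME c. c 0 = p \<and> c m = q \<and> (\<forall>j\<le>m. c j \<in> X) \<and>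
    (\<forall>j<m. dist (c j) (c (Suc j)) \<le> dist p q / 2))"
  have "ch p q 0 = p \<and> ch p q m = q \<and> (\<forall>j\<le>m. ch p q j \<in> X) \<and>
    (\<forall>j<m. dist (ch p q j) (ch p q (Suc j)) \<le> dist p q / 2)" if "p \<in> X" "q \<in> X" for p q
    unfolding ch_def by (rule someI_ex[OF chain[OF that]])
  then have ch: "\<And>p q. p \<in> X \<Longrightarrow> q \<in> X \<Longrightarrow> ch p q 0 = p" "\<And>p q. p \<in> X \<Longrightarrow> q \<in> X \<Longrightarrow> ch p q m = q"
    "\<And>p q j. p \<in> X \<Longrightarrow> q \<in> X \<Longrightarrow> j \<le> m \<Longrightarrow> ch p q j \<in> X"
    "\<And>p q j. p \<in> X \<Longrightarrow> q \<in> X \<Longrightarrow> j < m \<Longrightarrow> dist (ch p q j) (ch p q (Suc j)) \<le> dist p q / 2"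
    by simp_all
  have ch_dist: "dist p (ch p q j) \<le> real j * (dist p q / 2)" if "p \<in> X" "q \<in> X" "j \<le> m" for p q j
    using that(3)
  proof (induction j)
    case (Suc j)
    have "dist p (ch p q (Suc j)) \<le> dist p (ch p q j) + dist (ch p q j) (ch p q (Suc j))" by (rule dist_triangle)
    then show ?case using Suc ch(4)[OF that(1,2), of j] by (simp add: distrib_right)
  qed (use ch(1)[OF that(1,2)] in simp)
  \<comment> \<open>\<open>A k i\<close> is the position at time \<open>i / m ^ k\<close>. At level
    0 every index after 0 gives \<open>q\<close>, so \<open>Suc (i div m)\<close> needs no range
    condition, and after time 1 the sequence rests at \<open>q\<close>.\<close>
  define A where "A = rec_nat (\<lambda>i::nat. if i = 0 then p else q) (\<lambda>k a i. ch (a (i div m)) (a (Suc (i div m))) (i mod m))"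
  have A0: "A 0 i = (if i = 0 then p else q)" for i by (simp add: A_def)
  have A_Suc: "A (Suc k) i = ch (A k (i div m)) (A k (Suc (i div m))) (i mod m)" for k i by (simp add: A_def)
  have AX: "A k i \<in> X" for k i
    by (induction k arbitrary: i) (use pq ch(3) m in \<open>auto simp: A0 A_Suc less_imp_le\<close>)
  have A_step: "dist (A k i) (A k (Suc i)) \<le> l / 2 ^ k" for k i
  proof (induction k arbitrary: i)
    case 0
    then show ?case by (simp add: A0 l_def)
  next
    case (Suc k)
    let ?x = "A k (i div m)" and ?y = "A k (Suc (i div m))"
    have "A (Suc k) (Suc i) = ch ?x ?y (Suc (i mod m))"
    proof (cases "Suc (i mod m) = m")
      case True
      then have "Suc i mod m = 0" "Suc i div m = Suc (i div m)" by (auto simp: mod_Suc div_Suc)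
      then show ?thesis using True ch(1,2) AX by (simp add: A_Suc)
    next
      case False
      then have "Suc i mod m = Suc (i mod m)" "Suc i div m = i div m" by (auto simp: mod_Suc div_Suc)
      then show ?thesis by (simp add: A_Suc)
    qed
    then have "dist (A (Suc k) i) (A (Suc k) (Suc i)) \<le> dist ?x ?y / 2"
      using ch(4)[OF AX AX, of "i mod m"] m by (simp add: A_Suc)
    then show ?case using Suc[of "i div m"] by simp
  qed
  have A_end: "A k i = q" if "m ^ k \<le> i" for k i
    using that
  proof (induction k arbitrary: i)
    case 0
    then show ?case by (auto simp: A0)
  next
    case (Suc k)
    have "m ^ k \<le> i div m" using Suc.prems m by (simp add: less_eq_div_iff_mult_less_eq mult.commute)
    then have "A k (i div m) = q" "A k (Suc (i div m)) = q" using Suc.IH by auto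
    then have "dist q (A (Suc k) i) \<le> 0"
      using ch_dist[OF pq(2) pq(2), of "i mod m"] m by (simp add: A_Suc less_imp_le)
    then show ?case by simp
  qed
  have A_start: "A k 0 = p" for k by (induction k) (use ch(1) AX in \<open>auto simp: A0 A_Suc\<close>)
  define F where "F = (\<lambda>k t::real. A k (nat \<lfloor>t * real m ^ k\<rfloor>))"
  have F_step: "dist (F k t) (F (Suc k) t) \<le> real m * l / 2 ^ k" if t: "0 \<le> t" for k t
  proof -
    define i where "i = nat \<lfloor>t * real m ^ Suc k\<rfloor>"
    have "\<lfloor>t * real m ^ Suc k / real m\<rfloor> = \<lfloor>t * real m ^ Suc k\<rfloor> div int m"
      using floor_divide_real_eq_div[of "int m" "t * real m ^ Suc k"] by simp
    moreover have "t * real m ^ Suc k / real m = t * real m ^ k" using m by simp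
    ultimately have i: "nat \<lfloor>t * real m ^ k\<rfloor> = i div m"
      unfolding i_def using t by (simp add: nat_div_distrib)
    let ?x = "A k (i div m)" and ?y = "A k (Suc (i div m))"
    have "dist (F k t) (F (Suc k) t) = dist ?x (ch ?x ?y (i mod m))"
      by (simp only: F_def i A_Suc i_def[symmetric])
    also have "\<dots> \<le> real (i mod m) * (dist ?x ?y / 2)" using m by (intro ch_dist AX) (simp add: less_imp_le)
    also have "\<dots> \<le> real m * (l / 2 ^ k)"
    proof (rule mult_mono)
      show "dist ?x ?y / 2 \<le> l / 2 ^ k" using A_step[of k "i div m"] zero_le_dist[of ?x ?y] by linarith
    qed (use m in \<open>auto simp: less_imp_le\<close>)
    finally show ?thesis by simp
  qed
  have "\<exists>y\<in>X. \<forall>k. dist (F k t) y \<le> 2 * (real m * l) / 2 ^ k" if "0 \<le> t" for t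
    using AX F_step[OF that] by (intro geometric_limit[OF X]) (auto simp: F_def l_def)
  then obtain f where f: "\<And>t. 0 \<le> t \<Longrightarrow> f t \<in> X" "\<And>t k. 0 \<le> t \<Longrightarrow> dist (F k t) (f t) \<le> 2 * (real m * l) / 2 ^ k"
    by metis
  have lim_eq: "f t = y" if "0 \<le> t" "\<And>k. F k t = y" for t y
  proof (rule ccontr)
    assume ne: "f t \<noteq> y"
    obtain k where "2 * (real m * l) / 2 ^ k < dist y (f t)"
      by (rule halving_eventually_small[of "2 * (real m * l)" "dist y (f t)"]) (use ne in \<open>auto simp: l_def\<close>)
    then show False using f(2)[OF that(1), of k] that(2)[of k] by simp
  qed
  have "continuous_on {0..1} f"
    unfolding continuous_on_iff
  proof (intro ballI allI impI)
    fix s e :: real assume s: "s \<in> {0..1}" and e: "0 < e"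
    \<comment> \<open>Two approximation errors of \<open>2 * (real m * l)\<close> and one step
      \<open>l\<close>, all to be divided by \<open>2 ^ k\<close>.\<close>
    define b where "b = 4 * (real m * l) + l"
    obtain k where k: "b / 2 ^ k < e"
      by (rule halving_eventually_small[of b e]) (use e in \<open>auto simp: b_def l_def\<close>)
    have close: "dist (f u) (f v) < e" if "0 \<le> u" "u \<le> v" "v - u < 1 / real m ^ k" for u v
    proof -
      have mk: "0 < real m ^ k" using m by simp
      have "(v - u) * real m ^ k < 1" using that(3) mk by (simp add: pos_less_divide_eq)
      then have "v * real m ^ k < u * real m ^ k + 1" by (simp add: algebra_simps)
      moreover have "u * real m ^ k \<le> v * real m ^ k" using that mk by (simp add: mult_right_mono)
      ultimately have "nat \<lfloor>v * real m ^ k\<rfloor> = nat \<lfloor>u * real m ^ k\<rfloor> \<or> nat \<lfloor>v * real m ^ k\<rfloor> = Suc (nat \<lfloor>u * real m ^ k\<rfloor>)"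
        using that mk by (intro nat_floor_diff_le_one) auto
      then have "dist (F k u) (F k v) \<le> l / 2 ^ k" using A_step[of k] by (auto simp: F_def l_def)
      moreover have "dist (f u) (f v) \<le> dist (F k u) (f u) + dist (F k u) (F k v) + dist (F k v) (f v)"
        using dist_triangle[of "f u" "f v" "F k u"] dist_triangle[of "F k u" "f v" "F k v"] by (simp add: dist_commute)
      moreover have "0 \<le> v" using that by simp
      ultimately have "dist (f u) (f v) \<le> 2 * (real m * l) / 2 ^ k + l / 2 ^ k + 2 * (real m * l) / 2 ^ k"
        using f(2)[of u k] f(2)[of v k] that(1) by linarith
      also have "\<dots> = b / 2 ^ k" by (simp add: b_def add_divide_distrib)
      finally show ?thesis using k by simp
    qed
    show "\<exists>d>0. \<forall>x'\<in>{0..1}. dist x' s < d \<longrightarrow> dist (f x') (f s) < e"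
    proof (intro exI[of _ "1 / real m ^ k"] conjI ballI impI)
      fix x assume x: "x \<in> {0..1}" "dist x s < 1 / real m ^ k"
      show "dist (f x) (f s) < e"
      proof (cases "x \<le> s")
        case True
        then show ?thesis using close[of x s] x s by (simp add: dist_real_def)
      next
        case False
        then show ?thesis using close[of s x] x s by (simp add: dist_real_def dist_commute)
      qed
    qed (use m in simp)
  qed
  then have "path f" by (simp add: path_def)
  moreover have "path_image f \<subseteq> X \<inter> cball p ((2 * real m + 1) * dist p q)"
  proof
    fix y assume "y \<in> path_image f"
    then obtain t where t: "0 \<le> t" "t \<le> 1" "y = f t" by (auto simp: path_image_def)
    have "dist p (F 0 t) \<le> l" by (simp add: F_def A0 l_def)
    moreover have "dist (F 0 t) (f t) \<le> 2 * (real m * l)" using f(2)[OF t(1), of 0] by simp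
    ultimately have "dist p y \<le> l + 2 * (real m * l)" using dist_triangle[of p y "F 0 t"] t by simp
    then show "y \<in> X \<inter> cball p ((2 * real m + 1) * dist p q)" using f(1) t by (simp add: l_def algebra_simps)
  qed
  moreover have "pathstart f = p" unfolding pathstart_def by (rule lim_eq) (auto simp: F_def A_start)
  moreover have "pathfinish f = q" unfolding pathfinish_def by (rule lim_eq) (auto simp: F_def intro!: A_end simp flip: of_nat_power)
  ultimately show thesis by (rule that)
qed

text \<open>The Kuratowski embedding \<open>\<phi>\<close>, sending \<open>x\<close> to the bounded
  function \<open>dist x y - dist a y\<close> of \<open>y\<close>, is isometric and moves the path
  into a Banach space, where \<open>path_contains_arc\<close> applies. The arc stays in the image of
  \<phi> and is pulled back.\<close>

lemma path_contains_arc_metric: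
  fixes p :: "real \<Rightarrow> 'a::metric_space"
  assumes "path p" "pathstart p = a" "pathfinish p = b" "a \<noteq> b"
  obtains q where "arc q" "path_image q \<subseteq> path_image p" "pathstart q = a" "pathfinish q = b"
proof -
  define \<phi> :: "'a \<Rightarrow> 'a \<Rightarrow>\<^sub>C real" where "\<phi> = (\<lambda>x. Bcontfun (\<lambda>y. dist x y - dist a y))"
  have app: "apply_bcontfun (\<phi> x) y = dist x y - dist a y" for x y
  proof -
    have "(\<lambda>y. dist x y - dist a y) \<in> bcontfun"
    proof (rule bcontfun_normI)
      show "continuous_on UNIV (\<lambda>y. dist x y - dist a y)" by (intro continuous_intros)
      show "norm (dist x y - dist a y) \<le> dist x a" for y
        using dist_triangle[of x y a] dist_triangle[of a y x] by (simp add: dist_commute abs_le_iff)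
    qed
    then show ?thesis by (simp add: \<phi>_def Bcontfun_inverse)
  qed
  have iso: "dist (\<phi> x) (\<phi> y) = dist x y" for x y
  proof (rule antisym)
    show "dist (\<phi> x) (\<phi> y) \<le> dist x y"
    proof (rule dist_bound)
      fix z show "dist (apply_bcontfun (\<phi> x) z) (apply_bcontfun (\<phi> y) z) \<le> dist x y"
        using dist_triangle[of x z y] dist_triangle[of y z x] by (simp add: app dist_real_def dist_commute abs_le_iff)
    qed
    show "dist x y \<le> dist (\<phi> x) (\<phi> y)"
      using dist_bounded[of "\<phi> x" y "\<phi> y"] by (simp add: app dist_real_def)
  qed
  have inj: "\<phi> x = \<phi> y \<Longrightarrow> x = y" for x y using iso[of x y] by simp
  have "continuous_on S \<phi>" for S unfolding continuous_on_iff iso by blast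
  then have "path (\<phi> \<circ> p)" using assms(1) unfolding path_def by (intro continuous_on_compose)
  moreover have "pathstart (\<phi> \<circ> p) = \<phi> a" "pathfinish (\<phi> \<circ> p) = \<phi> b" using assms(2,3) by (auto simp: pathstart_def pathfinish_def)
  moreover have "\<phi> a \<noteq> \<phi> b" using inj assms(4) by blast
  ultimately obtain q where q: "arc q" "path_image q \<subseteq> path_image (\<phi> \<circ> p)" "pathstart q = \<phi> a" "pathfinish q = \<phi> b"
    by (rule path_contains_arc)
  define h where "h = inv \<phi>"
  have h\<phi>: "h (\<phi> x) = x" for x unfolding h_def by (rule inv_f_f) (auto intro: injI inj)
  have qh: "\<phi> (h (q t)) = q t" "h (q t) \<in> path_image p" if "t \<in> {0..1}" for t
  proof -
    have "q t \<in> path_image (\<phi> \<circ> p)" using q(2) that by (auto simp: path_image_def)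
    then obtain s where "s \<in> {0..1}" "q t = \<phi> (p s)" by (auto simp: path_image_def)
    then show "\<phi> (h (q t)) = q t" "h (q t) \<in> path_image p" by (auto simp: h\<phi> path_image_def)
  qed
  have qd: "dist (h (q s)) (h (q t)) = dist (q s) (q t)" if "s \<in> {0..1}" "t \<in> {0..1}" for s t
    using iso[of "h (q s)" "h (q t)"] qh(1) that by simp
  show thesis
  proof (rule that[of "h \<circ> q"])
    have "continuous_on {0..1} q" "inj_on q {0..1}" using q(1) by (auto simp: arc_def path_def)
    then have "continuous_on {0..1} (h \<circ> q)" unfolding continuous_on_iff using qd by simp
    moreover have "inj_on (h \<circ> q) {0..1}"
    proof (rule inj_onI)
      fix s t assume st: "s \<in> {0..1}" "t \<in> {0..1}" "(h \<circ> q) s = (h \<circ> q) t"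
      then have "q s = q t" using qh(1) by (metis comp_apply)
      then show "s = t" using \<open>inj_on q {0..1}\<close> st by (auto dest: inj_onD)
    qed
    ultimately show "arc (h \<circ> q)" by (simp add: arc_def path_def)
    show "path_image (h \<circ> q) \<subseteq> path_image p" using qh(2) by (auto simp: path_image_def)
    show "pathstart (h \<circ> q) = a" "pathfinish (h \<circ> q) = b" using q(3,4) by (auto simp: pathstart_def pathfinish_def h\<phi>)
  qed
qed

section \<open>Arcs and leaves of a tree\<close>

text \<open>\<open>local_path\<close> records what the chains provide: paths that stay within a
  fixed multiple \<kappa> of the distance of their endpoints. All separation properties of arcs are
  derived from it.\<close>

locale turning_tree =
  fixes X :: "'a::metric_space set" and C \<kappa> :: real
  assumes compact_X: "compact X" and C1: "1 \<le> C" and \<kappa>: "0 \<le> \<kappa>"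
    and unique_arc: "\<And>x y. x \<in> X \<Longrightarrow> y \<in> X \<Longrightarrow> x \<noteq> y \<Longrightarrow> \<exists>!A. arc_between X x y A"
    and turning: "\<And>x y. x \<in> X \<Longrightarrow> y \<in> X \<Longrightarrow>
      \<exists>K\<subseteq>X. compact K \<and> connected K \<and> x \<in> K \<and> y \<in> K \<and> diameter K \<le> C * dist x y"
    and local_path: "\<And>p q. p \<in> X \<Longrightarrow> q \<in> X \<Longrightarrow>
      \<exists>f. path f \<and> path_image f \<subseteq> X \<inter> cball p (\<kappa> * dist p q) \<and> pathstart f = p \<and> pathfinish f = q"
begin

definition seg :: "'a \<Rightarrow> 'a \<Rightarrow> 'a set" where
  "seg x y = (if x = y then {x} else THE A. arc_between X x y A)"

lemma seg_arc: "x \<in> X \<Longrightarrow> y \<in> X \<Longrightarrow> x \<noteq> y \<Longrightarrow> arc_between X x y (seg x y)"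
  using theI'[OF unique_arc] by (simp add: seg_def)

lemma seg_unique: "x \<in> X \<Longrightarrow> y \<in> X \<Longrightarrow> x \<noteq> y \<Longrightarrow> arc_between X x y A \<Longrightarrow> A = seg x y"
  using unique_arc seg_arc by blast

lemma segE:
  assumes "x \<in> X" "y \<in> X" "x \<noteq> y"
  obtains g where "arc g" "g ` {0..1} = seg x y" "g 0 = x" "g 1 = y" "seg x y \<subseteq> X" "continuous_on {0..1} g" "inj_on g {0..1}"
  using seg_arc[OF assms] unfolding arc_between_def path_image_def pathstart_def pathfinish_def arc_def path_def
  by (metis (no_types, lifting) arc_def path_def)

lemma seg_basics:
  assumes "x \<in> X" "y \<in> X"
  shows "seg x y \<subseteq> X" "x \<in> seg x y" "y \<in> seg x y" "connected (seg x y)"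
proof -
  have "seg x y \<subseteq> X \<and> x \<in> seg x y \<and> y \<in> seg x y \<and> connected (seg x y)"
  proof (cases "x = y")
    case True
    then show ?thesis using assms by (simp add: seg_def)
  next
    case False
    obtain g :: "real \<Rightarrow> 'a" where g: "g ` {0..1} = seg x y" "g 0 = x" "g 1 = y" "seg x y \<subseteq> X" "continuous_on {0..1} g"
      by (rule segE[OF assms False]) (rule that)
    have "connected (g ` {0..1})" by (intro connected_continuous_image g) simp
    moreover have "g 0 \<in> g ` {0..1}" "g 1 \<in> g ` {0..1}" by auto
    ultimately show ?thesis using g by simp
  qed
  then show "seg x y \<subseteq> X" "x \<in> seg x y" "y \<in> seg x y" "connected (seg x y)" by auto
qed

text \<open>Every inner point \<open>z\<close> of the arc separates its endpoints in \<open>X\<close>: local paths make the path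
  components of \<open>X - {z}\<close> open, so a connected set avoiding \<open>z\<close> lies in one of them, and a path
  would contain a second arc.\<close>

lemma seg_subset_connected:
  assumes K: "connected K" "K \<subseteq> X" and xy: "x \<in> K" "y \<in> K"
  shows "seg x y \<subseteq> K"
proof
  fix z assume z: "z \<in> seg x y"
  show "z \<in> K"
  proof (rule ccontr)
    assume zK: "z \<notin> K"
    have xyX: "x \<in> X" "y \<in> X" using xy K by auto
    have ne: "x \<noteq> y" using z zK xy by (auto simp: seg_def)
    have "path_component (X - {z}) x y"
    proof (rule connected_equivalence_relation[OF K(1) xy])
      fix a assume a: "a \<in> K"
      \<comment> \<open>A local path from \<open>a\<close> to a point within \<open>d\<close> stays
        closer to \<open>a\<close> than \<open>z\<close> is, hence avoids \<open>z\<close>.\<close>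
      define d where "d = dist a z / (\<kappa> + 1)"
      have az: "0 < dist a z" using a zK by auto
      have d: "0 < d" using az \<kappa> by (simp add: d_def)
      have "path_component (X - {z}) a w" if w: "w \<in> K \<inter> ball a d" for w
      proof -
        have wd: "dist a w < d" using w by simp
        obtain f where f: "path f" "path_image f \<subseteq> X \<inter> cball a (\<kappa> * dist a w)" "pathstart f = a" "pathfinish f = w"
        proof -
          have "a \<in> X" "w \<in> X" using a w K by auto
          then show thesis using local_path[of a w] that by metis
        qed
        have "\<kappa> * dist a w \<le> \<kappa> * d" using wd \<kappa> by (intro mult_left_mono) auto
        also have "\<kappa> * d < (\<kappa> + 1) * d" using d by (simp add: distrib_right)
        also have "\<dots> = dist a z" using \<kappa> by (simp add: d_def)
        finally have "z \<notin> path_image f" using f(2) by auto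
        then have "path_image f \<subseteq> X - {z}" using f(2) by blast
        then show ?thesis unfolding path_component_def using f(1,3,4) by blast
      qed
      then show "\<exists>T. openin (top_of_set K) T \<and> a \<in> T \<and> (\<forall>w\<in>T. path_component (X - {z}) a w)"
        using a d by (intro exI[of _ "K \<inter> ball a d"]) (auto intro: openin_open_Int)
    qed (blast intro: path_component_sym path_component_trans)+
    then obtain f where f: "path f" "path_image f \<subseteq> X - {z}" "pathstart f = x" "pathfinish f = y"
      unfolding path_component_def by blast
    obtain g where g: "arc g" "path_image g \<subseteq> path_image f" "pathstart g = x" "pathfinish g = y"
      by (rule path_contains_arc_metric[OF f(1,3,4) ne])
    have "arc_between X x y (path_image g)" unfolding arc_between_def using f g by blast
    then have "path_image g = seg x y" by (rule seg_unique[OF xyX ne])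
    then show False using z f g by blast
  qed
qed

lemma seg_sub: "x \<in> X \<Longrightarrow> y \<in> X \<Longrightarrow> w \<in> seg x y \<Longrightarrow> v \<in> seg x y \<Longrightarrow> seg w v \<subseteq> seg x y"
  by (rule seg_subset_connected) (auto dest: seg_basics)

lemma seg_commute: "x \<in> X \<Longrightarrow> y \<in> X \<Longrightarrow> seg x y = seg y x"
  using seg_sub[of x y y x] seg_sub[of y x x y] seg_basics[of x y] seg_basics[of y x] by blast

lemma seg_triangle: assumes "x \<in> X" "y \<in> X" "z \<in> X" shows "seg x y \<subseteq> seg x z \<union> seg z y"
proof (rule seg_subset_connected)
  show "connected (seg x z \<union> seg z y)"
    by (rule connected_Un) (use seg_basics[of x z] seg_basics[of z y] assms in auto)
qed (use seg_basics[of x z] seg_basics[of z y] assms in auto)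

text \<open>The continuum supplied by bounded turning contains the arc, so the arc itself inherits
  the diameter bound.\<close>

lemma seg_dist: assumes "x \<in> X" "y \<in> X" "u \<in> seg x y" "v \<in> seg x y" shows "dist u v \<le> C * dist x y"
proof -
  obtain K where K: "K \<subseteq> X" "compact K" "connected K" "x \<in> K" "y \<in> K" "diameter K \<le> C * dist x y"
    using turning[OF assms(1,2)] by blast
  have "seg x y \<subseteq> K" by (rule seg_subset_connected) fact+
  then have "dist u v \<le> diameter K"
    using assms by (intro diameter_bounded_bound compact_imp_bounded K) auto
  then show ?thesis using K by simp
qed

text \<open>The part of the arc from \<open>x\<close> to \<open>w'\<close> up to the parameter of
  \<open>w\<close> is connected, hence contains \<open>seg x w\<close>. It can contain the endpoint
  \<open>w'\<close> only if it is the whole arc.\<close>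

lemma seg_antisym:
  assumes "x \<in> X" "w \<in> X" "w' \<in> X" "w \<in> seg x w'" "w' \<in> seg x w"
  shows "w = w'"
proof (cases "x = w'")
  case True
  then show ?thesis using assms by (simp add: seg_def)
next
  case False
  obtain g :: "real \<Rightarrow> 'a" where g: "g ` {0..1} = seg x w'" "g 0 = x" "g 1 = w'" "seg x w' \<subseteq> X" "continuous_on {0..1} g" "inj_on g {0..1}"
    by (rule segE[OF assms(1,3) False]) (rule that)
  obtain t where t: "t \<in> {0..1}" "w = g t" using assms(4) g(1) by (metis imageE)
  have "connected (g ` {0..t})" by (intro connected_continuous_image continuous_on_subset[OF g(5)]) (use t in auto)
  moreover have "g ` {0..t} \<subseteq> X" using g t by (metis atLeastatMost_subset_iff atLeastAtMost_iff dual_order.trans image_mono order_refl)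
  moreover have "x \<in> g ` {0..t}" "w \<in> g ` {0..t}" using g(2) t by auto
  ultimately have "seg x w \<subseteq> g ` {0..t}" by (rule seg_subset_connected)
  then obtain u where u: "u \<in> {0..t}" "w' = g u" using assms(5) by blast
  then have "u = 1" using inj_onD[OF g(6), of u 1] g(3) t by auto
  then show ?thesis using u t g(3) by auto
qed

text \<open>A subarc, reparametrised affinely, is the unique arc between its endpoints, so
  \<open>seg_dist\<close> holds on every parameter interval. This is the turning condition that the
  arc embedding uses.\<close>

lemma arc_turning:
  fixes g :: "real \<Rightarrow> 'a"
  assumes xy: "x \<in> X" "y \<in> X" "x \<noteq> y"
    and g: "g ` {0..1} = seg x y" "g 0 = x" "g 1 = y" "continuous_on {0..1} g" "inj_on g {0..1}"
    and st: "0 \<le> s" "s \<le> u" "u \<le> v" "v \<le> t" "t \<le> 1"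
  shows "dist (g u) (g v) \<le> C * dist (g s) (g t)"
proof (cases "s = t")
  case True
  then have "u = v" using st by simp
  then show ?thesis using C1 by simp
next
  case False
  define h where "h = (\<lambda>\<tau>. g (s + \<tau> * (t - s)))"
  have sub: "g ` {s..t} \<subseteq> X" using g(1) seg_basics(1)[OF xy(1,2)] st by fastforce
  have st': "s < t" using False st by simp
  have range: "s + \<tau> * (t - s) \<in> {s..t}" if "\<tau> \<in> {0..1}" for \<tau>
  proof -
    have "0 \<le> \<tau> * (t - s)" using that st' by simp
    moreover have "\<tau> * (t - s) \<le> 1 * (t - s)" by (rule mult_right_mono) (use that st' in auto)
    ultimately show ?thesis by simp
  qed
  have "continuous_on {0..1} h"
    unfolding h_def by (intro continuous_on_compose2[OF g(4)] continuous_intros) (use range st in fastforce)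
  moreover have "inj_on h {0..1}"
  proof (rule inj_onI)
    fix a b assume ab: "a \<in> {0..1}" "b \<in> {0..1}" "h a = h b"
    have "s + a * (t - s) = s + b * (t - s)"
      using ab range[OF ab(1)] range[OF ab(2)] st by (intro inj_onD[OF g(5)]) (auto simp: h_def)
    then show "a = b" using st' by simp
  qed
  ultimately have "arc h" by (simp add: arc_def path_def)
  moreover have "path_image h = g ` {s..t}"
  proof -
    have "(\<lambda>\<tau>. s + \<tau> * (t - s)) ` {0..1} = {s..t}"
    proof
      show "{s..t} \<subseteq> (\<lambda>\<tau>. s + \<tau> * (t - s)) ` {0..1}"
      proof
        fix a assume "a \<in> {s..t}"
        then show "a \<in> (\<lambda>\<tau>. s + \<tau> * (t - s)) ` {0..1}"
          using st' by (intro image_eqI[of _ _ "(a - s) / (t - s)"]) auto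
      qed
    qed (use range in auto)
    then show ?thesis unfolding path_image_def h_def by (metis image_image)
  qed
  ultimately have "arc_between X (g s) (g t) (g ` {s..t})"
    unfolding arc_between_def using sub by (auto simp: pathstart_def pathfinish_def h_def)
  moreover have "g s \<in> X" "g t \<in> X" using sub st by auto
  moreover have "g s \<noteq> g t" using inj_onD[OF g(5), of s t] st st' by auto
  ultimately have "g ` {s..t} = seg (g s) (g t)" using seg_unique by blast
  then show ?thesis using \<open>g s \<in> X\<close> \<open>g t \<in> X\<close> st by (intro seg_dist) auto
qed

text \<open>If \<open>c\<close> lies on \<open>seg x v\<close> but not on \<open>seg x w\<close>,
  then it lies on \<open>seg w v\<close>, whence \<open>dist c w \<le> C * dist w v\<close>; this
  fails for \<open>v\<close> close to \<open>w\<close>. Closedness provides upper bounds of chains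
  by compactness.\<close>

lemma closed_beyond: assumes "x \<in> X" "c \<in> X" shows "closed {w \<in> X. c \<in> seg x w}"
proof -
  have "w \<in> X \<and> c \<in> seg x w" if "w \<in> closure {w \<in> X. c \<in> seg x w}" for w
  proof -
    have "closure {w \<in> X. c \<in> seg x w} \<subseteq> X" by (rule closure_minimal) (use compact_X compact_imp_closed in auto)
    then have w: "w \<in> X" using that by blast
    have "c \<in> seg x w"
    proof (rule ccontr)
      assume no: "c \<notin> seg x w"
      then have "0 < dist c w" using seg_basics[OF assms(1) w] by auto
      then have "0 < dist c w / (C + 1)" using C1 by simp
      then obtain v where v: "v \<in> X" "c \<in> seg x v" "dist v w < dist c w / (C + 1)"
        using \<open>w \<in> closure _\<close> unfolding closure_approachable by blast
      have "c \<in> seg w v" using seg_triangle[OF assms(1) v(1) w] v no by blast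
      then have "dist c w \<le> C * dist w v" using seg_basics[OF w v(1)] by (intro seg_dist w v) auto
      also have "\<dots> \<le> (C + 1) * dist w v" by (simp add: mult_right_mono)
      also have "\<dots> < dist c w" using v(3) C1 by (simp add: pos_less_divide_eq dist_commute mult.commute)
      finally show False by simp
    qed
    then show ?thesis using w by simp
  qed
  then have "closure {w \<in> X. c \<in> seg x w} \<subseteq> {w \<in> X. c \<in> seg x w}" by blast
  then show ?thesis using closure_subset closed_closure by (metis (no_types, lifting) antisym)
qed

text \<open>A point that is maximal for the order \<open>w \<le> w' \<longleftrightarrow> w \<in> seg x w'\<close> is a leaf, since otherwise an arc
  from \<open>x\<close> into another component of its complement extends beyond it.\<close>

lemma leaf_beyond:
  assumes x: "x \<in> X" and y: "y \<in> X"
  obtains e where "e \<in> leaves X" "y \<in> seg x e"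
proof -
  define A where "A = {w \<in> X. y \<in> seg x w}"
  define le where "le = (\<lambda>w w'. w \<in> seg x w')"
  have yA: "y \<in> A" using seg_basics[OF x y] y by (simp add: A_def)
  have AX: "A \<subseteq> X" by (auto simp: A_def)
  have trans: "le a c" if "le a b" "le b c" "b \<in> X" "c \<in> X" for a b c
    using seg_sub[of x c x b] that x seg_basics[of x c] by (auto simp: le_def)
  have up: "w' \<in> A" if "w \<in> A" "le w w'" "w' \<in> X" for w w'
    using seg_sub[of x w' x w] that x seg_basics[of x w'] by (auto simp: A_def le_def)
  have po: "partial_order_on A (relation_of le A)"
  proof (rule partial_order_on_relation_ofI)
    show "le a a" if "a \<in> A" for a using seg_basics[of x a] that x AX by (auto simp: le_def)
    show "le a c" if "a \<in> A" "b \<in> A" "c \<in> A" "le a b" "le b c" for a b c using trans that AX by blast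
    show "a = b" if "a \<in> A" "b \<in> A" "le a b" "le b a" for a b
      using seg_antisym[of x a b] that x AX by (auto simp: le_def)
  qed
  have "\<exists>m\<in>A. \<forall>a\<in>A. le m a \<longrightarrow> a = m"
  proof (rule predicate_Zorn[OF po])
    fix Ch assume Ch: "Ch \<in> Chains (relation_of le A)"
    have ChA: "Ch \<subseteq> A" and tot: "\<And>a b. a \<in> Ch \<Longrightarrow> b \<in> Ch \<Longrightarrow> le a b \<or> le b a"
      using Ch by (auto simp: Chains_def relation_of_def)
    show "\<exists>u\<in>A. \<forall>a\<in>Ch. le a u"
    proof (cases "Ch = {}")
      case True
      then show ?thesis using yA by auto
    next
      case False
      have max: "\<exists>u\<in>F. \<forall>a\<in>F. le a u" if "finite F" "F \<noteq> {}" "F \<subseteq> Ch" for F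
        using that
      proof (induction F rule: finite_ne_induct)
        case (singleton a)
        then show ?case using seg_basics[of x a] x ChA AX by (auto simp: le_def)
      next
        case (insert a F)
        then obtain u where u: "u \<in> F" "\<forall>b\<in>F. le b u" by auto
        have X: "a \<in> X" "u \<in> X" using insert u ChA AX by auto
        have "le a u \<or> le u a" using tot insert u by blast
        then show ?case
        proof
          assume "le a u"
          then show ?thesis using u by blast
        next
          assume "le u a"
          then have "\<forall>b\<in>F. le b a" using trans u X by blast
          moreover have "le a a" using seg_basics[of x a] x X by (auto simp: le_def)
          ultimately show ?thesis by blast
        qed
      qed
      \<comment> \<open>Finitely many members of the chain have a greatest one, so the closed sets
        of points beyond the members have the finite intersection property.\<close>
      have "X \<inter> \<Inter>((\<lambda>c. {w \<in> X. c \<in> seg x w}) ` Ch) \<noteq> {}"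
      proof (rule compact_imp_fip[OF compact_X])
        show "closed T" if "T \<in> (\<lambda>c. {w \<in> X. c \<in> seg x w}) ` Ch" for T
          using that closed_beyond[OF x] ChA AX by auto
        fix F' assume "finite F'" "F' \<subseteq> (\<lambda>c. {w \<in> X. c \<in> seg x w}) ` Ch"
        then obtain F where F: "F \<subseteq> Ch" "finite F" "F' = (\<lambda>c. {w \<in> X. c \<in> seg x w}) ` F"
          by (meson finite_subset_image)
        show "X \<inter> \<Inter>F' \<noteq> {}"
        proof (cases "F = {}")
          case True
          then show ?thesis using F x by auto
        next
          case ne: False
          obtain u where "u \<in> F" "\<forall>a\<in>F. le a u" using max[OF F(2) ne F(1)] by blast
          then have "u \<in> X \<inter> \<Inter>F'" using F ChA AX by (auto simp: le_def)
          then show ?thesis by blast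
        qed
      qed
      then obtain u where u: "u \<in> X" "\<forall>c\<in>Ch. le c u" by (auto simp: le_def)
      moreover obtain c where "c \<in> Ch" using False by blast
      ultimately have "u \<in> A" using up ChA by blast
      then show ?thesis using u by blast
    qed
  qed
  then obtain m where m: "m \<in> A" "\<And>a. a \<in> A \<Longrightarrow> le m a \<Longrightarrow> a = m" by blast
  have mX: "m \<in> X" using m AX by blast
  have no_ext: "u = m" if "u \<in> X" "m \<in> seg x u" for u
    using m(2)[of u] up[OF m(1), of u] that by (simp add: le_def)
  have "connected (X - {m})"
  \<comment> \<open>If \<open>m = x\<close>, every point of \<open>X\<close> lies beyond
    \<open>m\<close> and maximality leaves no other point. Otherwise the arcs from \<open>x\<close>
    to the remaining points all avoid \<open>m\<close>.\<close>
  proof (cases "m = x")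
    case True
    have "u = m" if "u \<in> X" for u using no_ext[OF that] seg_basics[OF x that] True by simp
    then have "X - {m} = {}" by blast
    then show ?thesis by (metis connected_empty)
  next
    case False
    have "connected_component (X - {m}) x u" if u: "u \<in> X - {m}" for u
      unfolding connected_component_def
    proof (intro exI conjI)
      show "connected (seg x u)" "seg x u \<subseteq> X - {m}" "x \<in> seg x u" "u \<in> seg x u"
        using seg_basics[OF x, of u] u no_ext[of u] by auto
    qed
    then show ?thesis unfolding connected_iff_connected_component
      by (meson connected_component_sym connected_component_trans)
  qed
  then have "m \<in> leaves X" using mX by (simp add: leaves_def)
  then show thesis using that m(1) by (auto simp: A_def)
qed

text \<open>An arc from \<open>x\<close> through a point \<open>y\<close> within
  \<open>d / 8\<close> reaches a leaf, so beyond \<open>y\<close> it meets the sphere of radius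
  \<open>d / 2\<close> at some \<open>z\<close>. A net point \<open>z'\<close> within
  \<open>d / (8 * C)\<close> of \<open>z\<close> is joined to \<open>z\<close> by an arc whose
  points are within \<open>d / 8\<close> of \<open>z\<close>. This arc cannot pass through
  \<open>y\<close>, so \<open>y\<close> also lies on \<open>seg x z'\<close>.\<close>

lemma ball_covered_by_segs:
  assumes M: "separation_bound X (1 / (8 * C)) M" and x: "x \<in> X" and \<delta>: "0 < infdist x (leaves X)"
  obtains Z where "finite Z" "card Z \<le> M" "Z \<subseteq> X - {x}" "X \<inter> ball x (1 / 8 * infdist x (leaves X)) \<subseteq> (\<Union>z\<in>Z. seg x z)"
proof -
  define d where "d = infdist x (leaves X)"
  have d: "0 < d" using \<delta> by (simp add: d_def)
  define Sph where "Sph = {z \<in> X. dist x z = d / 2}"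
  have "Sph \<subseteq> X \<inter> ball x d" using d by (auto simp: Sph_def)
  then obtain Z where Z: "Z \<subseteq> Sph" "finite Z" "card Z \<le> M"
      "\<And>a. a \<in> Sph \<Longrightarrow> \<exists>s\<in>Z. dist a s < 1 / (8 * C) * d \<or> a = s"
    using separation_bound_net[OF M x d] by metis
  have "\<exists>z\<in>Z. y \<in> seg x z" if y: "y \<in> X" "dist x y < d / 8" for y
  proof -
    obtain e where e: "e \<in> leaves X" "y \<in> seg x e" by (rule leaf_beyond[OF x y(1)])
    have eX: "e \<in> X" using e by (simp add: leaves_def)
    have "d \<le> dist x e" unfolding d_def by (rule infdist_le[OF e(1)])
    have "connected (dist x ` seg y e)"
      by (intro connected_continuous_image continuous_intros seg_basics y eX)
    moreover have "dist x y \<in> dist x ` seg y e" "dist x e \<in> dist x ` seg y e" using seg_basics[OF y(1) eX] by auto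
    ultimately have "d / 2 \<in> dist x ` seg y e"
      by (rule connectedD_interval) (use \<open>d \<le> dist x e\<close> y d in auto)
    then obtain z where z: "z \<in> seg y e" "dist x z = d / 2" by auto
    have zX: "z \<in> X" using z seg_basics[OF y(1) eX] by blast
    have yz: "y \<in> seg x z"
    proof (rule ccontr)
      assume "y \<notin> seg x z"
      then have "y \<in> seg z e" using seg_triangle[OF x eX zX] e by blast
      then have "y = z" using seg_antisym[OF eX y(1) zX] z seg_commute eX y(1) zX by blast
      then show False using z y d by simp
    qed
    obtain z' where z': "z' \<in> Z" "dist z z' < 1 / (8 * C) * d \<or> z = z'" using Z(4)[of z] z zX by (auto simp: Sph_def)
    have z'X: "z' \<in> X" using z' Z by (auto simp: Sph_def)
    have "dist z z' < 1 / (8 * C) * d" using z' d C1 by auto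
    then have "C * dist z z' < C * (1 / (8 * C) * d)" using C1 by (intro mult_strict_left_mono) auto
    then have Cz: "C * dist z z' < d / 8" using C1 by simp
    have "y \<in> seg x z'"
    proof (rule ccontr)
      assume "y \<notin> seg x z'"
      then have "y \<in> seg z' z" using seg_triangle[OF x zX z'X] yz by blast
      then have "dist y z \<le> C * dist z' z" using seg_basics[OF z'X zX] by (intro seg_dist z'X zX) auto
      then have "dist y z < d / 8" using Cz by (simp add: dist_commute)
      moreover have "d / 2 \<le> dist x y + dist y z" using dist_triangle[of x z y] z by simp
      ultimately show False using y d by simp
    qed
    then show ?thesis using z' by blast
  qed
  then have "X \<inter> ball x (1 / 8 * infdist x (leaves X)) \<subseteq> (\<Union>z\<in>Z. seg x z)" by (auto simp: d_def[symmetric])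
  moreover have "Z \<subseteq> X - {x}" using Z d by (auto simp: Sph_def)
  ultimately show thesis using that Z by blast
qed

end

section \<open>The embedding theorem\<close>

lemma (in turning_tree) seg_coord_embeds:
  assumes sb: "\<And>e. 0 < e \<Longrightarrow> \<exists>M. separation_bound X e M"
  obtains n L where "1 \<le> L" "\<And>x y. x \<in> X \<Longrightarrow> y \<in> X \<Longrightarrow> x \<noteq> y \<Longrightarrow> coord_embeds n L (seg x y)"
proof -
  obtain n L where nL: "\<forall>g. continuous_on {0..1::real} g \<longrightarrow> g ` {0..1} \<subseteq> X \<longrightarrow> g 0 \<noteq> g 1 \<longrightarrow>
     (\<forall>s u v t. 0 \<le> s \<longrightarrow> s \<le> u \<longrightarrow> u \<le> v \<longrightarrow> v \<le> t \<longrightarrow> t \<le> 1 \<longrightarrow> dist (g u) (g v) \<le> C * dist (g s) (g t)) \<longrightarrow>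
     coord_embeds n L (g ` {0..1})"
    using quasiarc_coord_embeds[OF sb C1] by blast
  \<comment> \<open>\<open>coord_embeds_UN\<close> works with a constant of at least 1.\<close>
  have "coord_embeds n (max 1 L) (seg x y)" if xy: "x \<in> X" "y \<in> X" "x \<noteq> y" for x y
  proof -
    obtain g :: "real \<Rightarrow> 'a" where g: "g ` {0..1} = seg x y" "g 0 = x" "g 1 = y" "seg x y \<subseteq> X"
        "continuous_on {0..1} g" "inj_on g {0..1}"
      by (rule segE[OF xy]) (rule that)
    have turn: "\<forall>s u v t. 0 \<le> s \<longrightarrow> s \<le> u \<longrightarrow> u \<le> v \<longrightarrow> v \<le> t \<longrightarrow> t \<le> 1 \<longrightarrow> dist (g u) (g v) \<le> C * dist (g s) (g t)"
      by (intro allI impI arc_turning[OF xy g(1-3,5,6)])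
    have "g ` {0..1} \<subseteq> X" "g 0 \<noteq> g 1" using g(1-4) xy(3) by auto
    then have "coord_embeds n L (g ` {0..1})" using nL g(5) turn by blast
    then have "coord_embeds n L (seg x y)" by (simp only: g(1))
    then show ?thesis by (rule coord_embeds_mono) auto
  qed
  then show thesis using that[of "max 1 L" n] by simp
qed

lemma (in turning_tree) coord_embeds_if_leaves:
  assumes sb: "\<And>e. 0 < e \<Longrightarrow> \<exists>M. separation_bound X e M" and ne: "X \<noteq> {}"
    and E: "coord_embeds n0 L0 (leaves X)"
  shows "\<exists>n L. coord_embeds n L X"
proof -
  obtain n L where nL: "1 \<le> L" "\<And>x y. x \<in> X \<Longrightarrow> y \<in> X \<Longrightarrow> x \<noteq> y \<Longrightarrow> coord_embeds n L (seg x y)"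
    by (rule seg_coord_embeds[OF sb]) (assumption, rule that)
  have "0 < 1 / (8 * C)" using C1 by simp
  then obtain M where M: "separation_bound X (1 / (8 * C)) M" using sb by blast
  obtain x0 where "x0 \<in> X" using ne by blast
  then have "leaves X \<noteq> {}" using leaf_beyond[of x0 x0] by blast
  then show ?thesis
  proof (rule whitney_gluing[OF sb _ E, of "1 / 8" "M * Suc n" "3 * L\<^sup>2", rotated 1])
    fix x assume x: "x \<in> X" "0 < infdist x (leaves X)"
    obtain Z where Z: "finite Z" "card Z \<le> M" "Z \<subseteq> X - {x}"
      "X \<inter> ball x (1 / 8 * infdist x (leaves X)) \<subseteq> (\<Union>z\<in>Z. seg x z)"
      by (rule ball_covered_by_segs[OF M x])
    have "coord_embeds n L (seg x z)" if "z \<in> Z" for z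
      using nL(2)[of x z] that Z(3) x(1) by blast
    from coord_embeds_UN[OF Z(1,2) nL(1) this]
    show "coord_embeds (M * Suc n) (3 * L\<^sup>2) (X \<inter> ball x (1 / 8 * infdist x (leaves X)))"
      by (rule coord_embeds_mono) (use Z(4) in auto)
  qed auto
qed

theorem theorem1p8:
  fixes X :: "'a::metric_space set"
  assumes "quasiconformal_tree X"
  shows "bilipschitz_embeds_Euclidean X \<longleftrightarrow> bilipschitz_embeds_Euclidean (leaves X)"
  unfolding bilipschitz_embeds_Euclidean_iff
proof
  assume "\<exists>n L. coord_embeds n L X"
  moreover have "leaves X \<subseteq> X" by (auto simp: leaves_def)
  ultimately show "\<exists>n L. coord_embeds n L (leaves X)" using coord_embeds_mono by blast
next
  assume "\<exists>n L. coord_embeds n L (leaves X)"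
  then obtain n0 L0 where E: "coord_embeds n0 L0 (leaves X)" by blast
  have tree: "metric_tree X" and dbl: "doubling X" and "bounded_turning X"
    using assms by (auto simp: quasiconformal_tree_def)
  then obtain C0 where C0: "\<And>x y. x \<in> X \<Longrightarrow> y \<in> X \<Longrightarrow>
      \<exists>K\<subseteq>X. compact K \<and> connected K \<and> x \<in> K \<and> y \<in> K \<and> diameter K \<le> C0 * dist x y"
    unfolding bounded_turning_def by blast
  define C where "C = max 1 C0"
  have turning: "\<exists>K\<subseteq>X. compact K \<and> connected K \<and> x \<in> K \<and> y \<in> K \<and> diameter K \<le> C * dist x y"
    if xy: "x \<in> X" "y \<in> X" for x y
  proof -
    obtain K where K: "K \<subseteq> X" "compact K" "connected K" "x \<in> K" "y \<in> K" "diameter K \<le> C0 * dist x y"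
      using C0[OF xy] by blast
    have "C0 * dist x y \<le> C * dist x y" by (rule mult_right_mono) (auto simp: C_def)
    then have "diameter K \<le> C * dist x y" using K(6) by linarith
    then show ?thesis using K(1-5) by blast
  qed
  have sb: "\<exists>M. separation_bound X e M" if "0 < e" for e
    by (rule doubling_imp_separation_bound[OF dbl that]) blast
  have C1: "1 \<le> C" by (simp add: C_def)
  then have C: "0 \<le> C" by linarith
  obtain m :: nat where m: "0 < m" and chain: "\<And>p q. p \<in> X \<Longrightarrow> q \<in> X \<Longrightarrow> \<exists>c. c 0 = p \<and> c m = q \<and>
      (\<forall>j\<le>m. c j \<in> X) \<and> (\<forall>j<m. dist (c j) (c (Suc j)) \<le> dist p q / 2)"
    by (rule bounded_turning_chain[of X C]) (erule sb, rule C, erule (1) turning, rule that)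
  have compact: "compact X" using tree by (simp add: metric_tree_def)
  interpret turning_tree X C "2 * real m + 1"
  proof
    show "\<exists>!A. arc_between X x y A" if "x \<in> X" "y \<in> X" "x \<noteq> y" for x y
      using tree that by (simp add: metric_tree_def)
    show "\<exists>f. path f \<and> path_image f \<subseteq> X \<inter> cball p ((2 * real m + 1) * dist p q) \<and> pathstart f = p \<and> pathfinish f = q"
      if "p \<in> X" "q \<in> X" for p q
      by (rule chain_imp_path[OF compact_imp_complete[OF compact] m chain that]) (assumption+, blast)
  qed (use compact C1 turning in auto)
  show "\<exists>n L. coord_embeds n L X"
  \<comment> \<open>The gluing starts from a nonempty set \<open>E\<close>; an empty tree coincides
    with its set of leaves.\<close>
  proof (cases "X = {}")
    case True
    then have "leaves X = X" by (simp add: leaves_def)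
    then show ?thesis using E by auto
  next
    case False
    then show ?thesis using coord_embeds_if_leaves[OF sb _ E] by blast
  qed
qed

end
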